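(* Let $r\ge 1$ be an integer, let $\mathbb{T}$ be a bounded time scale with at least $2r+1$ points, and put $a:=\min\mathbb{T}$, $b:=\max\mathbb{T}$. Let $L:[a,\rho^{r}(b)]_{\mathbb{T}}\times\mathbb{R}^{r+1}\to\mathbb{R}$, $(t,u_1,\ldots,u_{r+1})\mapsto L(t,u_1,\ldots,u_{r+1})$, have continuous partial derivatives $\frac{\partial L}{\partial u_i}$ for all $t\in[a,\rho^r(b)]_{\mathbb{T}}$, $i=1,\ldots,r+1$, let $y_a^i,y_b^i\in\mathbb{R}$ for $i=0,\ldots,r-1$, and consider the problem $$\mathcal{L}(y(\cdot))=\int_a^{\rho^{r-1}(b)}L\left(t,y(t),y^{\Delta}(t),\ldots,y^{\Delta^r}(t)\right)\Delta t\longrightarrow\min \qquad (P)$$ subject to the boundary conditions $$y^{\Delta^i}(a)=y_a^i,\qquad y^{\Delta^i}\left(\rho^{r-1}(b)\right)=y_b^i,\qquad i=0,\ldots,r-1. \qquad (BC)$$ Assume that for every admissible $y(\cdot)$ (i.e. $y\in C^r_{prd}$ satisfying (BC)) the functions $t\mapsto L[y](t)$ and $t\mapsto\frac{\partial L}{\partial u_i}[y](t)$, $i=1,\ldots,r+1$, are piecewise rd-continuous, where $L[y](t)=L(t,y(t),y^\Delta(t),\ldots,y^{\Delta^r}(t))$ and similarly for the partial derivatives. Write $\frac{\partial L}{\partial y^{\Delta^i}}:=\frac{\partial L}{\partial u_{i+1}}$ for $i=0,\ldots,r$. If $y(\cdot)$ is a weak local minimizer for (P)--(BC), then there exist constants $c_1,\ldots,c_r$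 such that $y(\cdot)$ satisfies, for all $t\in[a,\rho^r(b)]_{\mathbb{T}}$, the Euler-Lagrange equation $$\begin{aligned} &\frac{\partial L}{\partial y^{\Delta^r}}[y](t)-\int_a^{\sigma(t)}\frac{\partial L}{\partial y^{\Delta^{r-1}}}[y](\tau_r)\,\Delta\tau_r\\ &+\sum_{i=0}^{r-3}(-1)^i\int_a^{\sigma(t)}\int_a^{\sigma(\tau_r)}\cdots\int_a^{\sigma(\tau_{r-i})}\frac{\partial L}{\partial y^{\Delta^{r-2-i}}}[y](\tau_{r-1-i})\,\Delta\tau_{r-1-i}\cdots\Delta\tau_{r-1}\Delta\tau_r\\ &+(-1)^r\int_a^{\sigma(t)}\left\{\int_a^{\sigma(\tau_r)}\left[\cdots\int_a^{\sigma(\tau_2)}\frac{\partial L}{\partial y}[y](\tau_1)\,\Delta\tau_1+c_1\cdots\right]\Delta\tau_{r-1}-(-1)^{r-1}c_{r-1}\right\}\Delta\tau_r-c_r=0, \end{aligned}$$ where the sum over $i$ is empty if $r\le 2$, and the last line means $(-1)^r\int_a^{\sigma(t)}G_{r-1}(\tau_r)\,\Delta\tau_r-c_r$ with $G_1(s)=\int_a^{\sigma(s)}\frac{\partial L}{\partial y}[y](\tau_1)\,\Delta\tau_1+c_1$ and $G_k(s)=\int_a^{\sigma(s)}G_{k-1}(\tau_k)\,\Delta\tau_k-(-1)^kc_k$ for $2\le k\le r-1$. For $r=1$ the equation reads $\frac{\partial L}{\partial y^{\Delta}}[y](t)-\int_a^{\sigma(t)}\frac{\partial L}{\partial y}[y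](\tau_1)\,\Delta\tau_1-c_1=0$.
   Context: A time scale $\mathbb{T}$ is a nonempty closed subset of $\mathbb{R}$. The forward and backward jump operators $\sigma,\rho:\mathbb{T}\to\mathbb{T}$ are $\sigma(t)=\inf\{s\in\mathbb{T}:s>t\}$ (with $\inf\emptyset=\sup\mathbb{T}$) and $\rho(t)=\sup\{s\in\mathbb{T}:s<t\}$ (with $\sup\emptyset=\inf\mathbb{T}$); $\sigma^n,\rho^n$ denote $n$-fold compositions, $\sigma^0=\rho^0=\mathrm{id}$. A point $t$ is right-dense if $\sigma(t)=t$ and left-dense if $\rho(t)=t$. Notation: $[c,d]_{\mathbb{T}}:=[c,d]\cap\mathbb{T}$. With $b=\max\mathbb{T}$, $\mathbb{T}^{\kappa}:=\mathbb{T}\setminus(\rho(b),b]$, $\mathbb{T}^{\kappa^0}:=\mathbb{T}$, $\mathbb{T}^{\kappa^n}:=(\mathbb{T}^{\kappa^{n-1}})^{\kappa}$. A function $f:\mathbb{T}\to\mathbb{R}$ is delta-differentiable at $t\in\mathbb{T}^\kappa$ with delta derivative $f^\Delta(t)$ if for every $\varepsilon>0$ there is a neighborhood $U$ of $t$ with $|f(\sigma(t))-f(s)-f^\Delta(t)(\sigma(t)-s)|\le\varepsilon|\sigma(t)-s|$ for all $s\in U$. Put $f^{\Delta^0}=f$; the $r$th delta derivative $f^{\Delta^r}:\mathbb{T}^{\kappa^r}\to\mathbb{R}$ is $(f^{\Delta^{r-1}})^\Delta$, provided $f^{\Delta^{r-1}}$ is delta-differentiable on $\mathbb{T}^{\kappa^r}$.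 $f$ is rd-continuous if it is continuous at right-dense points and its left-sided limits exist at left-dense points. $f\in C^r_{prd}$ means that $f^{\Delta^i}$ is continuous for $i=0,\ldots,r-1$, and $f^{\Delta^r}$ exists and is rd-continuous for all, except possibly finitely many, $t\in\mathbb{T}^{\kappa^r}$. A piecewise rd-continuous $f$ has an antiderivative $F$, $F^\Delta=f$, and the delta integral is $\int_c^d f(t)\Delta t=F(d)-F(c)$ for $c,d\in\mathbb{T}$. An admissible $y(\cdot)$ is a weak local minimizer for (P)--(BC) if there is $\delta>0$ such that $\mathcal{L}(y(\cdot))\le\mathcal{L}(\bar y(\cdot))$ for every admissible $\bar y\in C^r_{prd}$ with $\|y-\bar y\|_{r,\infty}<\delta$, where $\|y\|_{r,\infty}:=\sum_{i=0}^r\|y^{\Delta^i}\|_\infty$ and $\|y\|_\infty:=\sup_{t\in[a,\rho^r(b)]_{\mathbb{T}}}|y(t)|$.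
   Formalization: Piecewise rd-continuous functions must have one-sided limits at every point; partial derivatives are jointly continuous in (t,u); σ and higher derivatives are those of the truncated time scale [a,ρ^{r-1}(b)]; the equation is claimed at all t where y^{Δ^r}(t) exists. *)

theory Defs
  imports "HOL-Analysis.Analysis"
begin

definition time_scale :: "real set \<Rightarrow> bool" where
  "time_scale T \<longleftrightarrow> T \<noteq> {} \<and> closed T"

definition sigma :: "real set \<Rightarrow> real \<Rightarrow> real" where
  "sigma T t = (if {s \<in> T. s > t} = {} then Sup T else Inf {s \<in> T. s > t})"

definition rho :: "real set \<Rightarrow> real \<Rightarrow> real" where
  "rho T t = (if {s \<in> T. s < t} = {} then Inf T else Sup {s \<in> T. s < t})"

text \<open>For a bounded time scale, \<open>(kappa ^^ n) T\<close> is the part of \<open>T\<close> up to \<open>(rho T ^^ n) (Sup T)\<close>;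
  see \<open>kappa_iterate\<close> below.\<close>

definition kappa :: "real set \<Rightarrow> real set" where
  "kappa T = T - {rho T (Sup T)<..Sup T}"

definition has_delta_derivative :: "real set \<Rightarrow> (real \<Rightarrow> real) \<Rightarrow> real \<Rightarrow> real \<Rightarrow> bool" where
  "has_delta_derivative T f D t \<longleftrightarrow>
     (\<forall>\<epsilon>>0. \<exists>U. open U \<and> t \<in> U \<and>
        (\<forall>s \<in> U \<inter> T. \<bar>f (sigma T t) - f s - D * (sigma T t - s)\<bar> \<le> \<epsilon> * \<bar>sigma T t - s\<bar>))"

text \<open>The delta derivative is unique at points of \<open>kappa T\<close>, and unspecified where it does not exist.\<close>

definition delta_deriv :: "real set \<Rightarrow> (real \<Rightarrow> real) \<Rightarrow> real \<Rightarrow> real" where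
  "delta_deriv T f t = (THE D. has_delta_derivative T f D t)"

text \<open>The \<open>n\<close>-th delta derivative is a function on \<open>(kappa ^^ n) T\<close>, and the next derivative is taken
  with respect to that time scale. Its forward jump agrees with the one of \<open>T\<close> except possibly at its
  maximum \<open>m\<close>, where it gives \<open>m\<close> itself, while \<open>sigma T m\<close> may lie outside of the domain of the
  \<open>n\<close>-th derivative (e.g. \<open>T = {0..1} \<union> {2}\<close> and \<open>n = 1\<close>, where \<open>m = 1\<close>).\<close>

primrec delta_deriv_n :: "real set \<Rightarrow> nat \<Rightarrow> (real \<Rightarrow> real) \<Rightarrow> real \<Rightarrow> real" where
  "delta_deriv_n T 0 f = f"
| "delta_deriv_n T (Suc n) f = delta_deriv ((kappa ^^ n) T) (delta_deriv_n T n f)"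

primrec delta_differentiable_n :: "real set \<Rightarrow> nat \<Rightarrow> (real \<Rightarrow> real) \<Rightarrow> real \<Rightarrow> bool" where
  "delta_differentiable_n T 0 f t \<longleftrightarrow> True"
| "delta_differentiable_n T (Suc n) f t \<longleftrightarrow>
     (\<exists>D. has_delta_derivative ((kappa ^^ n) T) (delta_deriv_n T n f) D t)"

text \<open>Functions on \<open>kappa S\<close>, where \<open>S\<close> is a time scale. The left limit at the minimum is trivial.\<close>

definition rd_continuous_at :: "real set \<Rightarrow> (real \<Rightarrow> real) \<Rightarrow> real \<Rightarrow> bool" where
  "rd_continuous_at S f t \<longleftrightarrow>
     (sigma S t = t \<longrightarrow> continuous (at t within kappa S) f) \<and>
     (rho S t = t \<longrightarrow> (\<exists>l. (f \<longlongrightarrow> l) (at t within (kappa S \<inter> {..<t}))))"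

text \<open>As usual for piecewise notions, one-sided limits are required everywhere, also at the finitely
  many exceptional points (at scattered points they are trivial). In particular such functions are bounded
  on a bounded time scale, which is what makes supremum norms finite and antiderivatives exist: the
  function \<open>1 / t\<close> has a single exceptional point and no antiderivative.\<close>

definition piecewise_rd_continuous :: "real set \<Rightarrow> (real \<Rightarrow> real) \<Rightarrow> bool" where
  "piecewise_rd_continuous S f \<longleftrightarrow>
     (\<exists>E. finite E \<and> (\<forall>t \<in> kappa S - E. rd_continuous_at S f t)) \<and>
     (\<forall>t \<in> kappa S. (\<exists>l. (f \<longlongrightarrow> l) (at t within (kappa S \<inter> {..<t}))) \<and>
                    (\<exists>l. (f \<longlongrightarrow> l) (at t within (kappa S \<inter> {t<..}))))"

text \<open>An antiderivative of a piecewise rd-continuous function may fail to have the right derivative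
  at finitely many points. These must be right-dense: at a right-scattered point the equation
  determines the jump of \<open>F\<close>.\<close>

definition delta_antiderivative :: "real set \<Rightarrow> (real \<Rightarrow> real) \<Rightarrow> (real \<Rightarrow> real) \<Rightarrow> bool" where
  "delta_antiderivative S f F \<longleftrightarrow>
     continuous_on S F \<and>
     (\<exists>E. finite E \<and> (\<forall>t \<in> E. sigma S t = t) \<and> (\<forall>t \<in> kappa S - E. has_delta_derivative S F (f t) t))"

definition delta_integral :: "real set \<Rightarrow> real \<Rightarrow> real \<Rightarrow> (real \<Rightarrow> real) \<Rightarrow> real" where
  "delta_integral S c d f = (let F = (SOME F. delta_antiderivative S f F) in F d - F c)"

text \<open>The class \<open>C\<^sup>r\<^sub>p\<^sub>r\<^sub>d\<close>, for \<open>r \<ge> 1\<close>. The values of \<open>delta_deriv_n T r f\<close> at the finitely many points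
  where this derivative does not exist are irrelevant for \<open>piecewise_rd_continuous\<close>.\<close>

definition C_prd :: "real set \<Rightarrow> nat \<Rightarrow> (real \<Rightarrow> real) set" where
  "C_prd T r = {f.
     (\<forall>i<r. (\<forall>t \<in> (kappa ^^ i) T. delta_differentiable_n T i f t) \<and>
            continuous_on ((kappa ^^ i) T) (delta_deriv_n T i f)) \<and>
     (\<exists>E. finite E \<and> (\<forall>t \<in> (kappa ^^ r) T - E. delta_differentiable_n T r f t)) \<and>
     piecewise_rd_continuous ((kappa ^^ (r - 1)) T) (delta_deriv_n T r f)}"

text \<open>The supremum is taken over the points where the derivative in question exists.\<close>

definition prd_norm :: "real set \<Rightarrow> nat \<Rightarrow> (real \<Rightarrow> real) \<Rightarrow> real" where
  "prd_norm T r f =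
     (\<Sum>i\<le>r. SUP t \<in> {t \<in> T \<inter> {Inf T..(rho T ^^ r) (Sup T)}. delta_differentiable_n T i f t}.
        \<bar>delta_deriv_n T i f t\<bar>)"

definition admissible :: "real set \<Rightarrow> nat \<Rightarrow> (nat \<Rightarrow> real) \<Rightarrow> (nat \<Rightarrow> real) \<Rightarrow> (real \<Rightarrow> real) \<Rightarrow> bool" where
  "admissible T r ya yb y \<longleftrightarrow>
     y \<in> C_prd T r \<and>
     (\<forall>i<r. delta_deriv_n T i y (Inf T) = ya i \<and>
            delta_deriv_n T i y ((rho T ^^ (r - 1)) (Sup T)) = yb i)"

text \<open>The space \<open>\<real>\<^bsup>r+1\<^esup>\<close> is \<open>{..r} \<rightarrow>\<^sub>E UNIV\<close> (with the product topology), where the coordinate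
  with index \<open>i\<close> takes the place of the \<open>i\<close>-th derivative, i.e. it is \<open>u\<^bsub>i+1\<^esub>\<close> when counted from 1.\<close>

definition jet :: "real set \<Rightarrow> nat \<Rightarrow> (real \<Rightarrow> real) \<Rightarrow> real \<Rightarrow> nat \<Rightarrow> real" where
  "jet T r y t = (\<lambda>i \<in> {..r}. delta_deriv_n T i y t)"

definition partial_deriv :: "(real \<Rightarrow> (nat \<Rightarrow> real) \<Rightarrow> real) \<Rightarrow> nat \<Rightarrow> real \<Rightarrow> (nat \<Rightarrow> real) \<Rightarrow> real" where
  "partial_deriv L i t u = deriv (\<lambda>x. L t (u(i := x))) (u i)"

definition action :: "real set \<Rightarrow> nat \<Rightarrow> (real \<Rightarrow> (nat \<Rightarrow> real) \<Rightarrow> real) \<Rightarrow> (real \<Rightarrow> real) \<Rightarrow> real" where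
  "action T r L y =
     delta_integral ((kappa ^^ (r - 1)) T) (Inf T) ((rho T ^^ (r - 1)) (Sup T)) (\<lambda>t. L t (jet T r y t))"

definition weak_local_minimizer ::
  "real set \<Rightarrow> nat \<Rightarrow> (real \<Rightarrow> (nat \<Rightarrow> real) \<Rightarrow> real) \<Rightarrow> (nat \<Rightarrow> real) \<Rightarrow> (nat \<Rightarrow> real) \<Rightarrow> (real \<Rightarrow> real) \<Rightarrow> bool"
where
  "weak_local_minimizer T r L ya yb y \<longleftrightarrow>
     admissible T r ya yb y \<and>
     (\<exists>\<delta>>0. \<forall>z. admissible T r ya yb z \<and> prd_norm T r (\<lambda>t. y t - z t) < \<delta> \<longrightarrow>
        action T r L y \<le> action T r L z)"

text \<open>The operator taking \<open>f\<close> to the function that maps \<open>s\<close> to the integral of \<open>f\<close> from the minimum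
  of \<open>S\<close> to \<open>sigma S s\<close>; its powers are the iterated integrals of the Euler-Lagrange equation.\<close>

definition sigma_integral :: "real set \<Rightarrow> (real \<Rightarrow> real) \<Rightarrow> real \<Rightarrow> real" where
  "sigma_integral S f s = delta_integral S (Inf S) (sigma S s) f"

text \<open>Starting with index 0 puts \<open>G\<^sub>1\<close> under the general rule, since \<open>- (- 1) ^ 1 * c 1 = c 1\<close>.\<close>

primrec EL_nested :: "real set \<Rightarrow> (real \<Rightarrow> real) \<Rightarrow> (nat \<Rightarrow> real) \<Rightarrow> nat \<Rightarrow> real \<Rightarrow> real" where
  "EL_nested S f c 0 = f"
| "EL_nested S f c (Suc k) =
     (\<lambda>s. sigma_integral S (EL_nested S f c k) s - (- 1) ^ Suc k * c (Suc k))"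

text \<open>The integrands live on \<open>kappa S\<close> for \<open>S = (kappa ^^ (r - 1)) T\<close>, so the jumps in the limits of
  integration are those of \<open>S\<close>; they agree with those of \<open>T\<close> below the maximum of \<open>S\<close>.\<close>

definition EL_lhs ::
  "real set \<Rightarrow> nat \<Rightarrow> (real \<Rightarrow> (nat \<Rightarrow> real) \<Rightarrow> real) \<Rightarrow> (real \<Rightarrow> real) \<Rightarrow> (nat \<Rightarrow> real) \<Rightarrow> real \<Rightarrow> real"
where
  "EL_lhs T r L y c t =
     (let S = (kappa ^^ (r - 1)) T;
          J = sigma_integral S;
          p = (\<lambda>i s. partial_deriv L i s (jet T r y s))
      in if r = 1 then p 1 t - J (p 0) t - c 1
         else p r t - J (p (r - 1)) t
              + (\<Sum>i<r - 2. (- 1) ^ i * (J ^^ (i + 2)) (p (r - 2 - i)) t)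
              + (- 1) ^ r * J (EL_nested S (p 0) c (r - 1)) t - c r)"

lemma kappa_iterate:
  assumes "time_scale T" and "bounded T"
  shows "(kappa ^^ n) T = T \<inter> {Inf T..(rho T ^^ n) (Sup T)}"
    and "(rho T ^^ n) (Sup T) \<in> T"
    and "Sup ((kappa ^^ n) T) = (rho T ^^ n) (Sup T)"
proof -
  have T: "T \<noteq> {}" "closed T" "bdd_above T" "bdd_below T"
    using assms by (auto simp: time_scale_def bounded_imp_bdd_above bounded_imp_bdd_below)
  have inT: "Inf T \<in> T" "Sup T \<in> T"
    using T by (auto intro: closed_contains_Inf closed_contains_Sup)
  have lb: "Inf T \<le> t" "t \<le> Sup T" if "t \<in> T" for t
    using T that by (auto intro: cInf_lower cSup_upper)
  have rho: "rho T t \<in> T \<and> rho T t \<le> t" if "t \<in> T" for t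
  proof (cases "{s \<in> T. s < t} = {}")
    case True
    then show ?thesis using inT lb that by (auto simp: rho_def)
  next
    case False
    have "Sup {s \<in> T. s < t} \<in> closure {s \<in> T. s < t}"
      using False by (intro closure_contains_Sup) (auto intro: bdd_aboveI[of _ t])
    also have "\<dots> \<subseteq> T"
      using T(2) by (intro closure_minimal) auto
    finally show ?thesis
      using False by (auto simp: rho_def intro!: cSup_least)
  qed
  have "(kappa ^^ n) T = T \<inter> {Inf T..(rho T ^^ n) (Sup T)} \<and> (rho T ^^ n) (Sup T) \<in> T"
  proof (induction n)
    case 0
    then show ?case using inT lb by auto
  next
    case (Suc n)
    define m where "m = (rho T ^^ n) (Sup T)"
    define S where "S = (kappa ^^ n) T"
    have S: "S = T \<inter> {Inf T..m}" "m \<in> T"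
      using Suc by (auto simp: m_def S_def)
    have "Inf T \<le> m" by (rule lb) (rule S)
    have SupS: "Sup S = m"
      using S lb by (intro cSup_eq_maximum) auto
    have InfS: "Inf S = Inf T"
      using S(1) inT lb(1) \<open>Inf T \<le> m\<close> by (intro cInf_eq_minimum) auto
    have below: "{s \<in> S. s < m} = {s \<in> T. s < m}"
      using S lb by auto
    have "rho S (Sup S) = rho T m"
      by (simp only: rho_def SupS InfS below)
    moreover have "rho T m \<in> T" "rho T m \<le> m"
      using rho[OF S(2)] by auto
    ultimately have "kappa S = T \<inter> {Inf T..rho T m}"
      unfolding kappa_def SupS using S by auto
    with \<open>rho T m \<in> T\<close> show ?case
      by (simp add: S_def m_def)
  qed
  then show *: "(kappa ^^ n) T = T \<inter> {Inf T..(rho T ^^ n) (Sup T)}" "(rho T ^^ n) (Sup T) \<in> T"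
    by auto
  show "Sup ((kappa ^^ n) T) = (rho T ^^ n) (Sup T)"
    unfolding *(1) using *(2) lb by (intro cSup_eq_maximum) auto
qed

end

theory Submission
  imports Defs
begin

text \<open>
  The key observation is that a delta integral is an ordinary integral: the antiderivative of a piecewise
  rd-continuous \<open>f\<close> on a compact time scale \<open>S\<close> is \<open>t \<mapsto> \<integral> f (rho S x) dx\<close>, integrated from the minimum of
  \<open>S\<close> to \<open>t\<close>, because \<open>rho S\<close> sends the gap after a right-scattered point to that point
  (\<open>delta_primitive_antiderivative\<close>, \<open>delta_integral_eq_primitive\<close>). Together with the uniqueness of
  antiderivatives (\<open>zero_delta_derivative_constant\<close>) this makes linearity, estimates and dominated convergence available.

  Let \<open>J\<close> map \<open>f\<close> to its integral up to \<open>\<sigma> t\<close>, let \<open>\<langle>f, g\<rangle>\<close> be the integral of \<open>f g\<close> over \<open>K = \<kappa>\<^sup>r\<^sup>-\<^sup>1 T\<close>, and let \<open>p\<^sub>i\<close> be the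
  partial derivative of \<open>L\<close> for the \<open>i\<close>-th derivative along the minimizer. A variation \<open>\<eta>\<close> with zero initial data is
  the \<open>r\<close>-fold primitive of its top derivative \<open>v\<close>. Integration by parts turns primitives of \<open>v\<close> into
  powers of \<open>J\<close> on the other factor. Thus \<open>\<eta>\<close> satisfies the terminal conditions if \<open>v\<close> is orthogonal to
  \<open>J\<^sup>k 1\<close> for all \<open>k < r\<close> (\<open>primitive_power_Sup_eq_0\<close>), and then the first variation
  \<open>\<Sum> \<langle>p\<^sub>i, \<eta>\<^bsup>\<Delta> i\<^esup>\<rangle>\<close>, which is nonnegative at a minimizer (\<open>first_variation_nonneg\<close>), equals \<open>\<langle>\<Psi>, v\<rangle>\<close> with
  \<open>\<Psi> = \<Sum> (-1)\<^bsup>r-i\<^esup> J\<^bsup>r-i\<^esup> p\<^sub>i\<close> (\<open>delta_pairing_primitive_power\<close>).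

  Now split \<open>\<Psi>\<close> into a combination of the \<open>J\<^sup>k 1\<close> and a remainder \<open>w\<close> orthogonal to them, which exists
  for any finite family (\<open>ex_orthogonal_projection\<close>). The direction \<open>v = - w\<close> gives \<open>0 \<le> \<langle>\<Psi>, v\<rangle> = - \<langle>w, w\<rangle>\<close>, so
  \<open>w\<close> is a null function. A null function vanishes at right-scattered points, and at right-dense points where
  it is continuous (\<open>delta_pairing_definite\<close>); \<open>w\<close> is continuous wherever \<open>y\<close> is \<open>r\<close> times differentiable
  (\<open>partial_tendsto_right_dense\<close>). There \<open>\<Psi>\<close> is a combination of the \<open>J\<^sup>k 1\<close>, and its coefficients are, up to
  sign, the constants of the equation, since the nested integrals differ from powers of \<open>J\<close> by just such combinations
  (\<open>EL_nested_eq\<close>).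
\<close>

section \<open>Regulated functions on a compact interval\<close>

lemma regulated_local_bounds:
  fixes g :: "real \<Rightarrow> real"
  assumes L: "\<exists>l. (g \<longlongrightarrow> l) (at x within {a..b} \<inter> {..<x})"
    and R: "\<exists>l. (g \<longlongrightarrow> l) (at x within {a..b} \<inter> {x<..})"
    and e: "e > 0"
  obtains l r d where "d > 0"
    and "\<And>z. z \<in> {a..b} \<Longrightarrow> x - d < z \<Longrightarrow> z < x \<Longrightarrow> \<bar>g z - l\<bar> \<le> e"
    and "\<And>z. z \<in> {a..b} \<Longrightarrow> x < z \<Longrightarrow> z < x + d \<Longrightarrow> \<bar>g z - r\<bar> \<le> e"
proof -
  obtain l where l: "(g \<longlongrightarrow> l) (at x within {a..b} \<inter> {..<x})" using L by blast
  obtain r where r: "(g \<longlongrightarrow> r) (at x within {a..b} \<inter> {x<..})" using R by blast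
  obtain d1 where d1: "d1 > 0" "\<And>z. z \<in> {a..b} \<inter> {..<x} \<Longrightarrow> dist z x < d1 \<Longrightarrow> z \<noteq> x \<Longrightarrow> dist (g z) l < e"
    using tendstoD[OF l e] unfolding eventually_at by blast
  obtain d2 where d2: "d2 > 0" "\<And>z. z \<in> {a..b} \<inter> {x<..} \<Longrightarrow> dist z x < d2 \<Longrightarrow> z \<noteq> x \<Longrightarrow> dist (g z) r < e"
    using tendstoD[OF r e] unfolding eventually_at by blast
  show thesis
  proof (rule that[of "min d1 d2" l r])
    show "min d1 d2 > 0" using d1 d2 by simp
    show "\<bar>g z - l\<bar> \<le> e" if "z \<in> {a..b}" "x - min d1 d2 < z" "z < x" for z
      using d1(2)[of z] that min.cobounded1[of d1 d2] by (auto simp: dist_real_def simp del: min.cobounded1)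
    show "\<bar>g z - r\<bar> \<le> e" if "z \<in> {a..b}" "x < z" "z < x + min d1 d2" for z
      using d2(2)[of z] that min.cobounded2[of d1 d2] by (auto simp: dist_real_def simp del: min.cobounded2)
  qed
qed

text \<open>Near each point a regulated function is within \<open>\<epsilon>\<close> of a function with at most three values, so by
  compactness it is a uniform limit of step functions.\<close>

lemma regulated_integrable:
  fixes g :: "real \<Rightarrow> real"
  assumes ab: "a \<le> b"
    and L: "\<And>x. x \<in> {a..b} \<Longrightarrow> \<exists>l. (g \<longlongrightarrow> l) (at x within {a..b} \<inter> {..<x})"
    and R: "\<And>x. x \<in> {a..b} \<Longrightarrow> \<exists>l. (g \<longlongrightarrow> l) (at x within {a..b} \<inter> {x<..})"
  shows "g integrable_on {a..b}"
proof -
  have "\<exists>h. (\<forall>x\<in>cbox a b. norm (g x - h x) \<le> e) \<and> h integrable_on cbox a b" if e: "e > 0" for e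
  proof -
    define P where "P c d \<longleftrightarrow> (\<exists>h. h integrable_on {c..d} \<and> (\<forall>x\<in>{a..b} \<inter> {c..d}. \<bar>g x - h x\<bar> \<le> e))" for c d
    have "P a b" using ab
    proof (induction rule: Bolzano)
      case (trans c d f)
      then obtain h k where h: "h integrable_on {c..d}" "\<forall>x\<in>{a..b} \<inter> {c..d}. \<bar>g x - h x\<bar> \<le> e"
        and k: "k integrable_on {d..f}" "\<forall>x\<in>{a..b} \<inter> {d..f}. \<bar>g x - k x\<bar> \<le> e"
        unfolding P_def by blast
      define u where "u x = (if x \<le> d then h x else k x)" for x
      have "u integrable_on {c..d}"
        by (rule integrable_spike_finite[of "{}", OF _ _ h(1)]) (auto simp: u_def)
      moreover have "u integrable_on {d..f}"
        by (rule integrable_spike_finite[of "{d}", OF _ _ k(1)]) (auto simp: u_def)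
      ultimately have "u integrable_on {c..f}"
        by (rule Henstock_Kurzweil_Integration.integrable_combine[OF \<open>c \<le> d\<close> \<open>d \<le> f\<close>])
      moreover have "\<forall>x\<in>{a..b} \<inter> {c..f}. \<bar>g x - u x\<bar> \<le> e"
        using h(2) k(2) by (auto simp: u_def)
      ultimately show ?case unfolding P_def by blast
    next
      case (local x)
      then have x: "x \<in> {a..b}" by simp
      obtain l r d where d: "d > 0"
        and l: "\<And>z. z \<in> {a..b} \<Longrightarrow> x - d < z \<Longrightarrow> z < x \<Longrightarrow> \<bar>g z - l\<bar> \<le> e"
        and r: "\<And>z. z \<in> {a..b} \<Longrightarrow> x < z \<Longrightarrow> z < x + d \<Longrightarrow> \<bar>g z - r\<bar> \<le> e"
        using regulated_local_bounds[OF L[OF x] R[OF x] e] by metis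
      have "P p q" if pq: "p \<le> x" "x \<le> q" "q - p < d" for p q
      proof -
        define h where "h z = (if z < x then l else if z = x then g x else r)" for z
        have c: "(\<lambda>_. y) integrable_on {s..t}" for s t y :: real
          by (rule integrable_const_ivl)
        have "h integrable_on {p..x}"
          by (rule integrable_spike_finite[of "{x}", OF _ _ c[of l]]) (auto simp: h_def)
        moreover have "h integrable_on {x..q}"
          by (rule integrable_spike_finite[of "{x}", OF _ _ c[of r]]) (auto simp: h_def)
        ultimately have "h integrable_on {p..q}"
          by (rule Henstock_Kurzweil_Integration.integrable_combine[OF pq(1,2)])
        moreover have "\<bar>g z - h z\<bar> \<le> e" if "z \<in> {a..b} \<inter> {p..q}" for z
          using l[of z] r[of z] that pq e by (cases z x rule: linorder_cases) (auto simp: h_def)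
        ultimately show ?thesis unfolding P_def by blast
      qed
      then show ?case using d by blast
    qed
    then show ?thesis by (auto simp: P_def)
  qed
  then show ?thesis
    using integrable_uniform_limit[of a b g] by simp
qed

lemma integral_near_constant:
  fixes g :: "real \<Rightarrow> real"
  assumes g: "g integrable_on {c..d}" and cd: "c \<le> d" and e: "0 \<le> e"
    and near: "\<And>x. c < x \<Longrightarrow> x < d \<Longrightarrow> \<bar>g x - l\<bar> \<le> e"
  shows "\<bar>integral {c..d} g - l * (d - c)\<bar> \<le> e * (d - c)"
proof -
  have "((\<lambda>x. g x - l) has_integral (integral {c..d} g - l * (d - c))) {c..d}"
    using has_integral_diff[OF integrable_integral[OF g] has_integral_const_real[of l c d]] cd
    by (simp add: mult.commute)
  then have "norm (integral {c..d} g - l * (d - c)) \<le> e * measure lborel (cbox c d)"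
    by (intro has_integral_bound_spike_finite[of e "{c, d}"]) (use e near in auto)
  then show ?thesis using cd by simp
qed

section \<open>Jump operators of a compact time scale\<close>

locale compact_time_scale =
  fixes S :: "real set"
  assumes time_scale: "time_scale S" and bounded: "bounded S"
begin

lemma nonempty: "S \<noteq> {}" and closed: "closed S" and compact: "compact S"
  and bdd: "bdd_above S" "bdd_below S"
  using time_scale bounded
  by (auto simp: time_scale_def compact_eq_bounded_closed bounded_imp_bdd_above bounded_imp_bdd_below)

lemma Inf_mem: "Inf S \<in> S" and Sup_mem: "Sup S \<in> S"
  using nonempty closed bdd by (auto intro: closed_contains_Inf closed_contains_Sup)

lemma Inf_le: "t \<in> S \<Longrightarrow> Inf S \<le> t" and le_Sup: "t \<in> S \<Longrightarrow> t \<le> Sup S"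
  using bdd by (auto intro: cInf_lower cSup_upper)

lemma Inf_le_Sup: "Inf S \<le> Sup S"
  by (rule Inf_le) (rule Sup_mem)

lemma rho_mem: "rho S x \<in> S"
proof (cases "{s \<in> S. s < x} = {}")
  case False
  have "Sup {s \<in> S. s < x} \<in> closure {s \<in> S. s < x}"
    using False by (intro closure_contains_Sup) (auto intro: bdd_aboveI[of _ x])
  also have "\<dots> \<subseteq> S"
    using closed by (intro closure_minimal) auto
  finally show ?thesis using False by (auto simp: rho_def)
qed (auto simp: rho_def Inf_mem)

lemma rho_le: "Inf S \<le> x \<Longrightarrow> rho S x \<le> x"
  by (auto simp: rho_def intro!: cSup_least)

lemma le_rho: "s \<in> S \<Longrightarrow> s < x \<Longrightarrow> s \<le> rho S x"
  by (auto simp: rho_def intro!: cSup_upper bdd_aboveI[of _ x])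

lemma rho_eqI:
  assumes "t \<in> S" "t < x" "\<And>s. s \<in> S \<Longrightarrow> s < x \<Longrightarrow> s \<le> t"
  shows "rho S x = t"
proof -
  have "Sup {s \<in> S. s < x} = t"
    using assms by (intro cSup_eq_maximum) auto
  then show ?thesis using assms(1,2) by (auto simp: rho_def)
qed

lemma rho_mono: "x \<le> x' \<Longrightarrow> rho S x \<le> rho S x'"
proof (cases "{s \<in> S. s < x} = {}")
  case True
  then show ?thesis using Inf_le[OF rho_mem] by (simp add: rho_def)
next
  case False
  assume "x \<le> x'"
  then have "Sup {s \<in> S. s < x} \<le> rho S x'"
    using False by (intro cSup_least) (auto intro: le_rho)
  then show ?thesis by (simp only: rho_def[of S x] False if_False)
qed

lemma sigma_mem: "sigma S x \<in> S"
proof (cases "{s \<in> S. s > x} = {}")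
  case False
  have "Inf {s \<in> S. s > x} \<in> closure {s \<in> S. s > x}"
    using False by (intro closure_contains_Inf) (auto intro: bdd_belowI[of _ x])
  also have "\<dots> \<subseteq> S"
    using closed by (intro closure_minimal) auto
  finally show ?thesis using False by (auto simp: sigma_def)
qed (auto simp: sigma_def Sup_mem)

lemma le_sigma: "x \<le> Sup S \<Longrightarrow> x \<le> sigma S x"
  by (auto simp: sigma_def intro!: cInf_greatest)

lemma sigma_le: "s \<in> S \<Longrightarrow> x < s \<Longrightarrow> sigma S x \<le> s"
  by (auto simp: sigma_def intro!: cInf_lower bdd_belowI[of _ x])

lemma rho_eq_of_scattered: "t \<in> S \<Longrightarrow> t < x \<Longrightarrow> x \<le> sigma S t \<Longrightarrow> rho S x = t"
  by (rule rho_eqI) (auto dest: sigma_le intro: leI)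

lemma right_dense_approach:
  assumes "sigma S x = x" "x < Sup S" "x < z"
  obtains s where "s \<in> S" "x < s" "s < z"
proof -
  have ne: "{s \<in> S. s > x} \<noteq> {}" using assms(2) Sup_mem by auto
  then have "Inf {s \<in> S. s > x} < z" using assms(1,3) by (simp only: sigma_def if_False)
  then show ?thesis using cInf_lessD[OF ne] that by blast
qed

lemma left_dense_approach:
  assumes "rho S x = x" "Inf S < x" "z < x"
  obtains s where "s \<in> S" "z < s" "s < x"
proof -
  have ne: "{s \<in> S. s < x} \<noteq> {}" using assms(2) Inf_mem by auto
  then have "z < Sup {s \<in> S. s < x}" using assms(1,3) by (simp only: rho_def if_False)
  then show ?thesis using less_cSupD[OF ne] that by blast
qed

lemma kappa_iff: "t \<in> kappa S \<longleftrightarrow> t \<in> S \<and> t \<le> rho S (Sup S)"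
  using le_Sup by (auto simp: kappa_def)

lemma kappa_subset: "kappa S \<subseteq> S"
  by (auto simp: kappa_def)

lemma kappaI: "s \<in> S \<Longrightarrow> s < Sup S \<Longrightarrow> s \<in> kappa S"
  by (simp add: kappa_iff le_rho)

lemma rho_mem_kappa: "x \<le> Sup S \<Longrightarrow> rho S x \<in> kappa S"
  by (simp add: kappa_iff rho_mem rho_mono)

lemma Inf_mem_kappa: "Inf S \<in> kappa S"
  using Inf_le rho_mem by (simp add: kappa_iff Inf_mem)

lemma compact_kappa: "compact (kappa S)"
proof -
  have "kappa S = S \<inter> {..rho S (Sup S)}" by (auto simp: kappa_iff)
  then show ?thesis using compact by (simp add: compact_Int_closed)
qed

text \<open>At a point of \<open>kappa S\<close> the difference quotients are not vacuous, so delta derivatives are unique.\<close>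

lemma kappa_approach:
  assumes "t \<in> kappa S" "Inf S < Sup S" "e > 0"
  obtains s where "s \<in> S" "s \<noteq> sigma S t" "\<bar>s - t\<bar> < e"
proof -
  have t: "t \<in> S" "t \<le> Sup S" using assms(1) kappa_subset le_Sup by auto
  consider "t < sigma S t" | "sigma S t = t" "t < Sup S" | "sigma S t = t" "t = Sup S"
    using le_sigma[OF t(2)] t(2) by linarith
  then show ?thesis
  proof cases
    case 1
    then show ?thesis using that[of t] t assms(3) by simp
  next
    case 2
    then obtain s where "s \<in> S" "t < s" "s < t + e"
      using right_dense_approach[of t "t + e"] assms(3) by auto
    then show ?thesis using that[of s] 2 by simp
  next
    case 3
    then have "rho S t = t" using assms(1) rho_le[OF Inf_le_Sup] by (simp add: kappa_iff)
    then obtain s where "s \<in> S" "t - e < s" "s < t"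
      using left_dense_approach[of t "t - e"] assms(2,3) 3 by auto
    then show ?thesis using that[of s] 3 by simp
  qed
qed

text \<open>Only the point itself is sent to a right-dense point by \<open>rho S\<close>. Hence a finite set of right-dense points
  has a finite preimage, which no integral of a function of \<open>rho S x\<close> can see.\<close>

lemma right_dense_of_rho_eq:
  assumes "sigma S t = t" "x \<le> Sup S" "Inf S \<le> x" "rho S x = t"
  shows "x = t"
proof (rule ccontr)
  assume "x \<noteq> t"
  then have "t < x" using assms rho_le[of x] by simp
  then obtain s where "s \<in> S" "t < s" "s < x"
    using right_dense_approach[of t x] assms by auto
  then show False using le_rho[of s x] assms by simp
qed

section \<open>Delta derivatives\<close>

lemma has_delta_derivative_iff:
  "has_delta_derivative S f D t \<longleftrightarrow> (\<forall>e>0. \<exists>d>0. \<forall>s\<in>S. \<bar>s - t\<bar> < d \<longrightarrow>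
     \<bar>f (sigma S t) - f s - D * (sigma S t - s)\<bar> \<le> e * \<bar>sigma S t - s\<bar>)" (is "?l = ?r")
proof
  assume ?l
  show ?r
  proof (intro allI impI)
    fix e :: real assume "e > 0"
    then obtain U where U: "open U" "t \<in> U"
      "\<forall>s \<in> U \<inter> S. \<bar>f (sigma S t) - f s - D * (sigma S t - s)\<bar> \<le> e * \<bar>sigma S t - s\<bar>"
      using \<open>?l\<close> unfolding has_delta_derivative_def by blast
    then obtain d where "d > 0" "ball t d \<subseteq> U" using open_contains_ball by blast
    then show "\<exists>d>0. \<forall>s\<in>S. \<bar>s - t\<bar> < d \<longrightarrow>
      \<bar>f (sigma S t) - f s - D * (sigma S t - s)\<bar> \<le> e * \<bar>sigma S t - s\<bar>"
      using U(3) by (intro exI[of _ d]) (auto simp: subset_eq dist_real_def abs_minus_commute)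
  qed
next
  assume ?r
  show ?l
    unfolding has_delta_derivative_def
  proof (intro allI impI)
    fix e :: real assume "e > 0"
    then obtain d where "d > 0" "\<forall>s\<in>S. \<bar>s - t\<bar> < d \<longrightarrow>
      \<bar>f (sigma S t) - f s - D * (sigma S t - s)\<bar> \<le> e * \<bar>sigma S t - s\<bar>"
      using \<open>?r\<close> by blast
    then show "\<exists>U. open U \<and> t \<in> U \<and>
      (\<forall>s\<in>U \<inter> S. \<bar>f (sigma S t) - f s - D * (sigma S t - s)\<bar> \<le> e * \<bar>sigma S t - s\<bar>)"
      by (intro exI[of _ "ball t d"]) (auto simp: dist_real_def abs_minus_commute)
  qed
qed

lemma delta_derivative_unique:
  assumes "has_delta_derivative S f D t" "has_delta_derivative S f D' t" "t \<in> kappa S" "Inf S < Sup S"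
  shows "D = D'"
proof (rule ccontr)
  assume "D \<noteq> D'"
  define e where "e = \<bar>D - D'\<bar> / 3"
  have e: "e > 0" using \<open>D \<noteq> D'\<close> by (simp add: e_def)
  obtain d where d: "d > 0" "\<forall>s\<in>S. \<bar>s - t\<bar> < d \<longrightarrow>
      \<bar>f (sigma S t) - f s - D * (sigma S t - s)\<bar> \<le> e * \<bar>sigma S t - s\<bar>"
    using assms(1) e unfolding has_delta_derivative_iff by blast
  obtain d' where d': "d' > 0" "\<forall>s\<in>S. \<bar>s - t\<bar> < d' \<longrightarrow>
      \<bar>f (sigma S t) - f s - D' * (sigma S t - s)\<bar> \<le> e * \<bar>sigma S t - s\<bar>"
    using assms(2) e unfolding has_delta_derivative_iff by blast
  obtain s where s: "s \<in> S" "s \<noteq> sigma S t" "\<bar>s - t\<bar> < min d d'"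
    using kappa_approach[OF assms(3,4), of "min d d'"] d d' by auto
  have "\<bar>(D - D') * (sigma S t - s)\<bar> \<le> 2 * e * \<bar>sigma S t - s\<bar>"
    using d(2) d'(2) s by (auto simp: algebra_simps dest!: bspec[of _ _ s])
  then have "\<bar>D - D'\<bar> \<le> 2 * e" using s(2) by (simp add: abs_mult)
  then show False using e by (simp add: e_def)
qed

lemma delta_deriv_eq:
  assumes "has_delta_derivative S f D t" "t \<in> kappa S" "Inf S < Sup S"
  shows "delta_deriv S f t = D"
  unfolding delta_deriv_def using assms delta_derivative_unique by blast

lemma has_delta_derivative_cong:
  assumes "\<And>s. s \<in> S \<Longrightarrow> f s = g s"
  shows "has_delta_derivative S f D t \<longleftrightarrow> has_delta_derivative S g D t"
  using assms sigma_mem[of t] by (simp add: has_delta_derivative_iff)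

lemma has_delta_derivative_linear:
  assumes "has_delta_derivative S f D t" "has_delta_derivative S g D' t"
  shows "has_delta_derivative S (\<lambda>s. p * f s + q * g s) (p * D + q * D') t"
  unfolding has_delta_derivative_iff
proof (intro allI impI)
  fix e :: real assume e: "e > 0"
  define e' where "e' = e / (\<bar>p\<bar> + \<bar>q\<bar> + 1)"
  have e': "e' > 0" using e by (simp add: e'_def)
  obtain d where d: "d > 0" "\<forall>s\<in>S. \<bar>s - t\<bar> < d \<longrightarrow>
      \<bar>f (sigma S t) - f s - D * (sigma S t - s)\<bar> \<le> e' * \<bar>sigma S t - s\<bar>"
    using assms(1) e' unfolding has_delta_derivative_iff by blast
  obtain d' where d': "d' > 0" "\<forall>s\<in>S. \<bar>s - t\<bar> < d' \<longrightarrow>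
      \<bar>g (sigma S t) - g s - D' * (sigma S t - s)\<bar> \<le> e' * \<bar>sigma S t - s\<bar>"
    using assms(2) e' unfolding has_delta_derivative_iff by blast
  have "\<bar>p * f (sigma S t) + q * g (sigma S t) - (p * f s + q * g s) - (p * D + q * D') * (sigma S t - s)\<bar>
        \<le> e * \<bar>sigma S t - s\<bar>" if s: "s \<in> S" "\<bar>s - t\<bar> < min d d'" for s
  proof -
    let ?F = "f (sigma S t) - f s - D * (sigma S t - s)" and ?G = "g (sigma S t) - g s - D' * (sigma S t - s)"
    have F: "\<bar>?F\<bar> \<le> e' * \<bar>sigma S t - s\<bar>" and G: "\<bar>?G\<bar> \<le> e' * \<bar>sigma S t - s\<bar>"
      using d d' s by auto
    have "p * f (sigma S t) + q * g (sigma S t) - (p * f s + q * g s) - (p * D + q * D') * (sigma S t - s)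
      = p * ?F + q * ?G" by (simp add: algebra_simps)
    also have "\<bar>\<dots>\<bar> \<le> \<bar>p\<bar> * \<bar>?F\<bar> + \<bar>q\<bar> * \<bar>?G\<bar>"
      by (metis abs_mult abs_triangle_ineq)
    also have "\<dots> \<le> \<bar>p\<bar> * (e' * \<bar>sigma S t - s\<bar>) + \<bar>q\<bar> * (e' * \<bar>sigma S t - s\<bar>)"
      using F G by (intro add_mono mult_left_mono) auto
    also have "\<dots> = (\<bar>p\<bar> + \<bar>q\<bar>) * e' * \<bar>sigma S t - s\<bar>" by (simp add: algebra_simps)
    also have "\<dots> \<le> e * \<bar>sigma S t - s\<bar>"
      using e by (intro mult_right_mono) (auto simp: e'_def field_simps)
    finally show ?thesis .
  qed
  then show "\<exists>d>0. \<forall>s\<in>S. \<bar>s - t\<bar> < d \<longrightarrow>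
       \<bar>p * f (sigma S t) + q * g (sigma S t) - (p * f s + q * g s) - (p * D + q * D') * (sigma S t - s)\<bar>
         \<le> e * \<bar>sigma S t - s\<bar>"
    using d(1) d'(1) by (intro exI[of _ "min d d'"]) auto
qed

lemma continuous_on_dist:
  fixes g :: "real \<Rightarrow> real"
  assumes "continuous_on A g" "t \<in> A" "e > 0"
  obtains d where "d > 0" "\<And>s. s \<in> A \<Longrightarrow> \<bar>s - t\<bar> < d \<Longrightarrow> \<bar>g s - g t\<bar> < e"
  using assms unfolding continuous_on_iff dist_real_def by blast

lemma has_delta_derivative_mult:
  assumes F: "has_delta_derivative S f D t" and G: "has_delta_derivative S g D' t"
    and g: "continuous_on S g" and t: "t \<in> S"
  shows "has_delta_derivative S (\<lambda>s. f s * g s) (D * g t + f (sigma S t) * D') t"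
  unfolding has_delta_derivative_iff
proof (intro allI impI)
  fix e :: real assume e: "e > 0"
  define C where "C = \<bar>f (sigma S t)\<bar> + \<bar>g t\<bar> + \<bar>D\<bar> + 2"
  define e' where "e' = min 1 (e / C)"
  have C: "C > 0" by (simp add: C_def)
  then have e': "e' > 0" "e' \<le> 1" "C * e' \<le> e" using e
    by (auto simp: e'_def min_def field_simps)
  obtain d1 where d1: "d1 > 0" "\<forall>s\<in>S. \<bar>s - t\<bar> < d1 \<longrightarrow>
      \<bar>f (sigma S t) - f s - D * (sigma S t - s)\<bar> \<le> e' * \<bar>sigma S t - s\<bar>"
    using F e' unfolding has_delta_derivative_iff by blast
  obtain d2 where d2: "d2 > 0" "\<forall>s\<in>S. \<bar>s - t\<bar> < d2 \<longrightarrow>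
      \<bar>g (sigma S t) - g s - D' * (sigma S t - s)\<bar> \<le> e' * \<bar>sigma S t - s\<bar>"
    using G e' unfolding has_delta_derivative_iff by blast
  obtain d3 where d3: "d3 > 0" "\<And>s. s \<in> S \<Longrightarrow> \<bar>s - t\<bar> < d3 \<Longrightarrow> \<bar>g s - g t\<bar> < e'"
    using continuous_on_dist[OF g t e'(1)] by metis
  define d where "d = min d1 (min d2 d3)"
  have "\<bar>f (sigma S t) * g (sigma S t) - f s * g s - (D * g t + f (sigma S t) * D') * (sigma S t - s)\<bar>
        \<le> e * \<bar>sigma S t - s\<bar>" if s: "s \<in> S" "\<bar>s - t\<bar> < d" for s
  proof -
    let ?m = "\<bar>sigma S t - s\<bar>"
    let ?F = "f (sigma S t) - f s - D * (sigma S t - s)" and ?G = "g (sigma S t) - g s - D' * (sigma S t - s)"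
    have F: "\<bar>?F\<bar> \<le> e' * ?m" and G: "\<bar>?G\<bar> \<le> e' * ?m" and g: "\<bar>g s - g t\<bar> \<le> e'"
      using d1(2) d2(2) d3(2)[of s] s by (auto simp: d_def)
    have tri: "\<bar>x + y + z\<bar> \<le> \<bar>x\<bar> + \<bar>y\<bar> + \<bar>z\<bar>" for x y z :: real by linarith
    have gs: "\<bar>g s\<bar> \<le> \<bar>g t\<bar> + 1" using g e'(2) by linarith
    \<comment> \<open>the error of \<open>g\<close>, the error of \<open>f\<close>, and the cost of evaluating \<open>g\<close> at \<open>t\<close> instead of \<open>s\<close>\<close>
    have "f (sigma S t) * g (sigma S t) - f s * g s - (D * g t + f (sigma S t) * D') * (sigma S t - s)
      = f (sigma S t) * ?G + g s * ?F + D * (g s - g t) * (sigma S t - s)"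
      by (simp add: algebra_simps)
    also have "\<bar>\<dots>\<bar> \<le> \<bar>f (sigma S t)\<bar> * \<bar>?G\<bar> + \<bar>g s\<bar> * \<bar>?F\<bar> + \<bar>D\<bar> * \<bar>g s - g t\<bar> * ?m"
      using tri[of "f (sigma S t) * ?G" "g s * ?F" "D * (g s - g t) * (sigma S t - s)"]
      by (simp only: abs_mult)
    also have "\<dots> \<le> \<bar>f (sigma S t)\<bar> * (e' * ?m) + (\<bar>g t\<bar> + 1) * (e' * ?m) + \<bar>D\<bar> * e' * ?m"
      using F G g gs by (intro add_mono mult_mono) auto
    also have "\<dots> \<le> C * e' * ?m"
      using e'(1) by (simp add: C_def algebra_simps)
    also have "\<dots> \<le> e * ?m"
      using e'(3) by (intro mult_right_mono) auto
    finally show ?thesis .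
  qed
  moreover have "d > 0" using d1(1) d2(1) d3(1) by (simp add: d_def)
  ultimately show "\<exists>d>0. \<forall>s\<in>S. \<bar>s - t\<bar> < d \<longrightarrow>
     \<bar>f (sigma S t) * g (sigma S t) - f s * g s - (D * g t + f (sigma S t) * D') * (sigma S t - s)\<bar>
       \<le> e * \<bar>sigma S t - s\<bar>"
    by blast
qed

text \<open>Near a right-scattered point the increments \<open>\<sigma> t - s\<close> are bounded away from 0, so that continuity turns
  the single difference quotient over the gap into the derivative.\<close>

lemma has_delta_derivative_scattered:
  assumes f: "continuous_on S f" and t: "t \<in> S" "t < sigma S t"
  shows "has_delta_derivative S f ((f (sigma S t) - f t) / (sigma S t - t)) t"
  unfolding has_delta_derivative_iff
proof (intro allI impI)
  fix e :: real assume e: "e > 0"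
  define m where "m = sigma S t - t"
  define D where "D = (f (sigma S t) - f t) / m"
  have m: "m > 0" using t by (simp add: m_def)
  have cont: "continuous_on S (\<lambda>s. f (sigma S t) - f s - D * (sigma S t - s))"
    by (intro continuous_intros f)
  have pos: "e * (m / 2) > 0" using m e by simp
  obtain d where d: "d > 0"
    "\<And>s. s \<in> S \<Longrightarrow> \<bar>s - t\<bar> < d \<Longrightarrow>
       \<bar>(f (sigma S t) - f s - D * (sigma S t - s)) - (f (sigma S t) - f t - D * (sigma S t - t))\<bar> < e * (m / 2)"
    by (rule continuous_on_dist[OF cont t(1) pos]) blast
  have z: "f (sigma S t) - f t - D * (sigma S t - t) = 0"
    using m by (simp add: D_def m_def)
  have "\<bar>f (sigma S t) - f s - D * (sigma S t - s)\<bar> \<le> e * \<bar>sigma S t - s\<bar>"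
    if s: "s \<in> S" "\<bar>s - t\<bar> < min d (m / 2)" for s
  proof -
    have "\<bar>f (sigma S t) - f s - D * (sigma S t - s)\<bar> \<le> e * (m / 2)"
      using d(2)[of s] s z by auto
    also have "\<dots> \<le> e * \<bar>sigma S t - s\<bar>"
      using s e by (intro mult_left_mono) (auto simp: m_def abs_if split: if_splits)
    finally show ?thesis .
  qed
  then show "\<exists>d>0. \<forall>s\<in>S. \<bar>s - t\<bar> < d \<longrightarrow> \<bar>f (sigma S t) - f s -
      (f (sigma S t) - f t) / (sigma S t - t) * (sigma S t - s)\<bar> \<le> e * \<bar>sigma S t - s\<bar>"
    using d(1) m by (intro exI[of _ "min d (m / 2)"]) (auto simp: D_def m_def)
qed

text \<open>A mean value inequality by the method of continuous induction: for every \<open>\<epsilon>\<close>, the change of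
  \<open>F\<close> from \<open>Inf S\<close> to \<open>t\<close> is at most \<open>\<epsilon>\<close> times the length plus \<open>\<epsilon>\<close> for every exceptional point passed.\<close>

lemma zero_delta_derivative_constant:
  assumes F: "continuous_on S F" and E: "finite E" "\<And>t. t \<in> E \<Longrightarrow> sigma S t = t"
    and D: "\<And>t. t \<in> kappa S - E \<Longrightarrow> has_delta_derivative S F 0 t" and t: "t \<in> S"
  shows "F t = F (Inf S)"
proof -
  let ?a = "Inf S"
  have "\<bar>F t - F ?a\<bar> \<le> e * (t - ?a) + e * card (E \<inter> {..<t})" if e: "e > 0" for e
  proof -
    define B where "B u = e * (u - ?a) + e * card (E \<inter> {..<u})" for u
    define P where "P u \<longleftrightarrow> \<bar>F u - F ?a\<bar> \<le> B u" for u
    define A where "A = {u \<in> S. \<forall>s \<in> S \<inter> {..u}. P s}"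
    have card: "card (E \<inter> {..<u}) \<le> card (E \<inter> {..<v})" if "u \<le> v" for u v
      using that E(1) by (intro card_mono) auto
    have B: "B u + e * (v - u) \<le> B v" if "u \<le> v" for u v
      using card[OF that] e by (simp add: B_def algebra_simps)
    have aA: "?a \<in> A"
    proof -
      have "S \<inter> {..?a} = {?a}" using Inf_le Inf_mem by force
      then show ?thesis using e Inf_mem by (simp add: A_def P_def B_def)
    qed
    define c where "c = Sup A"
    have bA: "bdd_above A" using bdd(1) by (rule bdd_above_mono) (auto simp: A_def)
    have cl: "c \<in> closure A" unfolding c_def using aA bA by (intro closure_contains_Sup) auto
    have cS: "c \<in> S" using cl closure_minimal[of A S] closed by (auto simp: A_def)
    have below: "P s" if s: "s \<in> S" "s < c" for s
    proof -
      obtain u where "u \<in> A" "s < u" using s less_cSupD[of A s] aA by (auto simp: c_def)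
      then show ?thesis using s by (auto simp: A_def)
    qed
    have Pc: "P c"
    proof (cases "c \<in> A")
      case True
      then show ?thesis using cS by (auto simp: A_def)
    next
      case False
      have "\<bar>F c - F ?a\<bar> \<le> B c + e'" if e': "e' > 0" for e'
      proof -
        obtain d where d: "d > 0" "\<And>s. s \<in> S \<Longrightarrow> \<bar>s - c\<bar> < d \<Longrightarrow> \<bar>F s - F c\<bar> < e'"
          using continuous_on_dist[OF F cS e'] by metis
        obtain u where u: "u \<in> A" "\<bar>u - c\<bar> < d"
          using cl d(1) unfolding closure_approachable dist_real_def by blast
        have "u \<le> c" unfolding c_def using u(1) bA by (rule cSup_upper)
        then have "B u \<le> B c" using B[of u c] e
          by (smt (verit) mult_nonneg_nonneg)
        moreover have "P u" "u \<in> S" using u(1) by (auto simp: A_def)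
        ultimately show ?thesis using d(2)[of u] u(2) unfolding P_def by linarith
      qed
      then show ?thesis unfolding P_def by (rule field_le_epsilon)
    qed
    have cA: "c \<in> A"
      unfolding A_def using cS Pc below by (auto simp: le_less)
    have "c = Sup S"
    proof (rule ccontr)
      assume "c \<noteq> Sup S"
      then have lt: "c < Sup S" using le_Sup[OF cS] by simp
      have no: False if v: "v \<in> S" "c < v" "\<And>s. s \<in> S \<Longrightarrow> c < s \<Longrightarrow> s \<le> v \<Longrightarrow> P s" for v
      proof -
        have "P s" if "s \<in> S \<inter> {..v}" for s
          using that v(3)[of s] below[of s] Pc by (cases s c rule: linorder_cases) auto
        then have "v \<in> A" unfolding A_def using v(1) by simp
        then have "v \<le> c" unfolding c_def using bA by (intro cSup_upper)
        then show False using v by simp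
      qed
      have ck: "c \<in> kappa S" using kappaI[OF cS lt] .
      show False
      proof (cases "sigma S c = c")
        case False
        then have lts: "c < sigma S c" using le_sigma[of c] lt by auto
        have "has_delta_derivative S F 0 c" using D[of c] ck E(2)[of c] False by auto
        moreover have "has_delta_derivative S F ((F (sigma S c) - F c) / (sigma S c - c)) c"
          using has_delta_derivative_scattered[OF F cS lts] .
        moreover have "Inf S < Sup S" using lt Inf_le[OF cS] by simp
        ultimately have "(F (sigma S c) - F c) / (sigma S c - c) = 0"
          using delta_derivative_unique ck by blast
        then have "F (sigma S c) = F c" using lts by simp
        moreover have "B c \<le> B (sigma S c)"
          using B[of c "sigma S c"] lts e by (smt (verit) mult_nonneg_nonneg)
        ultimately have "P (sigma S c)" using Pc by (simp add: P_def)
        then show False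
          using no[OF sigma_mem lts] sigma_le by (metis order_antisym)
      next
        case True
        have step: "\<exists>d>0. \<forall>s\<in>S. c < s \<and> s < c + d \<longrightarrow> P s"
        proof (cases "c \<in> E")
          case False
          then have "has_delta_derivative S F 0 c" using D[of c] ck by auto
          then obtain d where d: "d > 0" "\<forall>s\<in>S. \<bar>s - c\<bar> < d \<longrightarrow> \<bar>F c - F s\<bar> \<le> e * \<bar>c - s\<bar>"
            using e unfolding has_delta_derivative_iff True by auto
          have "P s" if s: "s \<in> S" "c < s" "s < c + d" for s
          proof -
            have "\<bar>F c - F s\<bar> \<le> e * (s - c)" using bspec[OF d(2) s(1)] s by simp
            then show ?thesis using Pc B[of c s] s unfolding P_def by linarith
          qed
          then show ?thesis using d(1) by blast
        next
          \<comment> \<open>continuity only bounds the jump by \<open>e\<close>, which the newly passed point of \<open>E\<close> pays for\<close>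
          case cE: True
          obtain d where d: "d > 0" "\<And>s. s \<in> S \<Longrightarrow> \<bar>s - c\<bar> < d \<Longrightarrow> \<bar>F s - F c\<bar> < e"
            using continuous_on_dist[OF F cS e] by metis
          have "P s" if s: "s \<in> S" "c < s" "s < c + d" for s
          proof -
            have "card (E \<inter> {..<c}) < card (E \<inter> {..<s})"
              using cE E(1) s by (intro psubset_card_mono) auto
            then have "e * (card (E \<inter> {..<c}) + 1) \<le> e * card (E \<inter> {..<s})"
              using e by (intro mult_left_mono) auto
            moreover have "e * (c - ?a) \<le> e * (s - ?a)" using e s by (intro mult_left_mono) auto
            ultimately have "B c + e \<le> B s" by (simp add: B_def algebra_simps)
            then show ?thesis using Pc d(2)[of s] s unfolding P_def by linarith
          qed
          then show ?thesis using d(1) by blast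
        qed
        then obtain d where d: "d > 0" "\<forall>s\<in>S. c < s \<and> s < c + d \<longrightarrow> P s" by blast
        obtain s where "s \<in> S" "c < s" "s < c + d"
          using right_dense_approach[OF True lt, of "c + d"] d(1) by auto
        then show False using no[of s] d(2) by force
      qed
    qed
    then have "P t" using cA t le_Sup by (auto simp: A_def)
    then show ?thesis by (simp add: P_def B_def)
  qed
  note bound = this
  \<comment> \<open>the total budget is \<open>e\<close> times a number that does not depend on \<open>e\<close>\<close>
  define N where "N = (t - ?a) + card (E \<inter> {..<t}) + 1"
  have N: "N > 0" using Inf_le[OF t] by (simp add: N_def)
  have "\<bar>F t - F ?a\<bar> \<le> 0 + e" if "e > 0" for e
  proof -
    have "\<bar>F t - F ?a\<bar> \<le> e / N * (t - ?a) + e / N * card (E \<inter> {..<t})"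
      using bound[of "e / N"] that N by simp
    also have "\<dots> = e / N * ((t - ?a) + card (E \<inter> {..<t}))" by (simp only: distrib_left)
    also have "\<dots> \<le> e / N * N" using that N by (intro mult_left_mono) (auto simp: N_def)
    finally show ?thesis using N by simp
  qed
  then have "\<bar>F t - F ?a\<bar> \<le> 0" by (rule field_le_epsilon)
  then show ?thesis by simp
qed

text \<open>The delta integral is taken with an arbitrarily chosen antiderivative, which differs from \<open>F\<close> by a
  constant.\<close>

lemma delta_integral_antiderivative:
  assumes F: "delta_antiderivative S f F" and cd: "c \<in> S" "d \<in> S"
  shows "delta_integral S c d f = F d - F c"
proof -
  define G where "G = (SOME F. delta_antiderivative S f F)"
  have G: "delta_antiderivative S f G" unfolding G_def by (rule someI[of "delta_antiderivative S f", OF F])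
  obtain E1 where E1: "finite E1" "\<forall>t\<in>E1. sigma S t = t"
    "\<forall>t\<in>kappa S - E1. has_delta_derivative S F (f t) t"
    using F unfolding delta_antiderivative_def by blast
  obtain E2 where E2: "finite E2" "\<forall>t\<in>E2. sigma S t = t"
    "\<forall>t\<in>kappa S - E2. has_delta_derivative S G (f t) t"
    using G unfolding delta_antiderivative_def by blast
  have "has_delta_derivative S (\<lambda>s. 1 * F s + (- 1) * G s) 0 t" if "t \<in> kappa S - (E1 \<union> E2)" for t
    using has_delta_derivative_linear[of F "f t" t G "f t" 1 "- 1"] E1(3) E2(3) that by auto
  moreover have "continuous_on S (\<lambda>s. 1 * F s + (- 1) * G s)"
    using F G by (auto simp: delta_antiderivative_def intro!: continuous_intros)
  ultimately have "F t - G t = F (Inf S) - G (Inf S)" if "t \<in> S" for t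
    using zero_delta_derivative_constant[of "\<lambda>s. 1 * F s + (- 1) * G s" "E1 \<union> E2" t] E1 E2 that by auto
  then have "F c - G c = F d - G d" using cd by simp
  then show ?thesis unfolding delta_integral_def Let_def G_def[symmetric] by simp
qed

end

section \<open>Piecewise rd-continuous functions and their integrals\<close>

text \<open>The candidate for the antiderivative as an ordinary integral: \<open>rho S\<close> maps the whole gap \<open>(t, \<sigma> t]\<close> to
  \<open>t\<close>, so the gap contributes its length times \<open>f t\<close>, as it must in a delta integral. The backward jump
  also has the advantage that it only looks at points below \<open>x\<close> and therefore does not change when the time
  scale is truncated above \<open>x\<close>.\<close>

definition delta_primitive :: "real set \<Rightarrow> (real \<Rightarrow> real) \<Rightarrow> real \<Rightarrow> real" where
  "delta_primitive S f t = integral {Inf S..t} (\<lambda>x. f (rho S x))"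

lemma tendsto_at_two_sided:
  fixes f :: "real \<Rightarrow> real"
  assumes "(f \<longlongrightarrow> l) (at t within K \<inter> {..<t})" "(f \<longlongrightarrow> l) (at t within K \<inter> {t<..})"
  shows "(f \<longlongrightarrow> l) (at t within K)"
proof -
  have "(f \<longlongrightarrow> l) (at t within (K \<inter> {..<t} \<union> K \<inter> {t<..}))"
    unfolding at_within_union using assms by (rule filterlim_sup)
  also have "K \<inter> {..<t} \<union> K \<inter> {t<..} = K - {t}" by auto
  finally show ?thesis by (simp add: at_within_def)
qed

context compact_time_scale
begin

lemma piecewise_rd_continuous_combine:
  assumes f: "piecewise_rd_continuous S f" and g: "piecewise_rd_continuous S g"
    and op: "\<And>F l m. (f \<longlongrightarrow> l) F \<Longrightarrow> (g \<longlongrightarrow> m) F \<Longrightarrow> ((\<lambda>x. op (f x) (g x)) \<longlongrightarrow> op l m) F"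
  shows "piecewise_rd_continuous S (\<lambda>x. op (f x) (g x))"
proof -
  have lim: "\<exists>l. ((\<lambda>x. op (f x) (g x)) \<longlongrightarrow> l) F" if "\<exists>l. (f \<longlongrightarrow> l) F" "\<exists>l. (g \<longlongrightarrow> l) F" for F
    using that op by metis
  have rd: "rd_continuous_at S (\<lambda>x. op (f x) (g x)) t" if "rd_continuous_at S f t" "rd_continuous_at S g t" for t
    using that unfolding rd_continuous_at_def continuous_within by (simp add: op lim)
  obtain E where E: "finite E" "\<forall>t \<in> kappa S - E. rd_continuous_at S f t"
    using f unfolding piecewise_rd_continuous_def by blast
  obtain E' where E': "finite E'" "\<forall>t \<in> kappa S - E'. rd_continuous_at S g t"
    using g unfolding piecewise_rd_continuous_def by blast
  have "finite (E \<union> E')" "\<forall>t \<in> kappa S - (E \<union> E'). rd_continuous_at S (\<lambda>x. op (f x) (g x)) t"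
    using E E' rd by auto
  moreover have "\<forall>t \<in> kappa S. (\<exists>l. ((\<lambda>x. op (f x) (g x)) \<longlongrightarrow> l) (at t within (kappa S \<inter> {..<t}))) \<and>
                    (\<exists>l. ((\<lambda>x. op (f x) (g x)) \<longlongrightarrow> l) (at t within (kappa S \<inter> {t<..})))"
    using f g lim unfolding piecewise_rd_continuous_def by simp
  ultimately show ?thesis
    unfolding piecewise_rd_continuous_def by blast
qed

lemma piecewise_rd_continuous_add:
  "piecewise_rd_continuous S f \<Longrightarrow> piecewise_rd_continuous S g \<Longrightarrow> piecewise_rd_continuous S (\<lambda>x. f x + g x)"
  by (rule piecewise_rd_continuous_combine) (auto intro: tendsto_intros)

lemma piecewise_rd_continuous_mult:
  "piecewise_rd_continuous S f \<Longrightarrow> piecewise_rd_continuous S g \<Longrightarrow> piecewise_rd_continuous S (\<lambda>x. f x * g x)"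
  by (rule piecewise_rd_continuous_combine) (auto intro: tendsto_intros)

lemma piecewise_rd_continuous_of_continuous:
  assumes "continuous_on (kappa S) f"
  shows "piecewise_rd_continuous S f"
proof -
  have lim: "(f \<longlongrightarrow> f t) (at t within kappa S \<inter> A)" if "t \<in> kappa S" for t A
    using assms that by (auto simp: continuous_on_def intro: tendsto_within_subset)
  have "(f \<longlongrightarrow> f t) (at t within kappa S)" if "t \<in> kappa S" for t
    using lim[OF that, of UNIV] by simp
  then have "\<forall>t \<in> kappa S - {}. rd_continuous_at S f t"
    using lim unfolding rd_continuous_at_def continuous_within by blast
  then show ?thesis
    using lim unfolding piecewise_rd_continuous_def by blast
qed

lemma piecewise_rd_continuous_const: "piecewise_rd_continuous S (\<lambda>x. c)"
  by (rule piecewise_rd_continuous_of_continuous) simp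

lemma piecewise_rd_continuous_scale:
  "piecewise_rd_continuous S f \<Longrightarrow> piecewise_rd_continuous S (\<lambda>x. c * f x)"
  by (rule piecewise_rd_continuous_mult[OF piecewise_rd_continuous_const])

lemma piecewise_rd_continuous_sum:
  assumes "\<And>i. i \<in> I \<Longrightarrow> piecewise_rd_continuous S (f i)"
  shows "piecewise_rd_continuous S (\<lambda>x. \<Sum>i\<in>I. f i x)"
  using assms
  by (induction I rule: infinite_finite_induct)
    (auto intro: piecewise_rd_continuous_const piecewise_rd_continuous_add)

lemma piecewise_rd_continuous_finite_modification:
  assumes f: "piecewise_rd_continuous S f" and E: "finite E" and eq: "\<And>t. t \<in> kappa S - E \<Longrightarrow> g t = f t"
  shows "piecewise_rd_continuous S g"
proof -
  have lim: "(g \<longlongrightarrow> l) (at t within A)" if "(f \<longlongrightarrow> l) (at t within A)" "A \<subseteq> kappa S" for t l A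
  proof -
    have "open (- (E - {t}))" using E by (intro open_Compl finite_imp_closed) auto
    then have "\<forall>\<^sub>F x in at t within A. x \<in> - (E - {t})"
      by (intro topological_tendstoD[OF tendsto_ident_at]) auto
    then have "\<forall>\<^sub>F x in at t within A. f x = g x"
      using that(2) eq by (auto simp: eventually_at_filter elim!: eventually_mono)
    then show ?thesis using that(1) by (rule Lim_transform_eventually[rotated])
  qed
  obtain E' where E': "finite E'" "\<forall>t \<in> kappa S - E'. rd_continuous_at S f t"
    using f unfolding piecewise_rd_continuous_def by blast
  have "rd_continuous_at S g t" if t: "t \<in> kappa S - (E \<union> E')" for t
  proof -
    have "rd_continuous_at S f t" using t E' by blast
    moreover have "g t = f t" using t eq by blast
    ultimately show ?thesis
      using lim[of _ t "kappa S"] lim[of _ t "kappa S \<inter> {..<t}"]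
      unfolding rd_continuous_at_def continuous_within by auto
  qed
  moreover have "finite (E \<union> E')" using E E' by simp
  moreover have "\<forall>t \<in> kappa S. (\<exists>l. (g \<longlongrightarrow> l) (at t within (kappa S \<inter> {..<t}))) \<and>
                    (\<exists>l. (g \<longlongrightarrow> l) (at t within (kappa S \<inter> {t<..})))"
    using f lim unfolding piecewise_rd_continuous_def by (meson Int_lower1)
  ultimately show ?thesis unfolding piecewise_rd_continuous_def by blast
qed

lemma piecewise_rd_continuous_bounded:
  assumes f: "piecewise_rd_continuous S f"
  shows "\<exists>M. \<forall>t\<in>kappa S. \<bar>f t\<bar> \<le> M"
proof -
  have "\<exists>d M. d > 0 \<and> (\<forall>s\<in>kappa S. \<bar>s - t\<bar> < d \<longrightarrow> \<bar>f s\<bar> \<le> M)" if t: "t \<in> kappa S" for t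
  proof -
    obtain l r where l: "(f \<longlongrightarrow> l) (at t within (kappa S \<inter> {..<t}))" and r: "(f \<longlongrightarrow> r) (at t within (kappa S \<inter> {t<..}))"
      using f t unfolding piecewise_rd_continuous_def by blast
    obtain d1 where d1: "d1 > 0" "\<And>z. z \<in> kappa S \<inter> {..<t} \<Longrightarrow> dist z t < d1 \<Longrightarrow> z \<noteq> t \<Longrightarrow> dist (f z) l < 1"
      using tendstoD[OF l zero_less_one] unfolding eventually_at by blast
    obtain d2 where d2: "d2 > 0" "\<And>z. z \<in> kappa S \<inter> {t<..} \<Longrightarrow> dist z t < d2 \<Longrightarrow> z \<noteq> t \<Longrightarrow> dist (f z) r < 1"
      using tendstoD[OF r zero_less_one] unfolding eventually_at by blast
    have "\<bar>f s\<bar> \<le> \<bar>l\<bar> + \<bar>r\<bar> + \<bar>f t\<bar> + 1" if "s \<in> kappa S" "\<bar>s - t\<bar> < min d1 d2" for s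
      using d1(2)[of s] d2(2)[of s] that
      by (cases s t rule: linorder_cases) (auto simp: dist_real_def)
    then show ?thesis using d1(1) d2(1) by (intro exI[of _ "min d1 d2"] exI[of _ "\<bar>l\<bar> + \<bar>r\<bar> + \<bar>f t\<bar> + 1"]) auto
  qed
  then obtain d M where d: "\<And>t. t \<in> kappa S \<Longrightarrow> d t > 0"
    and M: "\<And>t s. t \<in> kappa S \<Longrightarrow> s \<in> kappa S \<Longrightarrow> \<bar>s - t\<bar> < d t \<Longrightarrow> \<bar>f s\<bar> \<le> M t" by metis
  obtain C where C: "C \<subseteq> kappa S" "finite C" "kappa S \<subseteq> (\<Union>t\<in>C. ball t (d t))"
    using compactE_image[OF compact_kappa, of "kappa S" "\<lambda>t. ball t (d t)"] d by force
  have "\<bar>f s\<bar> \<le> (\<Sum>t\<in>C. \<bar>M t\<bar>)" if s: "s \<in> kappa S" for s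
  proof -
    obtain t where t: "t \<in> C" "s \<in> ball t (d t)" using C(3) s by blast
    then have "\<bar>f s\<bar> \<le> M t" using M[of t s] C(1) s by (auto simp: dist_real_def abs_minus_commute)
    also have "\<dots> \<le> \<bar>M t\<bar>" by simp
    also have "\<dots> \<le> (\<Sum>t\<in>C. \<bar>M t\<bar>)" using C(2) t(1) by (intro member_le_sum) auto
    finally show ?thesis .
  qed
  then show ?thesis by blast
qed

text \<open>Either \<open>rho S\<close> is constant on the left of \<open>x\<close>, or \<open>x\<close> is left-dense and \<open>rho S z\<close> tends to \<open>x\<close> from
  the left along with \<open>z\<close>. In both cases \<open>f\<close> needs no more than one-sided limits; the right-hand side is similar.\<close>

lemma comp_rho_left_limit:
  assumes f: "piecewise_rd_continuous S f" and x: "x \<in> {Inf S..Sup S}"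
  shows "\<exists>l. ((\<lambda>x. f (rho S x)) \<longlongrightarrow> l) (at x within {Inf S..Sup S} \<inter> {..<x})"
proof (cases "rho S x < x")
  case True
  have eq: "rho S z = rho S x" if "rho S x < z" "z \<le> x" for z
    using that rho_mem le_rho by (intro rho_eqI) auto
  have "f (rho S z) = f (rho S x)" if "z \<in> {Inf S..Sup S} \<inter> {..<x}" "dist z x < x - rho S x" for z
    using eq[of z] that by (simp add: dist_real_def)
  then have "\<forall>\<^sub>F z in at x within {Inf S..Sup S} \<inter> {..<x}. f (rho S z) = f (rho S x)"
    unfolding eventually_at using True by (metis diff_gt_0_iff_gt)
  then show ?thesis by (intro exI) (rule tendsto_eventually)
next
  case False
  then have eq: "rho S x = x" using rho_le[of x] x by simp
  then have xk: "x \<in> kappa S" using rho_mem_kappa[of x] x by simp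
  have "filterlim (rho S) (at x within kappa S \<inter> {..<x}) (at x within {Inf S..Sup S} \<inter> {..<x})"
    unfolding filterlim_at
  proof
    have "rho S z \<in> kappa S \<inter> {..<x} \<and> rho S z \<noteq> x" if "z \<in> {Inf S..Sup S} \<inter> {..<x}" for z
      using rho_mem_kappa[of z] rho_le[of z] that by auto
    then
    show "\<forall>\<^sub>F z in at x within {Inf S..Sup S} \<inter> {..<x}. rho S z \<in> kappa S \<inter> {..<x} \<and> rho S z \<noteq> x"
      unfolding eventually_at by (intro exI[of _ 1]) simp
    show "(rho S \<longlongrightarrow> x) (at x within {Inf S..Sup S} \<inter> {..<x})"
    proof (rule tendstoI)
      fix e :: real assume e: "e > 0"
      show "\<forall>\<^sub>F z in at x within {Inf S..Sup S} \<inter> {..<x}. dist (rho S z) x < e"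
      proof (cases "x = Inf S")
        case True
        then have "{Inf S..Sup S} \<inter> {..<x} = {}" by auto
        then show ?thesis by simp
      next
        case False
        then obtain s where s: "s \<in> S" "x - e < s" "s < x"
          using left_dense_approach[OF eq, of "x - e"] x e by auto
        have "dist (rho S z) x < e" if "z \<in> {Inf S..Sup S} \<inter> {..<x}" "dist z x < x - s" for z
          using le_rho[of s z] rho_le[of z] s that by (auto simp: dist_real_def)
        then show ?thesis unfolding eventually_at using s(3)
          by (intro exI[of _ "x - s"]) auto
      qed
    qed
  qed
  moreover obtain l where "(f \<longlongrightarrow> l) (at x within kappa S \<inter> {..<x})"
    using f xk unfolding piecewise_rd_continuous_def by blast
  ultimately show ?thesis by (intro exI) (rule filterlim_compose)
qed

lemma comp_rho_right_limit:
  assumes f: "piecewise_rd_continuous S f" and x: "x \<in> {Inf S..Sup S}"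
  shows "\<exists>l. ((\<lambda>x. f (rho S x)) \<longlongrightarrow> l) (at x within {Inf S..Sup S} \<inter> {x<..})"
proof (cases "x < sigma S x")
  case True
  have eq: "rho S z = rho S (sigma S x)" if "x < z" "z \<le> sigma S x" for z
  proof -
    have "s < z \<longleftrightarrow> s < sigma S x" if "s \<in> S" for s
      using that sigma_le[of s x] \<open>x < z\<close> \<open>z \<le> sigma S x\<close> by linarith
    then have "{s \<in> S. s < z} = {s \<in> S. s < sigma S x}" by blast
    then show ?thesis by (simp only: rho_def)
  qed
  have "f (rho S z) = f (rho S (sigma S x))" if "z \<in> {Inf S..Sup S} \<inter> {x<..}" "dist z x < sigma S x - x" for z
    using eq[of z] that by (simp add: dist_real_def)
  then have "\<forall>\<^sub>F z in at x within {Inf S..Sup S} \<inter> {x<..}. f (rho S z) = f (rho S (sigma S x))"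
    unfolding eventually_at using True by (metis diff_gt_0_iff_gt)
  then show ?thesis by (intro exI) (rule tendsto_eventually)
next
  case False
  then have eq: "sigma S x = x" using le_sigma[of x] x by simp
  then have xS: "x \<in> S" using sigma_mem[of x] by simp
  show ?thesis
  proof (cases "x = Sup S")
    case True
    then have "{Inf S..Sup S} \<inter> {x<..} = {}" by auto
    then show ?thesis by simp
  next
    case False
    then have lt: "x < Sup S" using x by simp
    have gt: "x < rho S z" if "x < z" for z
      using right_dense_approach[OF eq lt that] le_rho by (metis less_le_trans)
    have "filterlim (rho S) (at x within kappa S \<inter> {x<..}) (at x within {Inf S..Sup S} \<inter> {x<..})"
      unfolding filterlim_at
    proof
      have "rho S z \<in> kappa S \<inter> {x<..} \<and> rho S z \<noteq> x" if "z \<in> {Inf S..Sup S} \<inter> {x<..}" for z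
        using rho_mem_kappa[of z] gt[of z] that by auto
      then show "\<forall>\<^sub>F z in at x within {Inf S..Sup S} \<inter> {x<..}. rho S z \<in> kappa S \<inter> {x<..} \<and> rho S z \<noteq> x"
        unfolding eventually_at by (intro exI[of _ 1]) simp
      show "(rho S \<longlongrightarrow> x) (at x within {Inf S..Sup S} \<inter> {x<..})"
      proof (rule tendstoI)
        fix e :: real assume e: "e > 0"
        have "dist (rho S z) x < e" if "z \<in> {Inf S..Sup S} \<inter> {x<..}" "dist z x < e" for z
          using gt[of z] rho_le[of z] that by (auto simp: dist_real_def)
        then show "\<forall>\<^sub>F z in at x within {Inf S..Sup S} \<inter> {x<..}. dist (rho S z) x < e"
          unfolding eventually_at using e by (intro exI[of _ e]) auto
      qed
    qed
    moreover obtain l where "(f \<longlongrightarrow> l) (at x within kappa S \<inter> {x<..})"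
      using f kappaI[OF xS lt] unfolding piecewise_rd_continuous_def by blast
    ultimately show ?thesis by (intro exI) (rule filterlim_compose)
  qed
qed

lemma comp_rho_integrable:
  assumes "piecewise_rd_continuous S f"
  shows "(\<lambda>x. f (rho S x)) integrable_on {Inf S..Sup S}"
  using regulated_integrable[OF Inf_le_Sup] comp_rho_left_limit[OF assms] comp_rho_right_limit[OF assms]
  by blast

lemma comp_rho_integrable_subinterval:
  assumes "piecewise_rd_continuous S f" "Inf S \<le> c" "d \<le> Sup S"
  shows "(\<lambda>x. f (rho S x)) integrable_on {c..d}"
  using comp_rho_integrable[OF assms(1)] by (rule integrable_on_subinterval) (use assms in auto)

lemma delta_primitive_Inf: "delta_primitive S f (Inf S) = 0"
  by (simp add: delta_primitive_def)

lemma delta_primitive_diff: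
  assumes "piecewise_rd_continuous S f" "Inf S \<le> c" "c \<le> d" "d \<le> Sup S"
  shows "delta_primitive S f d - delta_primitive S f c = integral {c..d} (\<lambda>x. f (rho S x))"
  using Henstock_Kurzweil_Integration.integral_combine[OF assms(2,3)
      comp_rho_integrable_subinterval[OF assms(1) order_refl assms(4)]]
  by (simp add: delta_primitive_def)

lemma delta_primitive_continuous:
  assumes "piecewise_rd_continuous S f"
  shows "continuous_on S (delta_primitive S f)"
proof -
  have "continuous_on {Inf S..Sup S} (delta_primitive S f)"
    unfolding delta_primitive_def by (rule indefinite_integral_continuous_1[OF comp_rho_integrable[OF assms]])
  then show ?thesis by (rule continuous_on_subset) (auto simp: Inf_le le_Sup)
qed

text \<open>Between \<open>t\<close> and \<open>s\<close> the values of \<open>rho S\<close> stay strictly on the same side of \<open>t\<close> as \<open>s\<close>, so the integrand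
  is close to the one-sided limit. On the right this uses that \<open>t\<close> is right-dense: on a
  gap after \<open>t\<close> the integrand would be \<open>f t\<close>, whatever the limit is.\<close>

lemma delta_primitive_estimate:
  assumes f: "piecewise_rd_continuous S f" and t: "t \<in> S"
    and A: "A = {..<t} \<or> A = {t<..} \<and> sigma S t = t"
    and lim: "(f \<longlongrightarrow> l) (at t within kappa S \<inter> A)" and e: "e > 0"
  obtains d where "d > 0" and "\<And>s. s \<in> S \<inter> A \<Longrightarrow> \<bar>s - t\<bar> < d \<Longrightarrow>
      \<bar>delta_primitive S f t - delta_primitive S f s - l * (t - s)\<bar> \<le> e * \<bar>t - s\<bar>"
proof -
  let ?F = "delta_primitive S f"
  obtain d where d: "d > 0" "\<And>z. z \<in> kappa S \<inter> A \<Longrightarrow> dist z t < d \<Longrightarrow> z \<noteq> t \<Longrightarrow> dist (f z) l < e"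
    using tendstoD[OF lim e] unfolding eventually_at by blast
  have "\<bar>?F t - ?F s - l * (t - s)\<bar> \<le> e * \<bar>t - s\<bar>" if s: "s \<in> S \<inter> A" "\<bar>s - t\<bar> < d" for s
  proof -
    have sS: "s \<in> S" "s \<le> Sup S" "Inf S \<le> s" "t \<le> Sup S" "Inf S \<le> t"
      using s t le_Sup Inf_le by auto
    consider "A = {..<t}" "s < t" | "A = {t<..}" "sigma S t = t" "t < s" using A s by auto
    then show ?thesis
    proof cases
      case 1
      have "\<bar>f (rho S x) - l\<bar> \<le> e" if x: "s < x" "x < t" for x
        using d(2)[of "rho S x"] rho_mem_kappa[of x] rho_le[of x] le_rho[OF sS(1) x(1)] x sS s 1
        by (auto simp: dist_real_def)
      then have "\<bar>integral {s..t} (\<lambda>x. f (rho S x)) - l * (t - s)\<bar> \<le> e * (t - s)"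
        using comp_rho_integrable_subinterval[OF f] sS 1 e by (intro integral_near_constant) auto
      then show ?thesis using delta_primitive_diff[OF f, of s t] sS 1 by simp
    next
      case 2
      have "\<bar>f (rho S x) - l\<bar> \<le> e" if x: "t < x" "x < s" for x
      proof -
        obtain s' where "s' \<in> S" "t < s'" "s' < x"
          using right_dense_approach[OF 2(2), of x] x sS by auto
        then have "t < rho S x" using le_rho[of s' x] by simp
        then show ?thesis
          using d(2)[of "rho S x"] rho_mem_kappa[of x] rho_le[of x] x sS s 2
          by (auto simp: dist_real_def)
      qed
      then have "\<bar>integral {t..s} (\<lambda>x. f (rho S x)) - l * (s - t)\<bar> \<le> e * (s - t)"
        using comp_rho_integrable_subinterval[OF f] sS 2 e by (intro integral_near_constant) auto
      then show ?thesis using delta_primitive_diff[OF f, of t s] sS 2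
        by (simp add: abs_if algebra_simps split: if_splits)
    qed
  qed
  then show thesis using that d(1) by blast
qed

lemma delta_primitive_has_delta_derivative:
  assumes f: "piecewise_rd_continuous S f" and t: "t \<in> kappa S"
    and c: "sigma S t = t \<Longrightarrow> (f \<longlongrightarrow> f t) (at t within kappa S)"
  shows "has_delta_derivative S (delta_primitive S f) (f t) t"
proof (cases "sigma S t = t")
  case False
  have tS: "t \<in> S" using t kappa_subset by auto
  then have lt: "t < sigma S t" using False le_sigma[of t] le_Sup by force
  have bd: "Inf S \<le> t" "sigma S t \<le> Sup S" using Inf_le[OF tS] le_Sup[OF sigma_mem] by auto
  have "\<bar>integral {t..sigma S t} (\<lambda>x. f (rho S x)) - f t * (sigma S t - t)\<bar> \<le> 0 * (sigma S t - t)"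
    using comp_rho_integrable_subinterval[OF f] bd lt rho_eq_of_scattered[OF tS]
    by (intro integral_near_constant) auto
  then have "delta_primitive S f (sigma S t) - delta_primitive S f t = f t * (sigma S t - t)"
    using delta_primitive_diff[OF f, of t "sigma S t"] bd lt by simp
  then show ?thesis
    using has_delta_derivative_scattered[OF delta_primitive_continuous[OF f] tS lt] lt by simp
next
  case True
  have tS: "t \<in> S" using t kappa_subset by auto
  have lim: "(f \<longlongrightarrow> f t) (at t within kappa S \<inter> A)" for A
    using c[OF True] by (rule tendsto_within_subset) auto
  show ?thesis
    unfolding has_delta_derivative_iff True
  proof (intro allI impI)
    fix e :: real assume e: "e > 0"
    let ?F = "delta_primitive S f"
    obtain d1 where d1: "d1 > 0" "\<And>s. s \<in> S \<inter> {..<t} \<Longrightarrow> \<bar>s - t\<bar> < d1 \<Longrightarrow>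
      \<bar>?F t - ?F s - f t * (t - s)\<bar> \<le> e * \<bar>t - s\<bar>"
      using delta_primitive_estimate[OF f tS _ lim e, of "{..<t}"] by blast
    obtain d2 where d2: "d2 > 0" "\<And>s. s \<in> S \<inter> {t<..} \<Longrightarrow> \<bar>s - t\<bar> < d2 \<Longrightarrow>
      \<bar>?F t - ?F s - f t * (t - s)\<bar> \<le> e * \<bar>t - s\<bar>"
      using delta_primitive_estimate[OF f tS _ lim e, of "{t<..}"] True by blast
    have "\<bar>?F t - ?F s - f t * (t - s)\<bar> \<le> e * \<bar>t - s\<bar>" if "s \<in> S" "\<bar>s - t\<bar> < min d1 d2" for s
      using d1(2)[of s] d2(2)[of s] that by (cases s t rule: linorder_cases) auto
    then show "\<exists>d>0. \<forall>s\<in>S. \<bar>s - t\<bar> < d \<longrightarrow> \<bar>?F t - ?F s - f t * (t - s)\<bar> \<le> e * \<bar>t - s\<bar>"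
      using d1(1) d2(1) by (intro exI[of _ "min d1 d2"]) auto
  qed
qed

lemma delta_primitive_derivative_exceptions:
  assumes f: "piecewise_rd_continuous S f"
  obtains E where "finite E" "\<And>t. t \<in> E \<Longrightarrow> t \<in> kappa S \<and> sigma S t = t"
    "\<And>t. t \<in> kappa S - E \<Longrightarrow> has_delta_derivative S (delta_primitive S f) (f t) t"
proof -
  obtain E where E: "finite E" "\<forall>t \<in> kappa S - E. rd_continuous_at S f t"
    using f unfolding piecewise_rd_continuous_def by blast
  \<comment> \<open>at right-scattered points the derivative is correct whether or not \<open>f\<close> is continuous\<close>
  show thesis
  proof (rule that[of "{t \<in> E. t \<in> kappa S \<and> sigma S t = t}"])
    fix t assume "t \<in> kappa S - {t \<in> E. t \<in> kappa S \<and> sigma S t = t}"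
    then show "has_delta_derivative S (delta_primitive S f) (f t) t"
      using E(2) by (intro delta_primitive_has_delta_derivative f)
        (auto simp: rd_continuous_at_def continuous_within)
  qed (use E in auto)
qed

lemma delta_primitive_antiderivative:
  assumes f: "piecewise_rd_continuous S f"
  shows "delta_antiderivative S f (delta_primitive S f)"
proof -
  obtain E where "finite E" "\<And>t. t \<in> E \<Longrightarrow> t \<in> kappa S \<and> sigma S t = t"
    "\<And>t. t \<in> kappa S - E \<Longrightarrow> has_delta_derivative S (delta_primitive S f) (f t) t"
    using delta_primitive_derivative_exceptions[OF f] by metis
  then show ?thesis
    unfolding delta_antiderivative_def using delta_primitive_continuous[OF f] by blast
qed

lemma delta_integral_eq_primitive:
  assumes "piecewise_rd_continuous S f" "d \<in> S"
  shows "delta_integral S (Inf S) d f = delta_primitive S f d"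
  using delta_integral_antiderivative[OF delta_primitive_antiderivative[OF assms(1)] Inf_mem assms(2)]
  by (simp add: delta_primitive_Inf)

lemma antiderivative_diff_eq_primitive_diff:
  assumes "piecewise_rd_continuous S f" "delta_antiderivative S f u" "s \<in> S" "t \<in> S"
  shows "u t - u s = delta_primitive S f t - delta_primitive S f s"
  using delta_integral_antiderivative[OF assms(2-4)]
    delta_integral_antiderivative[OF delta_primitive_antiderivative[OF assms(1)] assms(3,4)] by simp

text \<open>By the mean value estimate a one-sided limit of the derivative is the one-sided derivative. Thus a
  derivative that exists at a right-dense point leaves no room for a jump there.\<close>

lemma delta_derivative_tendsto:
  assumes f: "piecewise_rd_continuous S f" and u: "delta_antiderivative S f u"
    and t: "t \<in> kappa S" "sigma S t = t" and D: "has_delta_derivative S u D t"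
  shows "(f \<longlongrightarrow> D) (at t within kappa S)"
proof -
  have tS: "t \<in> S" using t kappa_subset by auto
  have lim: "(f \<longlongrightarrow> D) (at t within kappa S \<inter> A)" if A: "A = {..<t} \<or> A = {t<..}" for A
  proof -
    obtain l where l: "(f \<longlongrightarrow> l) (at t within kappa S \<inter> A)"
      using f t A unfolding piecewise_rd_continuous_def by blast
    show ?thesis
    proof (cases "t islimpt (kappa S \<inter> A)")
      case False
      then have "at t within kappa S \<inter> A = bot" by (simp add: trivial_limit_within)
      then show ?thesis by simp
    next
      case True
      have "\<bar>D - l\<bar> \<le> 0 + e" if e: "e > 0" for e
      proof -
        obtain d1 where d1: "d1 > 0" "\<And>s. s \<in> S \<inter> A \<Longrightarrow> \<bar>s - t\<bar> < d1 \<Longrightarrow>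
            \<bar>delta_primitive S f t - delta_primitive S f s - l * (t - s)\<bar> \<le> e / 2 * \<bar>t - s\<bar>"
          using delta_primitive_estimate[OF f tS _ l, of "e / 2"] A t(2) e half_gt_zero by metis
        obtain d2 where d2: "d2 > 0" "\<forall>s\<in>S. \<bar>s - t\<bar> < d2 \<longrightarrow> \<bar>u t - u s - D * (t - s)\<bar> \<le> e / 2 * \<bar>t - s\<bar>"
          using D e unfolding has_delta_derivative_iff t(2) by (metis half_gt_zero)
        obtain s where s: "s \<in> kappa S \<inter> A" "s \<noteq> t" "dist s t < min d1 d2"
          using islimpt_approachable[THEN iffD1, OF True, rule_format, of "min d1 d2"] d1(1) d2(1) by auto
        then have sS: "s \<in> S" using kappa_subset by auto
        have a: "\<bar>u t - u s - l * (t - s)\<bar> \<le> e / 2 * \<bar>t - s\<bar>"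
          unfolding antiderivative_diff_eq_primitive_diff[OF f u sS tS]
          using d1(2)[of s] s sS by (auto simp: dist_real_def)
        have b: "\<bar>u t - u s - D * (t - s)\<bar> \<le> e / 2 * \<bar>t - s\<bar>"
          using d2(2) s sS by (auto simp: dist_real_def)
        have "\<bar>(D - l) * (t - s)\<bar> \<le> e * \<bar>t - s\<bar>"
          using a b abs_triangle_ineq4[of "u t - u s - l * (t - s)" "u t - u s - D * (t - s)"]
          by (simp add: left_diff_distrib)
        then show ?thesis using s(2) by (simp add: abs_mult)
      qed
      then have "\<bar>D - l\<bar> \<le> 0" by (rule field_le_epsilon)
      then show ?thesis using l by simp
    qed
  qed
  show ?thesis by (rule tendsto_at_two_sided[OF lim lim]) simp_all
qed

lemma sigma_integral_eq:
  assumes "piecewise_rd_continuous S f"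
  shows "sigma_integral S f = (\<lambda>s. delta_primitive S f (sigma S s))"
  unfolding sigma_integral_def using delta_integral_eq_primitive[OF assms sigma_mem] by simp

text \<open>Dense points are limits of their neighbours' forward jumps, so the continuity of the primitive survives
  the composition with \<open>\<sigma>\<close> there.\<close>

lemma sigma_integral_tendsto:
  assumes f: "piecewise_rd_continuous S f" and t: "t \<in> S"
    and A: "A = {..<t} \<or> A = {t<..} \<and> sigma S t = t"
  shows "(sigma_integral S f \<longlongrightarrow> delta_primitive S f t) (at t within kappa S \<inter> A)"
proof -
  have "(sigma S \<longlongrightarrow> t) (at t within kappa S \<inter> A)"
  proof (rule tendstoI)
    fix e :: real assume e: "e > 0"
    show "\<forall>\<^sub>F s in at t within kappa S \<inter> A. dist (sigma S s) t < e"
    proof (cases "A = {..<t}")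
      case True
      have "dist (sigma S s) t < e" if "s \<in> kappa S \<inter> A" "dist s t < e" for s
        using that True le_sigma[of s] sigma_le[OF t, of s] le_Sup[OF t] by (auto simp: dist_real_def)
      then show ?thesis unfolding eventually_at using e by blast
    next
      case False
      then have A': "A = {t<..}" "sigma S t = t" using A by auto
      show ?thesis
      proof (cases "t = Sup S")
        case True
        then have "kappa S \<inter> A = {}" using A' kappa_subset le_Sup by force
        then show ?thesis by simp
      next
        case False
        then obtain s0 where s0: "s0 \<in> S" "t < s0" "s0 < t + e"
          using right_dense_approach[OF A'(2), of "t + e"] le_Sup[OF t] e by auto
        have "dist (sigma S s) t < e" if "s \<in> kappa S \<inter> A" "dist s t < s0 - t" for s
          using that A' le_sigma[of s] sigma_le[OF s0(1), of s] le_Sup[of s] kappa_subset s0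
          by (auto simp: dist_real_def)
        then show ?thesis unfolding eventually_at using s0 by (intro exI[of _ "s0 - t"]) auto
      qed
    qed
  qed
  then have "((\<lambda>s. delta_primitive S f (sigma S s)) \<longlongrightarrow> delta_primitive S f t) (at t within kappa S \<inter> A)"
    by (rule continuous_on_tendsto_compose[OF delta_primitive_continuous[OF f] _ t])
      (simp add: sigma_mem)
  then show ?thesis by (simp only: sigma_integral_eq[OF f])
qed

lemma sigma_integral_right_dense:
  assumes f: "piecewise_rd_continuous S f" and t: "t \<in> S" "sigma S t = t"
  shows "(sigma_integral S f \<longlongrightarrow> sigma_integral S f t) (at t within kappa S)"
proof -
  have eq: "sigma_integral S f t = delta_primitive S f t"
    by (simp add: sigma_integral_eq[OF f] t)
  have lim: "(sigma_integral S f \<longlongrightarrow> sigma_integral S f t) (at t within kappa S \<inter> A)"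
    if "A = {..<t} \<or> A = {t<..}" for A
    unfolding eq by (rule sigma_integral_tendsto[OF f t(1)]) (use that t(2) in blast)
  show ?thesis by (rule tendsto_at_two_sided[OF lim lim]) simp_all
qed

lemma piecewise_rd_continuous_sigma_integral:
  assumes f: "piecewise_rd_continuous S f"
  shows "piecewise_rd_continuous S (sigma_integral S f)"
proof -
  have L: "\<exists>l. (sigma_integral S f \<longlongrightarrow> l) (at t within kappa S \<inter> {..<t})" if "t \<in> kappa S" for t
    using sigma_integral_tendsto[OF f] that kappa_subset by blast
  have R: "\<exists>l. (sigma_integral S f \<longlongrightarrow> l) (at t within kappa S \<inter> {t<..})" if t: "t \<in> kappa S" for t
  proof (cases "sigma S t = t")
    case True
    then show ?thesis using sigma_integral_tendsto[OF f, of t "{t<..}"] t kappa_subset by blast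
  next
    case False
    then have lt: "t < sigma S t" using le_sigma[of t] le_Sup t kappa_subset by force
    have "sigma_integral S f s = 0" if s: "s \<in> kappa S \<inter> {t<..}" "dist s t < sigma S t - t" for s
      using sigma_le[of s t] s kappa_subset by (auto simp: dist_real_def)
    then have "\<forall>\<^sub>F s in at t within kappa S \<inter> {t<..}. sigma_integral S f s = 0"
      unfolding eventually_at using lt by (metis diff_gt_0_iff_gt)
    then show ?thesis by (intro exI) (rule tendsto_eventually)
  qed
  have "rd_continuous_at S (sigma_integral S f) t" if "t \<in> kappa S - {}" for t
    using L sigma_integral_right_dense[OF f, of t] that kappa_subset
    unfolding rd_continuous_at_def continuous_within by auto
  then show ?thesis
    unfolding piecewise_rd_continuous_def using L R by blast
qed

lemma piecewise_rd_continuous_sigma_integral_power: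
  "piecewise_rd_continuous S f \<Longrightarrow> piecewise_rd_continuous S ((sigma_integral S ^^ n) f)"
  by (induction n) (auto intro: piecewise_rd_continuous_sigma_integral)

lemma delta_primitive_linear:
  assumes f: "piecewise_rd_continuous S f" and g: "piecewise_rd_continuous S g" and t: "t \<le> Sup S"
  shows "delta_primitive S (\<lambda>x. p * f x + q * g x) t = p * delta_primitive S f t + q * delta_primitive S g t"
proof -
  note i = comp_rho_integrable_subinterval[OF _ order_refl t]
  show ?thesis unfolding delta_primitive_def
    using integral_add[OF integrable_on_mult_right[OF i[OF f], of p] integrable_on_mult_right[OF i[OF g], of q]]
    by simp
qed

lemma sigma_integral_linear:
  assumes f: "piecewise_rd_continuous S f" and g: "piecewise_rd_continuous S g"
  shows "sigma_integral S (\<lambda>x. p * f x + q * g x) = (\<lambda>s. p * sigma_integral S f s + q * sigma_integral S g s)"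
  using f g
  by (subst (1 2 3) sigma_integral_eq)
    (auto intro!: piecewise_rd_continuous_add piecewise_rd_continuous_scale delta_primitive_linear le_Sup sigma_mem)

end

section \<open>Orthogonal projection in a degenerate inner product\<close>

text \<open>Gram-Schmidt for a form that may be degenerate and vectors that may be dependent: a null vector is
  orthogonal to everything by the Cauchy-Schwarz inequality, so it may be skipped.\<close>

lemma ex_orthogonal_projection:
  fixes B :: "('a \<Rightarrow> real) \<Rightarrow> ('a \<Rightarrow> real) \<Rightarrow> real" and e :: "nat \<Rightarrow> 'a \<Rightarrow> real"
  assumes lin: "\<And>f g p q. f \<in> V \<Longrightarrow> g \<in> V \<Longrightarrow> (\<lambda>x. p * f x + q * g x) \<in> V"
    and Blin: "\<And>f g h p q. f \<in> V \<Longrightarrow> g \<in> V \<Longrightarrow> h \<in> V \<Longrightarrow> B (\<lambda>x. p * f x + q * g x) h = p * B f h + q * B g h"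
    and sym: "\<And>f g. B f g = B g f"
    and nonneg: "\<And>f. f \<in> V \<Longrightarrow> 0 \<le> B f f"
    and e: "\<And>k. k < n \<Longrightarrow> e k \<in> V" and w: "w \<in> V"
  shows "\<exists>c. (\<lambda>x. w x - (\<Sum>j<n. c j * e j x)) \<in> V \<and> (\<forall>k<n. B (\<lambda>x. w x - (\<Sum>j<n. c j * e j x)) (e k) = 0)"
  using e w
proof (induction n arbitrary: w)
  case 0
  then show ?case by simp
next
  case (Suc n)
  obtain a where a: "(\<lambda>x. e n x - (\<Sum>j<n. a j * e j x)) \<in> V"
    "\<And>k. k < n \<Longrightarrow> B (\<lambda>x. e n x - (\<Sum>j<n. a j * e j x)) (e k) = 0"
    using Suc.IH[of "e n"] Suc.prems by auto
  obtain b where b: "(\<lambda>x. w x - (\<Sum>j<n. b j * e j x)) \<in> V"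
    "\<And>k. k < n \<Longrightarrow> B (\<lambda>x. w x - (\<Sum>j<n. b j * e j x)) (e k) = 0"
    using Suc.IH[of w] Suc.prems by auto
  define u where "u = (\<lambda>x. e n x - (\<Sum>j<n. a j * e j x))"
  define w' where "w' = (\<lambda>x. w x - (\<Sum>j<n. b j * e j x))"
  have V: "u \<in> V" "w' \<in> V" "e n \<in> V" using a b Suc.prems by (auto simp: u_def w'_def)
  have uk: "B u (e k) = 0" and wk: "B w' (e k) = 0" if "k < n" for k
    using a b that by (auto simp: u_def w'_def)
  \<comment> \<open>a vector orthogonal to all earlier ones sees no difference between \<open>e n\<close> and \<open>u\<close>\<close>
  have Bu: "B v (e n) = B v u" if v: "v \<in> V" "\<And>k. k < n \<Longrightarrow> B v (e k) = 0" for v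
  proof -
    have "(\<lambda>x. \<Sum>j<m. a j * e j x) \<in> V \<and> B (\<lambda>x. \<Sum>j<m. a j * e j x) v = 0" if "m \<le> n" for m
      using that
    proof (induction m)
      case 0
      show ?case using lin[OF v(1) v(1), of 0 0] Blin[OF v(1) v(1) v(1), of 0 0] by simp
    next
      case (Suc m)
      have em: "e m \<in> V" using Suc.prems by (intro Suc.prems(1) \<open>\<And>k. k < Suc n \<Longrightarrow> e k \<in> V\<close>) simp
      show ?case
        using lin[OF conjunct1[OF Suc.IH] em, of 1 "a m"] Blin[OF conjunct1[OF Suc.IH] em v(1), of 1 "a m"]
          Suc v(2)[of m] sym[of v "e m"] by (simp add: Suc_le_eq)
    qed
    from this[of n] have s: "(\<lambda>x. \<Sum>j<n. a j * e j x) \<in> V" "B (\<lambda>x. \<Sum>j<n. a j * e j x) v = 0" by auto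
    have "u = (\<lambda>x. 1 * e n x + (- 1) * (\<Sum>j<n. a j * e j x))" by (simp add: u_def)
    then have "B u v = B (e n) v" using Blin[OF V(3) s(1) v(1), of 1 "- 1"] s(2) by simp
    then show ?thesis using sym by metis
  qed
  define l where "l = B w' u / B u u"
  \<comment> \<open>if \<open>u\<close> is a null vector, then \<open>l = 0\<close> and the Cauchy-Schwarz inequality takes over\<close>
  have key: "B w' u = l * B u u"
  proof (cases "B u u = 0")
    case False
    then show ?thesis by (simp add: l_def)
  next
    case True
    have q: "0 \<le> B w' w' + 2 * s * B w' u" for s
    proof -
      let ?v = "\<lambda>x. 1 * w' x + s * u x"
      have v: "?v \<in> V" using lin V by blast
      have "B ?v ?v = B w' ?v + s * B u ?v" using Blin[OF V(2,1) v, of 1 s] by simp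
      also have "B w' ?v = B w' w' + s * B w' u"
        using Blin[OF V(2,1) V(2), of 1 s] sym[of w' ?v] sym[of u w'] by simp
      also have "B u ?v = B w' u"
        using Blin[OF V(2,1) V(1), of 1 s] sym[of u ?v] True by simp
      finally show ?thesis using nonneg[OF v] by simp
    qed
    have "B w' u = 0"
    proof (rule ccontr)
      assume ne: "B w' u \<noteq> 0"
      have "2 * (- (B w' w' + 1) / (2 * B w' u)) * B w' u = - (B w' w' + 1)" using ne by (simp add: field_simps)
      then show False using q[of "- (B w' w' + 1) / (2 * B w' u)"] by linarith
    qed
    then show ?thesis using True by simp
  qed
  define v where "v = (\<lambda>x. 1 * w' x + (- l) * u x)"
  have vV: "v \<in> V" unfolding v_def using lin V by blast
  have vB: "B v h = B w' h - l * B u h" if "h \<in> V" for h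
    using Blin[OF V(2,1) that, of 1 "- l"] by (simp add: v_def)
  have vk: "B v (e k) = 0" if "k < n" for k
    using vB[of "e k"] uk wk that Suc.prems(1)[of k] by simp
  have vn: "B v (e n) = 0"
    using Bu[OF vV vk] vB[OF V(1)] key by simp
  define c where "c j = (if j = n then l else b j - l * a j)" for j
  have "(\<Sum>j<n. c j * e j x) = (\<Sum>j<n. b j * e j x) - l * (\<Sum>j<n. a j * e j x)" for x
    by (simp add: c_def sum_distrib_left sum_subtractf algebra_simps)
  then have "v = (\<lambda>x. w x - (\<Sum>j<Suc n. c j * e j x))"
    by (auto simp: v_def w'_def u_def c_def algebra_simps)
  then show ?case using vV vk vn by (auto simp: less_Suc_eq intro!: exI[of _ c])
qed

section \<open>The pairing of two functions by the delta integral\<close>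

definition delta_pairing :: "real set \<Rightarrow> (real \<Rightarrow> real) \<Rightarrow> (real \<Rightarrow> real) \<Rightarrow> real" where
  "delta_pairing S f g = delta_primitive S (\<lambda>x. f x * g x) (Sup S)"

context compact_time_scale
begin

lemma delta_pairing_commute: "delta_pairing S f g = delta_pairing S g f"
  by (simp add: delta_pairing_def mult.commute)

lemma delta_pairing_linear:
  assumes "piecewise_rd_continuous S f" "piecewise_rd_continuous S g" "piecewise_rd_continuous S h"
  shows "delta_pairing S (\<lambda>x. p * f x + q * g x) h = p * delta_pairing S f h + q * delta_pairing S g h"
  using delta_primitive_linear[OF piecewise_rd_continuous_mult[OF assms(1,3)]
      piecewise_rd_continuous_mult[OF assms(2,3)], of "Sup S" p q]
  by (simp add: delta_pairing_def algebra_simps)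

lemma delta_pairing_sum:
  assumes "finite A" "\<And>i. i \<in> A \<Longrightarrow> piecewise_rd_continuous S (f i)" "piecewise_rd_continuous S h"
  shows "delta_pairing S (\<lambda>x. \<Sum>i\<in>A. a i * f i x) h = (\<Sum>i\<in>A. a i * delta_pairing S (f i) h)"
  using assms
proof (induction A)
  case empty
  then show ?case
    using delta_pairing_linear[OF assms(3,3,3), of 0 0] by simp
next
  case (insert j A)
  have "piecewise_rd_continuous S (\<lambda>x. \<Sum>i\<in>A. a i * f i x)"
    using insert by (intro piecewise_rd_continuous_sum piecewise_rd_continuous_scale) auto
  from delta_pairing_linear[OF _ this insert.prems(2), of "f j" "a j" 1] insert
  show ?case by simp
qed

lemma delta_primitive_square_mono:
  assumes f: "piecewise_rd_continuous S f" and cd: "Inf S \<le> c" "c \<le> d" "d \<le> Sup S"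
  shows "delta_primitive S (\<lambda>x. f x * f x) c \<le> delta_primitive S (\<lambda>x. f x * f x) d"
proof -
  note ff = piecewise_rd_continuous_mult[OF f f]
  have "0 \<le> integral {c..d} (\<lambda>x. f (rho S x) * f (rho S x))"
    using comp_rho_integrable_subinterval[OF ff cd(1,3)] by (intro integral_nonneg) auto
  then show ?thesis using delta_primitive_diff[OF ff cd] by simp
qed

lemma delta_pairing_nonneg:
  assumes "piecewise_rd_continuous S f"
  shows "0 \<le> delta_pairing S f f"
  using delta_primitive_square_mono[OF assms order_refl Inf_le_Sup order_refl]
  by (simp add: delta_pairing_def delta_primitive_Inf)

lemma ex_delta_pairing_projection:
  fixes e :: "nat \<Rightarrow> real \<Rightarrow> real"
  assumes w: "piecewise_rd_continuous S w" and e: "\<And>k. piecewise_rd_continuous S (e k)"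
  shows "\<exists>d. piecewise_rd_continuous S (\<lambda>x. w x - (\<Sum>j<n. d j * e j x)) \<and>
    (\<forall>k<n. delta_pairing S (\<lambda>x. w x - (\<Sum>j<n. d j * e j x)) (e k) = 0)"
proof -
  have "\<exists>d. (\<lambda>x. w x - (\<Sum>j<n. d j * e j x)) \<in> {f. piecewise_rd_continuous S f} \<and>
    (\<forall>k<n. delta_pairing S (\<lambda>x. w x - (\<Sum>j<n. d j * e j x)) (e k) = 0)"
    by (rule ex_orthogonal_projection[where B = "delta_pairing S"])
      (use w e in \<open>auto intro: piecewise_rd_continuous_add piecewise_rd_continuous_scale delta_pairing_linear
        delta_pairing_nonneg delta_pairing_commute\<close>)
  then show ?thesis by simp
qed

text \<open>The primitive of \<open>v\<^sup>2\<close> increases from 0 to \<open>\<langle>v, v\<rangle> = 0\<close>, so it vanishes together with its derivative.\<close>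

lemma delta_pairing_definite:
  assumes v: "piecewise_rd_continuous S v" and zero: "delta_pairing S v v = 0"
    and t: "t \<in> kappa S" and c: "sigma S t = t \<Longrightarrow> (v \<longlongrightarrow> v t) (at t within kappa S)"
    and lt: "Inf S < Sup S"
  shows "v t = 0"
proof -
  let ?G = "delta_primitive S (\<lambda>x. v x * v x)"
  have G: "?G s = 0" if s: "s \<in> S" for s
    using delta_primitive_square_mono[OF v order_refl Inf_le[OF s] le_Sup[OF s]]
      delta_primitive_square_mono[OF v Inf_le[OF s] le_Sup[OF s] order_refl] zero
    by (simp add: delta_pairing_def delta_primitive_Inf)
  have "has_delta_derivative S ?G (v t * v t) t"
    using c by (intro delta_primitive_has_delta_derivative piecewise_rd_continuous_mult v t) (auto intro: tendsto_mult)
  moreover have "has_delta_derivative S ?G 0 t"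
    unfolding has_delta_derivative_iff using G sigma_mem by (auto intro!: exI[of _ 1])
  ultimately have "v t * v t = 0" using delta_derivative_unique t lt by blast
  then show ?thesis by simp
qed

text \<open>Integration by parts: the product \<open>F H\<close> of two primitives has the derivative \<open>f H + F\<^sup>\<sigma> h\<close>.\<close>

lemma delta_pairing_by_parts:
  assumes f: "piecewise_rd_continuous S f" and h: "piecewise_rd_continuous S h"
  shows "delta_pairing S f (delta_primitive S h)
    = delta_primitive S f (Sup S) * delta_primitive S h (Sup S) - delta_pairing S (sigma_integral S f) h"
proof -
  let ?F = "delta_primitive S f" and ?H = "delta_primitive S h"
  let ?k = "\<lambda>x. 1 * (f x * ?H x) + 1 * (sigma_integral S f x * h x)"
  have H: "continuous_on S ?H" by (rule delta_primitive_continuous[OF h])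
  have 1: "piecewise_rd_continuous S (\<lambda>x. f x * ?H x)"
    by (intro piecewise_rd_continuous_mult f piecewise_rd_continuous_of_continuous
        continuous_on_subset[OF H kappa_subset])
  have 2: "piecewise_rd_continuous S (\<lambda>x. sigma_integral S f x * h x)"
    by (intro piecewise_rd_continuous_mult piecewise_rd_continuous_sigma_integral f h)
  have k: "piecewise_rd_continuous S ?k"
    using 1 2 by (intro piecewise_rd_continuous_add piecewise_rd_continuous_scale)
  obtain E where E: "finite E" "\<And>t. t \<in> E \<Longrightarrow> t \<in> kappa S \<and> sigma S t = t"
    "\<And>t. t \<in> kappa S - E \<Longrightarrow> has_delta_derivative S ?F (f t) t"
    using delta_primitive_derivative_exceptions[OF f] by metis
  obtain E' where E': "finite E'" "\<And>t. t \<in> E' \<Longrightarrow> t \<in> kappa S \<and> sigma S t = t"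
    "\<And>t. t \<in> kappa S - E' \<Longrightarrow> has_delta_derivative S ?H (h t) t"
    using delta_primitive_derivative_exceptions[OF h] by metis
  have "has_delta_derivative S (\<lambda>x. ?F x * ?H x) (?k t) t" if t: "t \<in> kappa S - (E \<union> E')" for t
    using has_delta_derivative_mult[OF E(3) E'(3) H, of t] t kappa_subset
    by (auto simp: sigma_integral_eq[OF f])
  moreover have "continuous_on S (\<lambda>x. ?F x * ?H x)"
    by (intro continuous_on_mult delta_primitive_continuous f h)
  moreover have "finite (E \<union> E')" "\<forall>t\<in>E \<union> E'. sigma S t = t" using E E' by auto
  ultimately have "delta_antiderivative S ?k (\<lambda>x. ?F x * ?H x)"
    unfolding delta_antiderivative_def by blast
  then have "?F (Sup S) * ?H (Sup S) - ?F (Inf S) * ?H (Inf S)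
      = delta_primitive S ?k (Sup S) - delta_primitive S ?k (Inf S)"
    using antiderivative_diff_eq_primitive_diff[OF k _ Inf_mem Sup_mem] by blast
  also have "delta_primitive S ?k (Sup S)
      = 1 * delta_primitive S (\<lambda>x. f x * ?H x) (Sup S) + 1 * delta_primitive S (\<lambda>x. sigma_integral S f x * h x) (Sup S)"
    by (rule delta_primitive_linear[OF 1 2 order_refl])
  finally show ?thesis by (simp add: delta_pairing_def delta_primitive_Inf)
qed

lemma piecewise_rd_continuous_primitive:
  "piecewise_rd_continuous S f \<Longrightarrow> piecewise_rd_continuous S (delta_primitive S f)"
  by (rule piecewise_rd_continuous_of_continuous[OF continuous_on_subset[OF delta_primitive_continuous kappa_subset]])

lemma piecewise_rd_continuous_primitive_power:
  "piecewise_rd_continuous S f \<Longrightarrow> piecewise_rd_continuous S ((delta_primitive S ^^ n) f)"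
  by (induction n) (auto intro: piecewise_rd_continuous_primitive)

text \<open>Each integration by parts moves one primitive to the other side, where it becomes a \<open>sigma_integral\<close>;
  the boundary terms at \<open>Sup S\<close> vanish by hypothesis, those at \<open>Inf S\<close> by construction.\<close>

lemma delta_pairing_primitive_power:
  assumes f: "piecewise_rd_continuous S f" and v: "piecewise_rd_continuous S v"
    and bd: "\<And>k. 0 < k \<Longrightarrow> k \<le> n \<Longrightarrow> (delta_primitive S ^^ k) v (Sup S) = 0"
  shows "delta_pairing S f ((delta_primitive S ^^ n) v) = (- 1) ^ n * delta_pairing S ((sigma_integral S ^^ n) f) v"
  using f bd
proof (induction n arbitrary: f)
  case 0
  then show ?case by simp
next
  case (Suc n)
  have "delta_pairing S f ((delta_primitive S ^^ Suc n) v)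
      = - delta_pairing S (sigma_integral S f) ((delta_primitive S ^^ n) v)"
    using delta_pairing_by_parts[OF Suc.prems(1) piecewise_rd_continuous_primitive_power[OF v, of n]]
      Suc.prems(2)[of "Suc n"] by simp
  also have "\<dots> = - ((- 1) ^ n * delta_pairing S ((sigma_integral S ^^ n) (sigma_integral S f)) v)"
    using Suc.IH[OF piecewise_rd_continuous_sigma_integral[OF Suc.prems(1)]] Suc.prems(2) by simp
  finally show ?case by (simp add: funpow_swap1)
qed

text \<open>The value of the \<open>(n + 1)\<close>-fold primitive of \<open>v\<close> at \<open>Sup S\<close> is the pairing of the \<open>n\<close>-fold primitive with 1, hence
  \<open>\<plusminus> \<langle>J\<^sup>n 1, v\<rangle>\<close>, where \<open>J\<close> is \<open>sigma_integral S\<close>. The boundary terms on the way are the values for smaller \<open>n\<close>.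
  This translates the terminal conditions on a variation into orthogonality relations for its top derivative.\<close>

lemma primitive_power_Sup_eq_0:
  assumes v: "piecewise_rd_continuous S v"
    and orth: "\<And>k. k < r \<Longrightarrow> delta_pairing S ((sigma_integral S ^^ k) (\<lambda>x. 1)) v = 0"
    and k: "0 < k" "k \<le> r"
  shows "(delta_primitive S ^^ k) v (Sup S) = 0"
  using k
proof (induction k rule: less_induct)
  case (less k)
  then obtain n where n: "k = Suc n" by (cases k) auto
  have "(delta_primitive S ^^ k) v (Sup S) = delta_pairing S (\<lambda>x. 1) ((delta_primitive S ^^ n) v)"
    by (simp add: n delta_pairing_def)
  also have "\<dots> = (- 1) ^ n * delta_pairing S ((sigma_integral S ^^ n) (\<lambda>x. 1)) v"
    using less n by (intro delta_pairing_primitive_power v piecewise_rd_continuous_const) auto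
  also have "\<dots> = 0" using orth[of n] less.prems n by simp
  finally show ?case .
qed

text \<open>By linearity the constants come out of the nested integrals, each multiplied by an iterated integral of 1.\<close>

lemma EL_nested_eq:
  assumes f: "piecewise_rd_continuous S f"
  shows "EL_nested S f c k
    = (\<lambda>s. (sigma_integral S ^^ k) f s - (\<Sum>j=1..k. (- 1) ^ j * c j * (sigma_integral S ^^ (k - j)) (\<lambda>x. 1) s))"
proof (induction k)
  case 0
  then show ?case by simp
next
  case (Suc k)
  note J1 = piecewise_rd_continuous_sigma_integral_power[OF piecewise_rd_continuous_const]
  have J_sum: "sigma_integral S (\<lambda>s. \<Sum>j\<in>A. a j * (sigma_integral S ^^ m j) (\<lambda>x. 1) s)
      = (\<lambda>s. \<Sum>j\<in>A. a j * (sigma_integral S ^^ Suc (m j)) (\<lambda>x. 1) s)"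
    if "finite A" for A :: "nat set" and a m
    using that
  proof (induction A)
    case empty
    show ?case
      using sigma_integral_linear[OF piecewise_rd_continuous_const piecewise_rd_continuous_const, of 0 0 0 0] by simp
  next
    case (insert i A)
    have "piecewise_rd_continuous S (\<lambda>s. \<Sum>j\<in>A. a j * (sigma_integral S ^^ m j) (\<lambda>x. 1) s)"
      by (intro piecewise_rd_continuous_sum piecewise_rd_continuous_scale J1)
    from sigma_integral_linear[OF J1[of "m i" 1] this, of "a i" 1] insert
    show ?case by simp
  qed
  have pw: "piecewise_rd_continuous S (\<lambda>s. \<Sum>j=1..k. (- 1) ^ j * c j * (sigma_integral S ^^ (k - j)) (\<lambda>x. 1) s)"
    by (intro piecewise_rd_continuous_sum piecewise_rd_continuous_scale J1)
  have "sigma_integral S (EL_nested S f c k)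
      = (\<lambda>s. (sigma_integral S ^^ Suc k) f s - (\<Sum>j=1..k. (- 1) ^ j * c j * (sigma_integral S ^^ Suc (k - j)) (\<lambda>x. 1) s))"
    using sigma_integral_linear[OF piecewise_rd_continuous_sigma_integral_power[OF f, of k] pw, of 1 "- 1"]
    unfolding Suc.IH J_sum[OF finite_atLeastAtMost] by simp
  moreover have "(\<Sum>j=1..k. (- 1) ^ j * c j * (sigma_integral S ^^ Suc (k - j)) (\<lambda>x. 1) s)
      = (\<Sum>j=1..k. (- 1) ^ j * c j * (sigma_integral S ^^ (Suc k - j)) (\<lambda>x. 1) s)" for s
    by (intro sum.cong) (auto simp: Suc_diff_le)
  ultimately show ?case by (auto simp: sum.atLeast_Suc_atMost_Suc_shift simp del: funpow.simps)
qed

end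

section \<open>Truncating a time scale at its maximum\<close>

context compact_time_scale
begin

lemma compact_time_scale_kappa: "compact_time_scale (kappa S)"
proof
  show "time_scale (kappa S)"
    unfolding time_scale_def using Inf_mem_kappa compact_imp_closed[OF compact_kappa] by auto
  show "bounded (kappa S)" using compact_imp_bounded[OF compact_kappa] .
qed

lemma Inf_kappa: "Inf (kappa S) = Inf S"
  using Inf_mem_kappa Inf_le kappa_subset by (intro cInf_eq_minimum) auto

lemma Sup_kappa: "Sup (kappa S) = rho S (Sup S)"
  using rho_mem_kappa by (intro cSup_eq_maximum) (auto simp: kappa_iff)

lemma rho_kappa: "x \<le> Sup (kappa S) \<Longrightarrow> rho (kappa S) x = rho S x"
proof -
  assume "x \<le> Sup (kappa S)"
  then have "{s \<in> kappa S. s < x} = {s \<in> S. s < x}" by (auto simp: kappa_iff Sup_kappa)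
  then show ?thesis by (simp only: rho_def Inf_kappa)
qed

lemma subset_insert_Sup_kappa: "S \<subseteq> insert (Sup S) (kappa S)"
  using kappaI le_Sup by force

text \<open>One primitive operator serves all truncations of a time scale. This makes iterated primitives invert the
  higher delta derivatives, each of which lives on a smaller time scale.\<close>

lemma delta_primitive_kappa:
  assumes "t \<le> Sup (kappa S)"
  shows "delta_primitive (kappa S) f t = delta_primitive S f t"
  unfolding delta_primitive_def Inf_kappa using assms by (intro integral_cong) (simp add: rho_kappa)

lemma delta_primitive_cong:
  assumes "\<And>s. s \<in> kappa S \<Longrightarrow> f s = g s" "t \<le> Sup S"
  shows "delta_primitive S f t = delta_primitive S g t"
  unfolding delta_primitive_def using assms by (intro integral_cong) (simp add: rho_mem_kappa)

end

section \<open>Higher-order delta derivatives and variations\<close>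

locale higher_order_time_scale = T: compact_time_scale T for T :: "real set" +
  fixes r :: nat
  assumes r: "r \<ge> 1" and enough_points: "infinite T \<or> card T \<ge> 2 * r + 1"
begin

abbreviation S :: "nat \<Rightarrow> real set" where "S i \<equiv> (kappa ^^ i) T"

text \<open>The action is an integral over \<open>K\<close>; its integrand lives on \<open>kappa K = S r\<close>.\<close>

abbreviation K :: "real set" where "K \<equiv> S (r - 1)"

text \<open>The \<open>i\<close>-th delta derivative of the variation with top derivative \<open>v\<close> that vanishes to order \<open>r\<close> at the minimum.\<close>

abbreviation variation :: "(real \<Rightarrow> real) \<Rightarrow> nat \<Rightarrow> real \<Rightarrow> real" where
  "variation v i \<equiv> (delta_primitive T ^^ (r - i)) v"

lemma compact_time_scale_S: "compact_time_scale (S i)"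
  by (induction i) (auto intro: compact_time_scale.compact_time_scale_kappa T.compact_time_scale_axioms)

sublocale K: compact_time_scale K
  by (rule compact_time_scale_S)

lemma kappa_K: "kappa K = S r"
  using r by (metis One_nat_def Suc_pred funpow.simps(2) less_le_trans o_apply zero_less_one)

lemma S_antimono: "i \<le> j \<Longrightarrow> S j \<subseteq> S i"
  by (induction j rule: dec_induct) (auto dest: subsetD[OF compact_time_scale.kappa_subset[OF compact_time_scale_S]])

lemma Inf_S: "Inf (S i) = Inf T"
  by (induction i) (auto simp: compact_time_scale.Inf_kappa[OF compact_time_scale_S])

lemma endpoints_mem:
  assumes "i < r"
  shows "Inf T \<in> S i" "Sup K \<in> S i"
proof -
  show "Inf T \<in> S i"
    using compact_time_scale.Inf_mem[OF compact_time_scale_S, of i] by (simp add: Inf_S)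
  show "Sup K \<in> S i"
    by (rule subsetD[OF S_antimono K.Sup_mem]) (use assms in simp)
qed

lemma Sup_S_antimono: "i \<le> j \<Longrightarrow> Sup (S j) \<le> Sup (S i)"
  using compact_time_scale.le_Sup[OF compact_time_scale_S] compact_time_scale.Sup_mem[OF compact_time_scale_S]
    S_antimono by blast

lemma delta_primitive_S:
  assumes "t \<le> Sup (S i)"
  shows "delta_primitive (S i) f t = delta_primitive T f t"
  using assms
proof (induction i)
  case (Suc i)
  have "delta_primitive (S (Suc i)) f t = delta_primitive (S i) f t"
    using compact_time_scale.delta_primitive_kappa[OF compact_time_scale_S, of t i] Suc.prems by simp
  then show ?case using Suc Sup_S_antimono[of i "Suc i"] by simp
qed simp

lemma delta_primitive_power_K:
  assumes "t \<le> Sup K"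
  shows "(delta_primitive K ^^ n) f t = (delta_primitive T ^^ n) f t"
  using assms
proof (induction n arbitrary: t)
  case (Suc n)
  have "delta_primitive K ((delta_primitive K ^^ n) f) t = delta_primitive K ((delta_primitive T ^^ n) f) t"
    using Suc K.kappa_subset K.le_Sup by (intro K.delta_primitive_cong Suc.IH) auto
  then show ?case using delta_primitive_S[OF Suc.prems] by simp
qed simp

text \<open>Each truncation removes at most the maximum, so enough points remain for delta derivatives to be unique.\<close>

lemma Inf_less_Sup:
  assumes "i \<le> r"
  shows "Inf (S i) < Sup (S i)"
proof -
  have many: "infinite (S j) \<or> card (S j) + j \<ge> 2 * r + 1" for j
  proof (induction j)
    case 0
    then show ?case using enough_points by simp
  next
    case (Suc j)
    have sub: "S j \<subseteq> insert (Sup (S j)) (S (Suc j))"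
      using compact_time_scale.subset_insert_Sup_kappa[OF compact_time_scale_S, of j] by simp
    show ?case
    proof (cases "finite (S (Suc j))")
      case True
      then have "finite (S j)" "card (S j) \<le> Suc (card (S (Suc j)))"
        using sub finite_subset card_mono[OF _ sub] card_insert_le_m1 card_insert_if
        by (auto intro: finite_subset order_trans[OF card_mono[OF _ sub]] simp: card_insert_if)
      then show ?thesis using Suc by simp
    qed simp
  qed
  interpret compact_time_scale "S i" by (rule compact_time_scale_S)
  have "Inf (S i) \<noteq> Sup (S i)"
  proof
    assume eq: "Inf (S i) = Sup (S i)"
    then have sub: "S i \<subseteq> {Sup (S i)}" using Inf_le le_Sup by force
    then have "finite (S i)" "card (S i) \<le> 1"
      using finite_subset card_mono[OF _ sub] by auto
    then show False using many[of i] assms r by simp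
  qed
  then show ?thesis using Inf_le_Sup by simp
qed

text \<open>A difference quotient of \<open>delta_deriv_n T i f\<close> has no meaning unless the derivative of order \<open>i\<close> exists
  everywhere, which is therefore part of the hypotheses whenever higher derivatives are computed.\<close>

definition lower_differentiable :: "(real \<Rightarrow> real) \<Rightarrow> bool" where
  "lower_differentiable f \<longleftrightarrow> (\<forall>i<r. \<forall>t\<in>S i. delta_differentiable_n T i f t)"

lemma delta_differentiable_n_SucD:
  assumes "delta_differentiable_n T (Suc i) f t" "i < r" "t \<in> S (Suc i)"
  shows "has_delta_derivative (S i) (delta_deriv_n T i f) (delta_deriv_n T (Suc i) f t) t"
proof -
  obtain D where D: "has_delta_derivative (S i) (delta_deriv_n T i f) D t" using assms(1) by auto
  then have "delta_deriv_n T (Suc i) f t = D"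
    using compact_time_scale.delta_deriv_eq[OF compact_time_scale_S D] assms Inf_less_Sup[of i] by simp
  then show ?thesis using D by simp
qed

lemma delta_deriv_n_SucI:
  assumes "has_delta_derivative (S i) (delta_deriv_n T i f) D t" "i < r" "t \<in> S (Suc i)"
  shows "delta_deriv_n T (Suc i) f t = D" "delta_differentiable_n T (Suc i) f t"
  using compact_time_scale.delta_deriv_eq[OF compact_time_scale_S assms(1)] assms Inf_less_Sup[of i] by auto

lemma delta_deriv_n_linear:
  assumes f: "lower_differentiable f" and g: "lower_differentiable g" and i: "i \<le> r"
    and t: "t \<in> S i" "delta_differentiable_n T i f t" "delta_differentiable_n T i g t"
  shows "delta_deriv_n T i (\<lambda>s. p * f s + q * g s) t = p * delta_deriv_n T i f t + q * delta_deriv_n T i g t"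
    and "delta_differentiable_n T i (\<lambda>s. p * f s + q * g s) t"
proof -
  have "delta_deriv_n T i (\<lambda>s. p * f s + q * g s) t = p * delta_deriv_n T i f t + q * delta_deriv_n T i g t
    \<and> delta_differentiable_n T i (\<lambda>s. p * f s + q * g s) t"
    using i t
  proof (induction i arbitrary: t)
    case (Suc i)
    let ?z = "\<lambda>s. p * f s + q * g s"
    interpret Si: compact_time_scale "S i" by (rule compact_time_scale_S)
    have ir: "i < r" using Suc.prems by simp
    have IH: "delta_deriv_n T i ?z s = p * delta_deriv_n T i f s + q * delta_deriv_n T i g s"
      if "s \<in> S i" for s
      using Suc.IH[of s] that ir f g by (simp add: lower_differentiable_def)
    have "has_delta_derivative (S i) (\<lambda>s. p * delta_deriv_n T i f s + q * delta_deriv_n T i g s)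
        (p * delta_deriv_n T (Suc i) f t + q * delta_deriv_n T (Suc i) g t) t"
      using Suc.prems ir by (intro Si.has_delta_derivative_linear delta_differentiable_n_SucD) auto
    then have "has_delta_derivative (S i) (delta_deriv_n T i ?z)
        (p * delta_deriv_n T (Suc i) f t + q * delta_deriv_n T (Suc i) g t) t"
      using Si.has_delta_derivative_cong[of "delta_deriv_n T i ?z", OF IH] by blast
    then show ?case using delta_deriv_n_SucI[OF _ ir Suc.prems(2)] by blast
  qed simp
  then show "delta_deriv_n T i (\<lambda>s. p * f s + q * g s) t = p * delta_deriv_n T i f t + q * delta_deriv_n T i g t"
    and "delta_differentiable_n T i (\<lambda>s. p * f s + q * g s) t" by auto
qed

lemma lower_differentiable_linear:
  assumes "lower_differentiable f" "lower_differentiable g"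
  shows "lower_differentiable (\<lambda>s. p * f s + q * g s)"
  unfolding lower_differentiable_def
  using delta_deriv_n_linear(2)[OF assms] assms by (simp add: lower_differentiable_def)

lemma delta_differentiable_n_scattered:
  assumes "continuous_on K (delta_deriv_n T (r - 1) f)" "t \<in> S r" "sigma K t \<noteq> t"
  shows "delta_differentiable_n T r f t"
proof -
  have tK: "t \<in> K" using assms(2) K.kappa_subset unfolding kappa_K by auto
  then have "t < sigma K t" using K.le_sigma[of t] K.le_Sup[of t] assms(3) by simp
  then have "\<exists>D. has_delta_derivative K (delta_deriv_n T (r - 1) f) D t"
    using K.has_delta_derivative_scattered[OF assms(1) tK] by blast
  then show ?thesis using r by (cases r) auto
qed

text \<open>The exceptional points of the top derivative may be taken right-dense, since at right-scattered points the
  continuity of the previous derivative is enough.\<close>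

lemma C_prdD:
  assumes "f \<in> C_prd T r"
  shows "lower_differentiable f" and "i < r \<Longrightarrow> continuous_on (S i) (delta_deriv_n T i f)"
    and "piecewise_rd_continuous K (delta_deriv_n T r f)"
    and "\<exists>E. finite E \<and> (\<forall>t\<in>E. sigma K t = t) \<and> (\<forall>t\<in>S r - E. delta_differentiable_n T r f t)"
proof -
  show "lower_differentiable f" "i < r \<Longrightarrow> continuous_on (S i) (delta_deriv_n T i f)"
    "piecewise_rd_continuous K (delta_deriv_n T r f)"
    using assms by (auto simp: C_prd_def lower_differentiable_def)
  obtain E where E: "finite E" "\<forall>t \<in> S r - E. delta_differentiable_n T r f t"
    using assms by (auto simp: C_prd_def)
  have "continuous_on K (delta_deriv_n T (r - 1) f)" using assms r by (auto simp: C_prd_def)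
  then have "\<forall>t \<in> S r - {t \<in> E. sigma K t = t}. delta_differentiable_n T r f t"
    using E(2) delta_differentiable_n_scattered by blast
  then show "\<exists>E. finite E \<and> (\<forall>t\<in>E. sigma K t = t) \<and> (\<forall>t\<in>S r - E. delta_differentiable_n T r f t)"
    using E(1) by (intro exI[of _ "{t \<in> E. sigma K t = t}"]) auto
qed

lemma C_prd_linear:
  assumes f: "f \<in> C_prd T r" and g: "g \<in> C_prd T r"
  shows "(\<lambda>s. p * f s + q * g s) \<in> C_prd T r"
proof -
  let ?z = "\<lambda>s. p * f s + q * g s"
  note lf = C_prdD(1)[OF f] and lg = C_prdD(1)[OF g]
  have lz: "lower_differentiable ?z" by (rule lower_differentiable_linear[OF lf lg])
  have "continuous_on (S i) (delta_deriv_n T i ?z)" if i: "i < r" for i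
  proof -
    have "continuous_on (S i) (\<lambda>t. p * delta_deriv_n T i f t + q * delta_deriv_n T i g t)"
      using C_prdD(2)[OF f i] C_prdD(2)[OF g i] by (intro continuous_intros)
    then show ?thesis
      using delta_deriv_n_linear(1)[OF lf lg, of i] lf lg i
      by (subst continuous_on_cong[OF refl]) (auto simp: lower_differentiable_def)
  qed
  moreover obtain E where E: "finite E" "\<forall>t\<in>S r - E. delta_differentiable_n T r f t"
    using C_prdD(4)[OF f] by blast
  obtain E' where E': "finite E'" "\<forall>t\<in>S r - E'. delta_differentiable_n T r g t"
    using C_prdD(4)[OF g] by blast
  have top: "delta_deriv_n T r ?z t = p * delta_deriv_n T r f t + q * delta_deriv_n T r g t"
    "delta_differentiable_n T r ?z t" if "t \<in> S r - (E \<union> E')" for t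
    using delta_deriv_n_linear[OF lf lg order_refl, of t] that E(2) E'(2) by auto
  have EE: "finite (E \<union> E')" using E E' by simp
  have "piecewise_rd_continuous K (\<lambda>t. p * delta_deriv_n T r f t + q * delta_deriv_n T r g t)"
    by (intro K.piecewise_rd_continuous_add K.piecewise_rd_continuous_scale C_prdD(3) f g)
  from K.piecewise_rd_continuous_finite_modification[OF this EE top(1)[folded kappa_K]]
  have "piecewise_rd_continuous K (delta_deriv_n T r ?z)" .
  ultimately show ?thesis
    using lz top(2) EE unfolding C_prd_def lower_differentiable_def by blast
qed

lemma top_derivative_antiderivative:
  assumes f: "f \<in> C_prd T r"
  shows "delta_antiderivative K (delta_deriv_n T r f) (delta_deriv_n T (r - 1) f)"
proof -
  obtain E where E: "finite E" "\<forall>t\<in>E. sigma K t = t" "\<forall>t\<in>S r - E. delta_differentiable_n T r f t"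
    using C_prdD(4)[OF f] by blast
  have "has_delta_derivative K (delta_deriv_n T (r - 1) f) (delta_deriv_n T r f t) t" if "t \<in> kappa K - E" for t
    using delta_differentiable_n_SucD[of "r - 1" f t] E(3) that r unfolding kappa_K by simp
  then show ?thesis
    unfolding delta_antiderivative_def using E C_prdD(2)[OF f, of "r - 1"] r by auto
qed

lemma delta_deriv_n_bounded:
  assumes f: "f \<in> C_prd T r" and i: "i \<le> r"
  shows "\<exists>M. \<forall>t\<in>S r. \<bar>delta_deriv_n T i f t\<bar> \<le> M"
proof (cases "i = r")
  case True
  then show ?thesis using K.piecewise_rd_continuous_bounded[OF C_prdD(3)[OF f]] unfolding kappa_K by simp
next
  case False
  then have "compact (delta_deriv_n T i f ` S i)"
    using i C_prdD(2)[OF f, of i] compact_time_scale.compact[OF compact_time_scale_S]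
    by (intro compact_continuous_image) auto
  then obtain M where "\<forall>x\<in>delta_deriv_n T i f ` S i. norm x \<le> M"
    using compact_imp_bounded bounded_iff by blast
  then show ?thesis using S_antimono[OF i] by auto
qed

lemma jet_bounded:
  assumes f: "f \<in> C_prd T r"
  shows "\<exists>M\<ge>0. \<forall>i\<le>r. \<forall>t\<in>S r. \<bar>delta_deriv_n T i f t\<bar> \<le> M"
proof -
  obtain M where M: "\<And>i t. i \<le> r \<Longrightarrow> t \<in> S r \<Longrightarrow> \<bar>delta_deriv_n T i f t\<bar> \<le> M i"
    using delta_deriv_n_bounded[OF f] by metis
  have "\<bar>delta_deriv_n T i f t\<bar> \<le> (\<Sum>i\<le>r. \<bar>M i\<bar>)" if "i \<le> r" "t \<in> S r" for i t
  proof -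
    have "\<bar>delta_deriv_n T i f t\<bar> \<le> \<bar>M i\<bar>" using M[OF that] by linarith
    also have "\<dots> \<le> (\<Sum>i\<le>r. \<bar>M i\<bar>)" using that(1) by (intro member_le_sum) auto
    finally show ?thesis .
  qed
  then show ?thesis by (intro exI[of _ "\<Sum>i\<le>r. \<bar>M i\<bar>"]) (auto intro: sum_nonneg)
qed

text \<open>No supremum in \<open>prd_norm\<close> is taken over the empty set.\<close>

lemma ex_top_differentiable:
  assumes f: "f \<in> C_prd T r"
  shows "\<exists>t\<in>S r. delta_differentiable_n T r f t"
proof (cases "sigma K (Inf K) = Inf K")
  case False
  then show ?thesis
    using delta_differentiable_n_scattered[OF C_prdD(2)[OF f]] K.Inf_mem_kappa r unfolding kappa_K by auto
next
  case True
  obtain E where E: "finite E" "\<forall>t\<in>S r - E. delta_differentiable_n T r f t"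
    using C_prdD(4)[OF f] by blast
  define z where "z = Min (insert (Sup K) {e \<in> E. Inf K < e})"
  have lt: "Inf K < Sup K" using Inf_less_Sup by simp
  have fin: "finite (insert (Sup K) {e \<in> E. Inf K < e})" using E by simp
  have "Inf K < z" unfolding z_def using lt fin by (subst Min_gr_iff) auto
  then obtain s where s: "s \<in> K" "Inf K < s" "s < z"
    using K.right_dense_approach[OF True lt] by blast
  have "s < Sup K" "s \<notin> E"
    using s fin by (auto simp: z_def)
  then have "s \<in> S r - E" using K.kappaI[OF s(1)] unfolding kappa_K by simp
  then show ?thesis using E(2) by blast
qed

lemma S_eq_interval: "S i = T \<inter> {Inf T..(rho T ^^ i) (Sup T)}" and Sup_S: "Sup (S i) = (rho T ^^ i) (Sup T)"
  using kappa_iterate[OF T.time_scale T.bounded] by auto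

text \<open>Small multiples of a fixed variation stay in the neighbourhood where a weak local minimizer is optimal.\<close>

lemma prd_norm_scale_le:
  assumes f: "f \<in> C_prd T r"
  shows "\<exists>B. \<forall>c. c \<noteq> 0 \<longrightarrow> prd_norm T r (\<lambda>t. c * f t) \<le> \<bar>c\<bar> * B"
proof -
  obtain M where M: "\<And>i t. i \<le> r \<Longrightarrow> t \<in> S r \<Longrightarrow> \<bar>delta_deriv_n T i f t\<bar> \<le> M"
    using jet_bounded[OF f] by blast
  note lf = C_prdD(1)[OF f]
  have "prd_norm T r (\<lambda>t. c * f t) \<le> \<bar>c\<bar> * (\<Sum>i\<le>r. M)" if c: "c \<noteq> 0" for c
  proof -
    let ?z = "\<lambda>t. c * f t"
    have lin: "delta_deriv_n T i ?z t = c * delta_deriv_n T i f t" "delta_differentiable_n T i ?z t"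
      if "i \<le> r" "t \<in> S i" "delta_differentiable_n T i f t" for i t
      using delta_deriv_n_linear[OF lf lf that that(3), of c 0] by auto
    have lz: "lower_differentiable ?z"
      using lin lf by (auto simp: lower_differentiable_def)
    have unscale: "delta_differentiable_n T i f t" if "i \<le> r" "t \<in> S i" "delta_differentiable_n T i ?z t" for i t
      using delta_deriv_n_linear(2)[OF lz lz that that(3), of "1 / c" 0] c by simp
    have "(SUP t \<in> {t \<in> S r. delta_differentiable_n T i ?z t}. \<bar>delta_deriv_n T i ?z t\<bar>) \<le> \<bar>c\<bar> * M"
      if i: "i \<le> r" for i
    proof (rule cSUP_least)
      have sub: "S r \<subseteq> S i" using S_antimono[OF i] .
      obtain t where t: "t \<in> S r" "delta_differentiable_n T r f t" using ex_top_differentiable[OF f] by blast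
      have "delta_differentiable_n T i f t"
        using t lf i sub by (cases "i = r") (auto simp: lower_differentiable_def)
      then show "{t \<in> S r. delta_differentiable_n T i ?z t} \<noteq> {}"
        using lin(2)[OF i] t(1) sub by blast
      show "\<bar>delta_deriv_n T i ?z t\<bar> \<le> \<bar>c\<bar> * M" if t: "t \<in> {t \<in> S r. delta_differentiable_n T i ?z t}" for t
      proof -
        have "t \<in> S i" using t sub by blast
        then have "delta_deriv_n T i ?z t = c * delta_deriv_n T i f t"
          using lin(1) unscale i t by blast
        then show ?thesis using M[OF i, of t] t by (simp add: abs_mult mult_left_mono)
      qed
    qed
    then have "prd_norm T r ?z \<le> (\<Sum>i\<le>r. \<bar>c\<bar> * M)"
      unfolding prd_norm_def S_eq_interval[symmetric] by (intro sum_mono) simp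
    then show ?thesis by (simp only: sum_distrib_left)
  qed
  then show ?thesis by blast
qed

lemma variation_primitive:
  assumes "i < r"
  shows "variation v i = delta_primitive T (variation v (Suc i))"
proof -
  have "r - i = Suc (r - Suc i)" using assms by simp
  then show ?thesis by (simp only: funpow.simps o_apply)
qed

text \<open>The first two claims feed each other: a primitive is continuous, and a continuous function may be
  integrated on the next larger time scale.\<close>

lemma variation_properties:
  assumes v: "piecewise_rd_continuous K v" and i: "i < r"
  shows "piecewise_rd_continuous (S i) (variation v (Suc i))"
    and "continuous_on (S i) (variation v i)"
    and "t \<in> S i \<Longrightarrow> variation v i t = delta_primitive (S i) (variation v (Suc i)) t"
proof -
  have eq: "variation v j t = delta_primitive (S j) (variation v (Suc j)) t" if "j < r" "t \<in> S j" for j t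
    using variation_primitive[OF that(1)] delta_primitive_S[of t j]
      compact_time_scale.le_Sup[OF compact_time_scale_S that(2)] by simp
  have "piecewise_rd_continuous (S (r - Suc k)) (variation v (Suc (r - Suc k))) \<and>
        continuous_on (S (r - Suc k)) (variation v (r - Suc k))" if "k < r" for k
    using that
  proof (induction k)
    case 0
    have "piecewise_rd_continuous (S (r - Suc 0)) (variation v (Suc (r - Suc 0)))"
      using v r by simp
    moreover from compact_time_scale.delta_primitive_continuous[OF compact_time_scale_S this]
    have "continuous_on (S (r - Suc 0)) (variation v (r - Suc 0))"
      using r eq[of "r - Suc 0"] by (subst continuous_on_cong[OF refl]) auto
    ultimately show ?case by blast
  next
    case (Suc k)
    define j where "j = r - Suc (Suc k)"
    have j: "Suc j = r - Suc k" "j < r" using Suc.prems by (auto simp: j_def)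
    have "continuous_on (kappa (S j)) (variation v (Suc j))"
      using Suc by (simp flip: j(1))
    then have 1: "piecewise_rd_continuous (S j) (variation v (Suc j))"
      by (rule compact_time_scale.piecewise_rd_continuous_of_continuous[OF compact_time_scale_S])
    from compact_time_scale.delta_primitive_continuous[OF compact_time_scale_S this]
    have "continuous_on (S j) (variation v j)"
      using j(2) eq[of j] by (subst continuous_on_cong[OF refl]) auto
    then show ?case using 1 unfolding j_def[symmetric] by blast
  qed
  from this[of "r - Suc i"] i
  show "piecewise_rd_continuous (S i) (variation v (Suc i))" "continuous_on (S i) (variation v i)"
    by (simp_all add: Suc_diff_Suc)
  show "t \<in> S i \<Longrightarrow> variation v i t = delta_primitive (S i) (variation v (Suc i)) t"
    using eq i by blast
qed

lemma delta_deriv_n_variation: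
  assumes v: "piecewise_rd_continuous K v" and i: "i < r" and t: "t \<in> S i"
  shows "delta_deriv_n T i (variation v 0) t = variation v i t"
    and "delta_differentiable_n T i (variation v 0) t"
proof -
  have "delta_deriv_n T i (variation v 0) t = variation v i t \<and> delta_differentiable_n T i (variation v 0) t"
    using i t
  proof (induction i arbitrary: t)
    case (Suc i)
    have ir: "i < r" using Suc.prems by simp
    interpret Si: compact_time_scale "S i" by (rule compact_time_scale_S)
    note var = variation_properties[OF v ir]
    have eq: "delta_deriv_n T i (variation v 0) s = delta_primitive (S i) (variation v (Suc i)) s" if "s \<in> S i" for s
      using Suc.IH[OF ir that] var(3)[OF that] by simp
    have tk: "t \<in> kappa (S i)" using Suc.prems by simp
    have "(variation v (Suc i) \<longlongrightarrow> variation v (Suc i) t) (at t within kappa (S i))"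
      using variation_properties(2)[OF v Suc.prems(1)] Suc.prems(2) by (simp add: continuous_on_def)
    then have "has_delta_derivative (S i) (delta_primitive (S i) (variation v (Suc i))) (variation v (Suc i) t) t"
      by (intro Si.delta_primitive_has_delta_derivative var(1) tk)
    then have "has_delta_derivative (S i) (delta_deriv_n T i (variation v 0)) (variation v (Suc i) t) t"
      using Si.has_delta_derivative_cong[of "delta_deriv_n T i (variation v 0)", OF eq] by blast
    then show ?case using delta_deriv_n_SucI[OF _ ir Suc.prems(2)] by blast
  qed simp
  then show "delta_deriv_n T i (variation v 0) t = variation v i t"
    and "delta_differentiable_n T i (variation v 0) t" by auto
qed

lemma delta_deriv_n_variation_top:
  assumes v: "piecewise_rd_continuous K v"
  obtains E where "finite E" "\<And>t. t \<in> E \<Longrightarrow> sigma K t = t"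
    "\<And>t. t \<in> S r - E \<Longrightarrow> delta_differentiable_n T r (variation v 0) t \<and> delta_deriv_n T r (variation v 0) t = v t"
proof -
  obtain E where E: "finite E" "\<And>t. t \<in> E \<Longrightarrow> t \<in> kappa K \<and> sigma K t = t"
    "\<And>t. t \<in> kappa K - E \<Longrightarrow> has_delta_derivative K (delta_primitive K v) (v t) t"
    using K.delta_primitive_derivative_exceptions[OF v] by metis
  have eq: "delta_deriv_n T (r - 1) (variation v 0) s = delta_primitive K v s" if "s \<in> K" for s
    using delta_deriv_n_variation(1)[OF v _ that] variation_properties(3)[OF v _ that] r by simp
  have "delta_differentiable_n T r (variation v 0) t \<and> delta_deriv_n T r (variation v 0) t = v t"
    if t: "t \<in> S r - E" for t
  proof -
    have "has_delta_derivative K (delta_deriv_n T (r - 1) (variation v 0)) (v t) t"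
      using K.has_delta_derivative_cong[of "delta_deriv_n T (r - 1) (variation v 0)", OF eq] E(3)[of t] t
      unfolding kappa_K by simp
    then show ?thesis using delta_deriv_n_SucI[of "r - 1" _ "v t" t] t r by auto
  qed
  then show thesis using that E by blast
qed

lemma variation_C_prd:
  assumes v: "piecewise_rd_continuous K v"
  shows "variation v 0 \<in> C_prd T r"
proof -
  obtain E where E: "finite E"
    "\<And>t. t \<in> S r - E \<Longrightarrow> delta_differentiable_n T r (variation v 0) t \<and> delta_deriv_n T r (variation v 0) t = v t"
    using delta_deriv_n_variation_top[OF v] by metis
  have "continuous_on (S i) (delta_deriv_n T i (variation v 0))" if "i < r" for i
    using variation_properties(2)[OF v that] delta_deriv_n_variation(1)[OF v that]
    by (subst continuous_on_cong[OF refl]) auto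
  moreover have "piecewise_rd_continuous K (delta_deriv_n T r (variation v 0))"
    using E(2) unfolding kappa_K[symmetric]
    by (intro K.piecewise_rd_continuous_finite_modification[OF v E(1)]) blast
  ultimately show ?thesis
    using E delta_deriv_n_variation(2)[OF v] unfolding C_prd_def by blast
qed

end

section \<open>Functions of finitely many real variables\<close>

lemma tendsto_componentwiseI:
  fixes f :: "'a \<Rightarrow> 'i \<Rightarrow> 'b :: topological_space"
  assumes "\<And>i. ((\<lambda>x. f x i) \<longlongrightarrow> l i) F"
  shows "(f \<longlongrightarrow> l) F"
proof -
  have "limitin (product_topology (\<lambda>_. euclidean) UNIV) f l F"
    unfolding limitin_componentwise using assms by simp
  then show ?thesis by (simp add: euclidean_product_topology)
qed

lemma compact_box_PiE: "compact ({..r} \<rightarrow>\<^sub>E {- R..R :: real} :: (nat \<Rightarrow> real) set)"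
proof -
  have eq: "({..r} \<rightarrow>\<^sub>E {- R..R}) = (\<Pi>\<^sub>E i\<in>UNIV. if i \<le> r then {- R..R} else {undefined})"
    by (auto simp: PiE_iff extensional_def split: if_splits)
  have "compactin (product_topology (\<lambda>_. euclidean) UNIV) ({..r} \<rightarrow>\<^sub>E {- R..R})"
    unfolding eq compactin_PiE by auto
  then show ?thesis by (simp add: euclidean_product_topology)
qed

lemma mean_value_unordered:
  fixes f :: "real \<Rightarrow> real"
  assumes "\<And>x. DERIV f x :> f' x"
  shows "\<exists>z. min a b \<le> z \<and> z \<le> max a b \<and> f b - f a = f' z * (b - a)"
proof (cases a b rule: linorder_cases)
  case less
  then obtain z where "a < z" "z < b" "f b - f a = (b - a) * f' z"
    using MVT2[OF less, of f f'] assms by blast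
  then show ?thesis by (intro exI[of _ z]) (auto simp: mult.commute)
next
  case greater
  then obtain z where "b < z" "z < a" "f a - f b = (a - b) * f' z"
    using MVT2[OF greater, of f f'] assms by blast
  then show ?thesis by (intro exI[of _ z]) (auto simp: algebra_simps)
qed auto

text \<open>Changing the coordinates one at a time reduces the increment of \<open>G\<close> to one-variable mean values.\<close>

lemma mean_value_coordinatewise:
  fixes G :: "(nat \<Rightarrow> real) \<Rightarrow> real"
  assumes u: "u \<in> {..r} \<rightarrow>\<^sub>E UNIV" and u': "u' \<in> {..r} \<rightarrow>\<^sub>E UNIV"
    and D: "\<And>i w. i \<le> r \<Longrightarrow> w \<in> {..r} \<rightarrow>\<^sub>E UNIV \<Longrightarrow> DERIV (\<lambda>x. G (w(i := x))) (w i) :> P i w"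
  shows "\<exists>\<xi>. (\<forall>i\<le>r. \<xi> i \<in> {..r} \<rightarrow>\<^sub>E UNIV \<and> (\<forall>j\<le>r. min (u j) (u' j) \<le> \<xi> i j \<and> \<xi> i j \<le> max (u j) (u' j)))
    \<and> G u' - G u = (\<Sum>i\<le>r. P i (\<xi> i) * (u' i - u i))"
proof -
  define w where "w k = (\<lambda>j. if j < k then u' j else u j)" for k
  have w: "(w k)(k := x) \<in> {..r} \<rightarrow>\<^sub>E UNIV" if "k \<le> r" for k x
    using u u' that by (auto simp: w_def PiE_iff extensional_def)
  have "\<exists>x. min (u k) (u' k) \<le> x \<and> x \<le> max (u k) (u' k) \<and>
      G (w (Suc k)) - G (w k) = P k ((w k)(k := x)) * (u' k - u k)" if k: "k \<le> r" for k
  proof -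
    have "DERIV (\<lambda>x. G ((w k)(k := x))) x :> P k ((w k)(k := x))" for x
      using D[OF k w[OF k, of x]] by simp
    then obtain x where "min (u k) (u' k) \<le> x" "x \<le> max (u k) (u' k)"
      "G ((w k)(k := u' k)) - G ((w k)(k := u k)) = P k ((w k)(k := x)) * (u' k - u k)"
      using mean_value_unordered[of "\<lambda>x. G ((w k)(k := x))" "\<lambda>x. P k ((w k)(k := x))" "u k" "u' k"] by blast
    moreover have "(w k)(k := u' k) = w (Suc k)" "(w k)(k := u k) = w k"
      by (auto simp: w_def fun_eq_iff less_Suc_eq)
    ultimately show ?thesis by auto
  qed
  then obtain x where x: "\<And>k. k \<le> r \<Longrightarrow> min (u k) (u' k) \<le> x k \<and> x k \<le> max (u k) (u' k) \<and>
      G (w (Suc k)) - G (w k) = P k ((w k)(k := x k)) * (u' k - u k)"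
    by metis
  have "G (w (Suc r)) - G (w 0) = (\<Sum>k<Suc r. G (w (Suc k)) - G (w k))"
    by (rule sum_lessThan_telescope[symmetric])
  also have "\<dots> = (\<Sum>k\<le>r. P k ((w k)(k := x k)) * (u' k - u k))"
    using x by (intro sum.cong) (auto simp: lessThan_Suc_atMost)
  also have "w (Suc r) = u'" using u u' by (auto simp: w_def fun_eq_iff PiE_iff extensional_def)
  also have "w 0 = u" by (auto simp: w_def)
  finally have "G u' - G u = (\<Sum>k\<le>r. P k ((w k)(k := x k)) * (u' k - u k))" .
  moreover have "min (u j) (u' j) \<le> ((w k)(k := x k)) j \<and> ((w k)(k := x k)) j \<le> max (u j) (u' j)"
    if "k \<le> r" for k j
    using x[OF that] by (auto simp: w_def)
  ultimately show ?thesis using w by (intro exI[of _ "\<lambda>k. (w k)(k := x k)"]) blast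
qed

section \<open>The first variation\<close>

locale variational_problem = higher_order_time_scale +
  fixes L :: "real \<Rightarrow> (nat \<Rightarrow> real) \<Rightarrow> real" and ya yb :: "nat \<Rightarrow> real"
  assumes L_differentiable: "\<And>i t u. i \<le> r \<Longrightarrow> t \<in> S r \<Longrightarrow> u \<in> {..r} \<rightarrow>\<^sub>E UNIV \<Longrightarrow>
      (\<lambda>x. L t (u(i := x))) differentiable at (u i)"
    and L_partial_continuous: "\<And>i. i \<le> r \<Longrightarrow>
      continuous_on (S r \<times> ({..r} \<rightarrow>\<^sub>E UNIV)) (\<lambda>(t, u). partial_deriv L i t u)"
    and L_rd: "\<And>z. admissible T r ya yb z \<Longrightarrow> piecewise_rd_continuous K (\<lambda>t. L t (jet T r z t))"
    and L_partial_rd: "\<And>z i. admissible T r ya yb z \<Longrightarrow> i \<le> r \<Longrightarrow>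
      piecewise_rd_continuous K (\<lambda>t. partial_deriv L i t (jet T r z t))"
begin

lemma jet_PiE: "jet T r z t \<in> {..r} \<rightarrow>\<^sub>E UNIV"
  by (simp add: jet_def)

lemma L_DERIV:
  assumes "i \<le> r" "t \<in> S r" "u \<in> {..r} \<rightarrow>\<^sub>E UNIV"
  shows "DERIV (\<lambda>x. L t (u(i := x))) (u i) :> partial_deriv L i t u"
  unfolding partial_deriv_def using L_differentiable[OF assms] by (simp add: DERIV_deriv_iff_real_differentiable)

lemma partials_bounded_on_box:
  "\<exists>C\<ge>0. \<forall>i\<le>r. \<forall>t\<in>S r. \<forall>u\<in>{..r} \<rightarrow>\<^sub>E {- R..R}. \<bar>partial_deriv L i t u\<bar> \<le> C"
proof -
  have "\<exists>C. \<forall>t\<in>S r. \<forall>u\<in>{..r} \<rightarrow>\<^sub>E {- R..R}. \<bar>partial_deriv L i t u\<bar> \<le> C" if i: "i \<le> r" for i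
  proof -
    have "compact (S r \<times> ({..r} \<rightarrow>\<^sub>E {- R..R}))"
      by (intro compact_Times compact_time_scale.compact[OF compact_time_scale_S] compact_box_PiE)
    moreover have "continuous_on (S r \<times> ({..r} \<rightarrow>\<^sub>E {- R..R})) (\<lambda>(t, u). partial_deriv L i t u)"
      by (rule continuous_on_subset[OF L_partial_continuous[OF i]]) (auto simp: PiE_iff)
    ultimately have "bounded ((\<lambda>(t, u). partial_deriv L i t u) ` (S r \<times> ({..r} \<rightarrow>\<^sub>E {- R..R})))"
      by (intro compact_imp_bounded compact_continuous_image)
    then obtain C where C: "\<forall>x\<in>(\<lambda>(t, u). partial_deriv L i t u) ` (S r \<times> ({..r} \<rightarrow>\<^sub>E {- R..R})). norm x \<le> C"
      unfolding bounded_iff by blast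
    have "\<bar>partial_deriv L i t u\<bar> \<le> C" if "t \<in> S r" "u \<in> {..r} \<rightarrow>\<^sub>E {- R..R}" for t u
      using bspec[OF C, of "partial_deriv L i t u"] that by force
    then show ?thesis by blast
  qed
  then obtain C where C: "\<And>i t u. i \<le> r \<Longrightarrow> t \<in> S r \<Longrightarrow> u \<in> {..r} \<rightarrow>\<^sub>E {- R..R} \<Longrightarrow> \<bar>partial_deriv L i t u\<bar> \<le> C i"
    by metis
  have "\<bar>partial_deriv L i t u\<bar> \<le> (\<Sum>i\<le>r. \<bar>C i\<bar>)"
    if "i \<le> r" "t \<in> S r" "u \<in> {..r} \<rightarrow>\<^sub>E {- R..R}" for i t u
  proof -
    have "\<bar>partial_deriv L i t u\<bar> \<le> \<bar>C i\<bar>" using C[OF that] by linarith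
    also have "\<dots> \<le> (\<Sum>i\<le>r. \<bar>C i\<bar>)" using that(1) by (intro member_le_sum) auto
    finally show ?thesis .
  qed
  then show ?thesis by (intro exI[of _ "\<Sum>i\<le>r. \<bar>C i\<bar>"]) (auto intro: sum_nonneg)
qed

lemma action_eq:
  assumes "admissible T r ya yb z"
  shows "action T r L z = integral {Inf K..Sup K} (\<lambda>x. L (rho K x) (jet T r z (rho K x)))"
  unfolding action_def Sup_S[symmetric] Inf_S[of "r - 1", symmetric]
  using K.delta_integral_eq_primitive[OF L_rd[OF assms] K.Sup_mem] by (simp only: delta_primitive_def)

lemma variation_endpoints:
  assumes v: "piecewise_rd_continuous K v"
    and bd: "\<And>k. 0 < k \<Longrightarrow> k \<le> r \<Longrightarrow> (delta_primitive K ^^ k) v (Sup K) = 0" and i: "i < r"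
  shows "delta_deriv_n T i (variation v 0) (Inf T) = 0" "delta_deriv_n T i (variation v 0) (Sup K) = 0"
proof -
  have "Inf T \<in> S i" "Sup K \<in> S i"
    using endpoints_mem[OF i] by auto
  moreover have "variation v i (Inf T) = 0"
    by (simp only: variation_primitive[OF i] delta_primitive_def) simp
  moreover have "variation v i (Sup K) = 0"
    using bd[of "r - i"] i delta_primitive_power_K[OF order_refl, of "r - i" v] by simp
  ultimately show "delta_deriv_n T i (variation v 0) (Inf T) = 0" "delta_deriv_n T i (variation v 0) (Sup K) = 0"
    by (simp_all only: delta_deriv_n_variation(1)[OF v i])
qed

text \<open>Varying \<open>y\<close> in the direction \<open>\<eta>\<close> with step \<open>1 / (n + 1)\<close>, the difference quotients of the integrands
  are bounded uniformly in \<open>n\<close> because the jets stay in a compact box, and they converge off the finitely many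
  points where a top derivative is missing. Dominated convergence then gives the sign of the first variation.\<close>

lemma first_variation_nonneg:
  assumes y: "weak_local_minimizer T r L ya yb y" and v: "piecewise_rd_continuous K v"
    and bd: "\<And>k. 0 < k \<Longrightarrow> k \<le> r \<Longrightarrow> (delta_primitive K ^^ k) v (Sup K) = 0"
  shows "0 \<le> (\<Sum>i\<le>r. delta_pairing K (\<lambda>t. partial_deriv L i t (jet T r y t)) ((delta_primitive K ^^ (r - i)) v))"
proof -
  define \<eta> where "\<eta> = variation v 0"
  define c where "c n = inverse (real (Suc n))" for n
  define z where "z n = (\<lambda>t. 1 * y t + c n * \<eta> t)" for n
  define Y where "Y i t = delta_deriv_n T i y t" for i t
  define H where "H i t = delta_deriv_n T i \<eta> t" for i t
  define P where "P i t u = partial_deriv L i t u" for i t u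
  define I where "I = {Inf K..Sup K}"
  have adm: "admissible T r ya yb y" using y by (simp add: weak_local_minimizer_def)
  have yC: "y \<in> C_prd T r" using adm by (simp add: admissible_def)
  have \<eta>C: "\<eta> \<in> C_prd T r" unfolding \<eta>_def by (rule variation_C_prd[OF v])
  have zC: "z n \<in> C_prd T r" for n unfolding z_def by (rule C_prd_linear[OF yC \<eta>C])
  note ly = C_prdD(1)[OF yC] and l\<eta> = C_prdD(1)[OF \<eta>C]
  have z_deriv: "delta_deriv_n T i (z n) t = Y i t + c n * H i t"
    if "i \<le> r" "t \<in> S i" "delta_differentiable_n T i y t" "delta_differentiable_n T i \<eta> t" for i n t
    using delta_deriv_n_linear(1)[OF ly l\<eta> that, of 1 "c n"] by (simp add: z_def Y_def H_def)
  have z_adm: "admissible T r ya yb (z n)" for n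
  proof -
    have "delta_deriv_n T i (z n) (Inf T) = ya i \<and> delta_deriv_n T i (z n) (Sup K) = yb i" if i: "i < r" for i
    proof -
      have "Inf T \<in> S i" "Sup K \<in> S i"
        using endpoints_mem[OF i] by auto
      then have "delta_deriv_n T i (z n) (Inf T) = Y i (Inf T) + c n * H i (Inf T)"
        "delta_deriv_n T i (z n) (Sup K) = Y i (Sup K) + c n * H i (Sup K)"
        using z_deriv[of i] i ly l\<eta> unfolding lower_differentiable_def by auto
      moreover have "Y i (Inf T) = ya i" "Y i (Sup K) = yb i"
        using adm i unfolding admissible_def Sup_S[symmetric] Y_def by auto
      moreover have "H i (Inf T) = 0" "H i (Sup K) = 0"
        using variation_endpoints[OF v bd i] unfolding H_def \<eta>_def by auto
      ultimately show ?thesis by simp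
    qed
    then show ?thesis using zC unfolding admissible_def Sup_S[symmetric] by blast
  qed
  obtain E1 where E1: "finite E1" "\<forall>t\<in>E1. sigma K t = t" "\<forall>t\<in>S r - E1. delta_differentiable_n T r y t"
    using C_prdD(4)[OF yC] by blast
  obtain E2 where E2: "finite E2" "\<And>t. t \<in> E2 \<Longrightarrow> sigma K t = t"
    "\<And>t. t \<in> S r - E2 \<Longrightarrow> delta_differentiable_n T r \<eta> t \<and> delta_deriv_n T r \<eta> t = v t"
    using delta_deriv_n_variation_top[OF v] unfolding \<eta>_def by metis
  define E where "E = E1 \<union> E2"
  have finE: "finite E" using E1 E2 by (simp add: E_def)
  \<comment> \<open>the exceptional points are right-dense, so they are null for the integral\<close>
  have off: "rho K x \<in> S r - E" if "x \<in> I - E" for x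
  proof -
    have "rho K x \<in> S r" using K.rho_mem_kappa[of x] that unfolding kappa_K I_def by auto
    moreover have "rho K x \<notin> E"
    proof
      assume e: "rho K x \<in> E"
      then have "sigma K (rho K x) = rho K x" using E1(2) E2(2) unfolding E_def by blast
      then have "x = rho K x" using K.right_dense_of_rho_eq[of "rho K x" x] that unfolding I_def by auto
      then show False using e that by auto
    qed
    ultimately show ?thesis by blast
  qed
  have inS: "rho K x \<in> S r" if "x \<in> I" for x
    using K.rho_mem_kappa[of x] that unfolding kappa_K I_def by auto
  have jet_z: "jet T r (z n) t j = Y j t + c n * H j t" if t: "t \<in> S r - E" and j: "j \<le> r" for n t j
  proof -
    have "delta_differentiable_n T j y t \<and> delta_differentiable_n T j \<eta> t"
    proof (cases "j = r")
      case True
      then show ?thesis using E1(3) E2(3)[of t] t unfolding E_def by blast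
    next
      case False
      then show ?thesis using ly l\<eta> t j S_antimono[OF j] unfolding lower_differentiable_def by (meson DiffD1 le_neq_implies_less subsetD)
    qed
    then show ?thesis using z_deriv[OF j, of t n] t S_antimono[OF j] j unfolding jet_def by auto
  qed
  have jet_y: "jet T r y t j = Y j t" if "j \<le> r" for t j
    using that by (simp add: jet_def Y_def)
  obtain M1 where M1: "M1 \<ge> 0" "\<forall>i\<le>r. \<forall>t\<in>S r. \<bar>delta_deriv_n T i y t\<bar> \<le> M1" using jet_bounded[OF yC] by blast
  obtain M2 where M2: "M2 \<ge> 0" "\<forall>i\<le>r. \<forall>t\<in>S r. \<bar>delta_deriv_n T i \<eta> t\<bar> \<le> M2" using jet_bounded[OF \<eta>C] by blast
  define M where "M = max M1 M2"
  have M: "M \<ge> 0" "\<And>i t. i \<le> r \<Longrightarrow> t \<in> S r \<Longrightarrow> \<bar>Y i t\<bar> \<le> M" "\<And>i t. i \<le> r \<Longrightarrow> t \<in> S r \<Longrightarrow> \<bar>H i t\<bar> \<le> M"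
    using M1 M2 by (auto simp: M_def Y_def H_def le_max_iff_disj)
  obtain C where C: "C \<ge> 0" "\<forall>i\<le>r. \<forall>t\<in>S r. \<forall>u\<in>{..r} \<rightarrow>\<^sub>E {- (2 * M)..2 * M}. \<bar>P i t u\<bar> \<le> C"
    using partials_bounded_on_box[of "2 * M"] unfolding P_def by blast
  have c: "0 < c n" "c n \<le> 1" "real (Suc n) * c n = 1" for n
    by (auto simp: c_def field_simps)
  define g where "g n t = (if t \<in> E then 0 else real (Suc n) * (L t (jet T r (z n) t) - L t (jet T r y t)))" for n t
  define G where "G t = (if t \<in> E then 0 else \<Sum>i\<le>r. P i t (jet T r y t) * H i t)" for t
  have mv: "\<exists>\<xi>. (\<forall>i\<le>r. \<xi> i \<in> {..r} \<rightarrow>\<^sub>E {- (2 * M)..2 * M} \<and> (\<forall>j\<le>r. \<bar>\<xi> i j - Y j t\<bar> \<le> c n * M))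
      \<and> g n t = (\<Sum>i\<le>r. P i t (\<xi> i) * H i t)" if t: "t \<in> S r - E" for n t
  proof -
    let ?u = "jet T r y t" and ?u' = "jet T r (z n) t"
    have tS: "t \<in> S r" using t by simp
    have "DERIV (\<lambda>x. L t (w(i := x))) (w i) :> P i t w" if "i \<le> r" "w \<in> {..r} \<rightarrow>\<^sub>E UNIV" for i w
      unfolding P_def using L_DERIV[OF that(1) tS that(2)] .
    from mean_value_coordinatewise[of ?u r ?u' "L t", OF jet_PiE jet_PiE this]
    obtain \<xi> where \<xi>0: "(\<forall>i\<le>r. \<xi> i \<in> {..r} \<rightarrow>\<^sub>E UNIV \<and>
        (\<forall>j\<le>r. min (?u j) (?u' j) \<le> \<xi> i j \<and> \<xi> i j \<le> max (?u j) (?u' j)))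
      \<and> L t ?u' - L t ?u = (\<Sum>i\<le>r. P i t (\<xi> i) * (?u' i - ?u i))"
      by (rule exE)
    have \<xi>: "\<And>i. i \<le> r \<Longrightarrow> \<xi> i \<in> {..r} \<rightarrow>\<^sub>E UNIV"
      "\<And>i j. i \<le> r \<Longrightarrow> j \<le> r \<Longrightarrow> min (?u j) (?u' j) \<le> \<xi> i j \<and> \<xi> i j \<le> max (?u j) (?u' j)"
      "L t ?u' - L t ?u = (\<Sum>i\<le>r. P i t (\<xi> i) * (?u' i - ?u i))"
      using \<xi>0 by (simp_all only: simp_thms)
    have near: "\<bar>\<xi> i j - Y j t\<bar> \<le> c n * M" and box: "\<xi> i j \<in> {- (2 * M)..2 * M}" if ij: "i \<le> r" "j \<le> r" for i j
    proof -
      have "\<bar>c n * H j t\<bar> \<le> c n * M"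
        using c(1)[of n] M(3)[OF ij(2) tS] by (simp add: abs_mult)
      then show near: "\<bar>\<xi> i j - Y j t\<bar> \<le> c n * M"
        using \<xi>(2)[OF ij] jet_y[OF ij(2)] jet_z[OF t ij(2), of n]
        by (auto simp: min_def max_def abs_if split: if_splits)
      have "c n * M \<le> M" using c[of n] M(1) by (simp add: mult_left_le_one_le)
      then show "\<xi> i j \<in> {- (2 * M)..2 * M}" using near M(2)[OF ij(2) tS] by auto
    qed
    have "real (Suc n) * (L t ?u' - L t ?u) = (\<Sum>i\<le>r. P i t (\<xi> i) * ((real (Suc n) * c n) * H i t))"
      unfolding \<xi>(3) sum_distrib_left using jet_y jet_z[OF t] by (intro sum.cong) (auto simp: mult_ac)
    then have "g n t = (\<Sum>i\<le>r. P i t (\<xi> i) * H i t)" using t unfolding c(3) by (simp add: g_def)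
    moreover have "\<xi> i \<in> {..r} \<rightarrow>\<^sub>E {- (2 * M)..2 * M}" if "i \<le> r" for i
      using \<xi>(1)[OF that] box[OF that] by (auto simp: PiE_iff)
    ultimately show ?thesis using near by blast
  qed
  have g_bound: "norm (g n t) \<le> (\<Sum>i\<le>r. C * M)" if t: "t \<in> S r" for n t
  proof (cases "t \<in> E")
    case True
    then show ?thesis using C(1) M(1) by (simp add: g_def)
  next
    case False
    then obtain \<xi> where \<xi>: "\<And>i. i \<le> r \<Longrightarrow> \<xi> i \<in> {..r} \<rightarrow>\<^sub>E {- (2 * M)..2 * M}"
      "g n t = (\<Sum>i\<le>r. P i t (\<xi> i) * H i t)" using mv[of t n] t by blast
    have "norm (\<Sum>i\<le>r. P i t (\<xi> i) * H i t) \<le> (\<Sum>i\<le>r. C * M)"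
      using C t \<xi>(1) M by (intro sum_norm_le) (auto simp: abs_mult intro!: mult_mono)
    then show ?thesis using \<xi>(2) by simp
  qed
  have c0: "c \<longlonglongrightarrow> 0" unfolding c_def by (rule LIMSEQ_inverse_real_of_nat)
  have g_lim: "(\<lambda>n. g n t) \<longlonglongrightarrow> G t" if t: "t \<in> S r" for t
  proof (cases "t \<in> E")
    case True
    then show ?thesis by (simp add: g_def G_def)
  next
    case False
    then have tE: "t \<in> S r - E" using t by simp
    have "\<forall>n. \<exists>\<xi>. (\<forall>i\<le>r. \<xi> i \<in> {..r} \<rightarrow>\<^sub>E {- (2 * M)..2 * M} \<and> (\<forall>j\<le>r. \<bar>\<xi> i j - Y j t\<bar> \<le> c n * M))
      \<and> g n t = (\<Sum>i\<le>r. P i t (\<xi> i) * H i t)"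
      by (rule allI) (rule mv[OF tE])
    then obtain \<xi> where \<xi>0: "\<forall>n. (\<forall>i\<le>r. \<xi> n i \<in> {..r} \<rightarrow>\<^sub>E {- (2 * M)..2 * M} \<and> (\<forall>j\<le>r. \<bar>\<xi> n i j - Y j t\<bar> \<le> c n * M))
      \<and> g n t = (\<Sum>i\<le>r. P i t (\<xi> n i) * H i t)"
      by (rule choice[THEN exE])
    have \<xi>: "\<And>n i. i \<le> r \<Longrightarrow> \<xi> n i \<in> {..r} \<rightarrow>\<^sub>E {- (2 * M)..2 * M}"
      "\<And>n i j. i \<le> r \<Longrightarrow> j \<le> r \<Longrightarrow> \<bar>\<xi> n i j - Y j t\<bar> \<le> c n * M"
      "\<And>n. g n t = (\<Sum>i\<le>r. P i t (\<xi> n i) * H i t)"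
      using \<xi>0 by (simp_all only: simp_thms)
    have "(\<lambda>n. P i t (\<xi> n i)) \<longlonglongrightarrow> P i t (jet T r y t)" if i: "i \<le> r" for i
    proof -
      have "(\<lambda>n. \<xi> n i) \<longlonglongrightarrow> jet T r y t"
      proof (rule tendsto_componentwiseI)
        fix j
        show "(\<lambda>n. \<xi> n i j) \<longlonglongrightarrow> jet T r y t j"
        proof (cases "j \<le> r")
          case True
          have "(\<lambda>n. c n * M) \<longlonglongrightarrow> 0" using tendsto_mult_left_zero[OF c0] .
          then have "(\<lambda>n. \<xi> n i j - Y j t) \<longlonglongrightarrow> 0"
            by (rule Lim_null_comparison[rotated]) (use \<xi>(2)[OF i True] in simp)
          then show ?thesis using jet_y[OF True] by (simp add: LIM_zero_iff)
        next
          case False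
          then have "\<xi> n i j = jet T r y t j" for n
            using \<xi>(1)[OF i, of n] jet_PiE[of y t] by (simp add: PiE_iff extensional_def)
          then show ?thesis by simp
        qed
      qed
      then have "(\<lambda>n. (t, \<xi> n i)) \<longlonglongrightarrow> (t, jet T r y t)" by (intro tendsto_Pair tendsto_const)
      moreover have "(t, \<xi> n i) \<in> S r \<times> ({..r} \<rightarrow>\<^sub>E UNIV)" for n
        using \<xi>(1)[OF i, of n] t by (auto simp: PiE_iff)
      moreover have "(t, jet T r y t) \<in> S r \<times> ({..r} \<rightarrow>\<^sub>E UNIV)" using t jet_PiE by simp
      ultimately have "(\<lambda>n. case (t, \<xi> n i) of (t, u) \<Rightarrow> partial_deriv L i t u)
          \<longlonglongrightarrow> (case (t, jet T r y t) of (t, u) \<Rightarrow> partial_deriv L i t u)"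
        by (intro continuous_on_tendsto_compose[OF L_partial_continuous[OF i]]) auto
      then show ?thesis by (simp add: P_def)
    qed
    then have "(\<lambda>n. \<Sum>i\<le>r. P i t (\<xi> n i) * H i t) \<longlonglongrightarrow> (\<Sum>i\<le>r. P i t (jet T r y t) * H i t)"
      by (intro tendsto_sum tendsto_mult_right) auto
    then show ?thesis using False by (simp add: \<xi>(3) G_def)
  qed
  have g_int: "(\<lambda>x. g n (rho K x)) integrable_on I"
    and g_val: "integral I (\<lambda>x. g n (rho K x)) = real (Suc n) * (action T r L (z n) - action T r L y)" for n
  proof -
    let ?q = "\<lambda>x. real (Suc n) * (L (rho K x) (jet T r (z n) (rho K x)) - L (rho K x) (jet T r y (rho K x)))"
    have "(?q has_integral real (Suc n) * (action T r L (z n) - action T r L y)) I"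
      unfolding I_def action_eq[OF adm] action_eq[OF z_adm]
      by (intro has_integral_mult_right has_integral_diff integrable_integral
          K.comp_rho_integrable[OF L_rd[OF adm]] K.comp_rho_integrable[OF L_rd[OF z_adm]])
    then have "((\<lambda>x. g n (rho K x)) has_integral real (Suc n) * (action T r L (z n) - action T r L y)) I"
      by (rule has_integral_spike_finite[OF finE, rotated]) (use off in \<open>auto simp: g_def\<close>)
    then show "(\<lambda>x. g n (rho K x)) integrable_on I"
      "integral I (\<lambda>x. g n (rho K x)) = real (Suc n) * (action T r L (z n) - action T r L y)"
      by (auto intro: integral_unique)
  qed
  have lim: "(\<lambda>n. integral I (\<lambda>x. g n (rho K x))) \<longlonglongrightarrow> integral I (\<lambda>x. G (rho K x))"
    by (rule dominated_convergence(2)[where h = "\<lambda>_. \<Sum>i\<le>r. C * M"])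
      (use g_int g_bound g_lim inS in \<open>auto simp: I_def simp del: sum_constant\<close>)
  have "\<forall>\<^sub>F n in sequentially. 0 \<le> integral I (\<lambda>x. g n (rho K x))"
  proof -
    obtain \<delta> where \<delta>: "\<delta> > 0" "\<And>w. admissible T r ya yb w \<Longrightarrow> prd_norm T r (\<lambda>t. y t - w t) < \<delta> \<Longrightarrow>
        action T r L y \<le> action T r L w"
      using y unfolding weak_local_minimizer_def by blast
    obtain B where B: "\<And>c. c \<noteq> 0 \<Longrightarrow> prd_norm T r (\<lambda>t. c * \<eta> t) \<le> \<bar>c\<bar> * B"
      using prd_norm_scale_le[OF \<eta>C] by blast
    have "(\<lambda>n. c n * B) \<longlonglongrightarrow> 0" using tendsto_mult_left_zero[OF c0] .
    then have "\<forall>\<^sub>F n in sequentially. c n * B < \<delta>" using \<delta>(1) by (rule order_tendstoD(2))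
    then show ?thesis
    proof eventually_elim
      case (elim n)
      have "(\<lambda>t. y t - z n t) = (\<lambda>t. (- c n) * \<eta> t)" by (auto simp: z_def)
      then have "prd_norm T r (\<lambda>t. y t - z n t) < \<delta>"
        using B[of "- c n"] c(1)[of n] elim by simp
      then show ?case using \<delta>(2)[OF z_adm] unfolding g_val by simp
    qed
  qed
  then have "0 \<le> integral I (\<lambda>x. G (rho K x))"
    by (intro tendsto_lowerbound[OF lim]) auto
  also have "integral I (\<lambda>x. G (rho K x))
      = integral I (\<lambda>x. \<Sum>i\<le>r. P i (rho K x) (jet T r y (rho K x)) * (delta_primitive K ^^ (r - i)) v (rho K x))"
  proof (rule integral_spike[OF negligible_finite[OF finE]])
    fix x assume x: "x \<in> I - E"
    have "H i (rho K x) = (delta_primitive K ^^ (r - i)) v (rho K x)" if i: "i \<le> r" for i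
    proof (cases "i = r")
      case True
      then show ?thesis using E2(3)[of "rho K x"] off[OF x] unfolding H_def E_def by simp
    next
      case False
      have "H i (rho K x) = variation v i (rho K x)"
        unfolding H_def \<eta>_def using delta_deriv_n_variation(1)[OF v, of i] False i off[OF x] S_antimono[OF i] by auto
      then show ?thesis
        using delta_primitive_power_K[OF K.le_Sup[OF K.rho_mem]] by simp
    qed
    then show "(\<Sum>i\<le>r. P i (rho K x) (jet T r y (rho K x)) * (delta_primitive K ^^ (r - i)) v (rho K x)) = G (rho K x)"
      using off[OF x] by (simp add: G_def)
  qed
  also have "\<dots> = (\<Sum>i\<le>r. integral I (\<lambda>x. P i (rho K x) (jet T r y (rho K x)) * (delta_primitive K ^^ (r - i)) v (rho K x)))"
    unfolding I_def P_def
    using K.comp_rho_integrable[OF K.piecewise_rd_continuous_mult[OF L_partial_rd[OF adm]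
          K.piecewise_rd_continuous_primitive_power[OF v]]]
    by (intro integral_sum) auto
  finally show ?thesis
    by (simp only: delta_pairing_def delta_primitive_def I_def P_def)
qed

section \<open>The Euler-Lagrange equation\<close>

text \<open>All entries of the jet are continuous at such a point, the top one because its existence as a derivative excludes
  a jump. This yields the equation at right-dense points, where integrals alone do not determine
  the value of a function.\<close>

lemma partial_tendsto_right_dense:
  assumes y: "admissible T r ya yb y" and i: "i \<le> r"
    and t: "t \<in> S r" "sigma K t = t" and D: "delta_differentiable_n T r y t"
  shows "((\<lambda>s. partial_deriv L i s (jet T r y s)) \<longlongrightarrow> partial_deriv L i t (jet T r y t)) (at t within S r)"
proof -
  have yC: "y \<in> C_prd T r" using y by (simp add: admissible_def)
  have "(jet T r y \<longlongrightarrow> jet T r y t) (at t within S r)"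
  proof (rule tendsto_componentwiseI)
    fix j
    consider "j < r" | "j = r" | "j > r" by linarith
    then show "((\<lambda>s. jet T r y s j) \<longlongrightarrow> jet T r y t j) (at t within S r)"
    proof cases
      case 1
      have "continuous_on (S r) (delta_deriv_n T j y)"
        by (rule continuous_on_subset[OF C_prdD(2)[OF yC 1] S_antimono]) (use 1 in simp)
      then show ?thesis using 1 t(1) by (simp add: jet_def continuous_on_def)
    next
      case 2
      have "has_delta_derivative K (delta_deriv_n T (r - 1) y) (delta_deriv_n T r y t) t"
        using delta_differentiable_n_SucD[of "r - 1" y t] D t r by simp
      then have "(delta_deriv_n T r y \<longlongrightarrow> delta_deriv_n T r y t) (at t within kappa K)"
        using K.delta_derivative_tendsto[OF C_prdD(3)[OF yC] top_derivative_antiderivative[OF yC]] t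
        unfolding kappa_K by blast
      then show ?thesis using 2 unfolding kappa_K by (simp add: jet_def)
    next
      case 3
      then show ?thesis by (simp add: jet_def)
    qed
  qed
  then have "((\<lambda>s. (s, jet T r y s)) \<longlongrightarrow> (t, jet T r y t)) (at t within S r)"
    by (intro tendsto_Pair tendsto_ident_at)
  moreover have "\<forall>\<^sub>F s in at t within S r. (s, jet T r y s) \<in> S r \<times> ({..r} \<rightarrow>\<^sub>E UNIV)"
    unfolding eventually_at_filter using jet_PiE by simp
  moreover have "(t, jet T r y t) \<in> S r \<times> ({..r} \<rightarrow>\<^sub>E UNIV)" using t(1) jet_PiE by simp
  ultimately have "((\<lambda>s. case (s, jet T r y s) of (t, u) \<Rightarrow> partial_deriv L i t u) \<longlongrightarrow>
      (case (t, jet T r y t) of (t, u) \<Rightarrow> partial_deriv L i t u)) (at t within S r)"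
    by (intro continuous_on_tendsto_compose[OF L_partial_continuous[OF i]])
  then show ?thesis by simp
qed

lemma sigma_integral_power_right_dense:
  assumes f: "piecewise_rd_continuous K f" and t: "t \<in> K" "sigma K t = t" and n: "n > 0"
  shows "((sigma_integral K ^^ n) f \<longlongrightarrow> (sigma_integral K ^^ n) f t) (at t within kappa K)"
  using n K.sigma_integral_right_dense[OF K.piecewise_rd_continuous_sigma_integral_power[OF f] t]
  by (cases n) auto

text \<open>The part of \<open>EL_lhs\<close> that is free of the constants, with the iterated integrals in a single sum.\<close>

definition EL_principal :: "(real \<Rightarrow> real) \<Rightarrow> real \<Rightarrow> real" where
  "EL_principal y t
    = (\<Sum>i\<le>r. (- 1) ^ (r - i) * (sigma_integral K ^^ (r - i)) (\<lambda>s. partial_deriv L i s (jet T r y s)) t)"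

text \<open>The lemma of du Bois-Reymond, with the direction chosen by orthogonal projection: subtract from the principal part
  its projection \<open>\<Sum> d\<^sub>j J\<^sup>j 1\<close>, and take the negative of the remainder \<open>w\<close> as the top derivative of a variation. Orthogonality
  to the \<open>J\<^sup>j 1\<close> makes it satisfy the boundary conditions, and the first variation becomes \<open>- \<langle>w, w\<rangle>\<close>.\<close>

lemma EL_principal_spanned:
  assumes y: "weak_local_minimizer T r L ya yb y"
  shows "\<exists>d. \<forall>t\<in>S r. delta_differentiable_n T r y t \<longrightarrow>
    EL_principal y t = (\<Sum>j<r. d j * (sigma_integral K ^^ j) (\<lambda>x. 1) t)"
proof -
  define p where "p i = (\<lambda>s. partial_deriv L i s (jet T r y s))" for i
  define e where "e j = (sigma_integral K ^^ j) (\<lambda>x. 1)" for j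
  let ?J = "sigma_integral K" and ?B = "delta_pairing K"
  have adm: "admissible T r ya yb y" using y by (simp add: weak_local_minimizer_def)
  have p: "piecewise_rd_continuous K (p i)" if "i \<le> r" for i
    unfolding p_def by (rule L_partial_rd[OF adm that])
  have Jp: "piecewise_rd_continuous K ((?J ^^ (r - i)) (p i))" if "i \<le> r" for i
    by (rule K.piecewise_rd_continuous_sigma_integral_power[OF p[OF that]])
  have e: "piecewise_rd_continuous K (e j)" for j
    unfolding e_def by (rule K.piecewise_rd_continuous_sigma_integral_power[OF K.piecewise_rd_continuous_const])
  have \<Psi>_eq: "EL_principal y = (\<lambda>t. \<Sum>i\<le>r. (- 1) ^ (r - i) * (?J ^^ (r - i)) (p i) t)"
    by (auto simp: EL_principal_def p_def)
  have \<Psi>: "piecewise_rd_continuous K (EL_principal y)"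
    unfolding \<Psi>_eq using Jp by (intro K.piecewise_rd_continuous_sum K.piecewise_rd_continuous_scale) auto
  obtain d where d: "piecewise_rd_continuous K (\<lambda>x. EL_principal y x - (\<Sum>j<r. d j * e j x))"
    "\<And>k. k < r \<Longrightarrow> ?B (\<lambda>x. EL_principal y x - (\<Sum>j<r. d j * e j x)) (e k) = 0"
    using K.ex_delta_pairing_projection[OF \<Psi>, of e r] e by blast
  define w where "w = (\<lambda>x. EL_principal y x - (\<Sum>j<r. d j * e j x))"
  define v where "v = (\<lambda>x. (- 1) * w x)"
  have w: "piecewise_rd_continuous K w" "\<And>k. k < r \<Longrightarrow> ?B w (e k) = 0" using d by (auto simp: w_def)
  have v: "piecewise_rd_continuous K v" unfolding v_def by (rule K.piecewise_rd_continuous_scale[OF w(1)])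
  have Bv: "?B v h = - ?B w h" if "piecewise_rd_continuous K h" for h
    using K.delta_pairing_linear[OF w(1) w(1) that, of "- 1" 0] by (simp add: v_def)
  have orth: "?B (e k) v = 0" if "k < r" for k
    using Bv[OF e] w(2)[OF that] K.delta_pairing_commute by simp
  have bd: "(delta_primitive K ^^ k) v (Sup K) = 0" if "0 < k" "k \<le> r" for k
    using K.primitive_power_Sup_eq_0[OF v _ that] orth unfolding e_def by blast
  \<comment> \<open>\<open>v\<close> is an admissible direction; the first variation in this direction is \<open>- \<langle>w, w\<rangle>\<close>\<close>
  have "0 \<le> (\<Sum>i\<le>r. ?B (p i) ((delta_primitive K ^^ (r - i)) v))"
    using first_variation_nonneg[OF y v bd] unfolding p_def by blast
  also have "\<dots> = (\<Sum>i\<le>r. (- 1) ^ (r - i) * ?B ((?J ^^ (r - i)) (p i)) v)"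
    using bd by (intro sum.cong K.delta_pairing_primitive_power p v) auto
  also have "\<dots> = ?B (EL_principal y) v"
    unfolding \<Psi>_eq using Jp by (intro K.delta_pairing_sum[symmetric] v) auto
  also have "\<dots> = ?B (\<lambda>x. 1 * w x + 1 * (\<Sum>j<r. d j * e j x)) v" by (simp add: w_def)
  also have "\<dots> = 1 * ?B w v + 1 * ?B (\<lambda>x. \<Sum>j<r. d j * e j x) v"
    using e by (intro K.delta_pairing_linear w v K.piecewise_rd_continuous_sum K.piecewise_rd_continuous_scale)
  also have "?B (\<lambda>x. \<Sum>j<r. d j * e j x) v = 0"
    unfolding K.delta_pairing_sum[OF finite_lessThan e v] using orth by simp
  finally have "?B w w \<le> 0" using Bv[OF w(1)] K.delta_pairing_commute[of w v] by simp
  then have zero: "?B w w = 0" using K.delta_pairing_nonneg[OF w(1)] by simp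
  have "w t = 0" if t: "t \<in> S r" and D: "delta_differentiable_n T r y t" for t
  proof (rule K.delta_pairing_definite[OF w(1) zero])
    show "t \<in> kappa K" using t unfolding kappa_K .
    then have tK: "t \<in> K" using K.kappa_subset by blast
    show "Inf K < Sup K" by (rule Inf_less_Sup) simp
    assume dense: "sigma K t = t"
    have "((?J ^^ (r - i)) (p i) \<longlongrightarrow> (?J ^^ (r - i)) (p i) t) (at t within kappa K)" if i: "i \<le> r" for i
    proof (cases "i = r")
      case True
      then show ?thesis
        using partial_tendsto_right_dense[OF adm i t dense D] unfolding kappa_K p_def by simp
    next
      case False
      then show ?thesis using i by (intro sigma_integral_power_right_dense p tK dense) auto
    qed
    moreover have "(e j \<longlongrightarrow> e j t) (at t within kappa K)" for j
    proof (cases "j = 0")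
      case False
      then show ?thesis unfolding e_def
        by (intro sigma_integral_power_right_dense K.piecewise_rd_continuous_const tK dense) auto
    qed (simp add: e_def)
    ultimately show "(w \<longlongrightarrow> w t) (at t within kappa K)"
      unfolding w_def \<Psi>_eq by (intro tendsto_intros) auto
  qed
  then show ?thesis unfolding w_def e_def by (intro exI[of _ d]) auto
qed

lemma EL_lhs_eq:
  assumes p0: "piecewise_rd_continuous K (\<lambda>s. partial_deriv L 0 s (jet T r y s))"
  shows "EL_lhs T r L y c t
    = EL_principal y t - (\<Sum>j=1..r. (- 1) ^ (r + j) * c j * (sigma_integral K ^^ (r - j)) (\<lambda>x. 1) t)"
proof -
  define p where "p i = (\<lambda>s. partial_deriv L i s (jet T r y s))" for i
  let ?J = "sigma_integral K"
  have nested: "?J (EL_nested K (p 0) c (r - 1)) t = EL_nested K (p 0) c r t + (- 1) ^ r * c r"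
    using r by (cases r) auto
  have N: "EL_nested K (p 0) c r t = (?J ^^ r) (p 0) t - (\<Sum>j=1..r. (- 1) ^ j * c j * (?J ^^ (r - j)) (\<lambda>x. 1) t)"
    using K.EL_nested_eq[OF p0, of c r] unfolding p_def by simp
  have split: "EL_lhs T r L y c t = (\<Sum>m<r. (- 1) ^ m * (?J ^^ m) (p (r - m)) t) + (- 1) ^ r * EL_nested K (p 0) c r t"
  proof (cases "r = 1")
    case True
    then show ?thesis by (simp add: EL_lhs_def Let_def p_def)
  next
    case False
    then have "r \<ge> 2" using r by simp
    then obtain q where q: "r = Suc (Suc q)" using le_Suc_ex[of 2 r] by auto
    have "EL_lhs T r L y c t = p r t - ?J (p (r - 1)) t + (\<Sum>i<r - 2. (- 1) ^ i * (?J ^^ (i + 2)) (p (r - 2 - i)) t)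
        + (- 1) ^ r * ?J (EL_nested K (p 0) c (r - 1)) t - c r"
      using False unfolding EL_lhs_def Let_def p_def by (simp only: if_False)
    also have "\<dots> = p r t - ?J (p (r - 1)) t + (\<Sum>i<r - 2. (- 1) ^ i * (?J ^^ (i + 2)) (p (r - 2 - i)) t)
        + (- 1) ^ r * EL_nested K (p 0) c r t"
      unfolding nested by (simp add: distrib_left flip: power_add mult.assoc)
    also have "p r t - ?J (p (r - 1)) t + (\<Sum>i<r - 2. (- 1) ^ i * (?J ^^ (i + 2)) (p (r - 2 - i)) t)
        = (\<Sum>m<r. (- 1) ^ m * (?J ^^ m) (p (r - m)) t)"
      unfolding q sum.lessThan_Suc_shift by simp
    finally show ?thesis .
  qed
  have "EL_principal y t = (\<Sum>m\<le>r. (- 1) ^ m * (?J ^^ m) (p (r - m)) t)"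
    unfolding EL_principal_def p_def[symmetric]
    by (rule sum.reindex_bij_witness[of _ "\<lambda>m. r - m" "\<lambda>i. r - i"]) auto
  also have "\<dots> = (\<Sum>m<r. (- 1) ^ m * (?J ^^ m) (p (r - m)) t) + (- 1) ^ r * (?J ^^ r) (p 0) t"
    by (simp flip: lessThan_Suc_atMost)
  finally show ?thesis
    unfolding split N by (simp add: right_diff_distrib sum_distrib_left power_add mult.assoc)
qed

theorem Euler_Lagrange:
  assumes y: "weak_local_minimizer T r L ya yb y"
  shows "\<exists>c. \<forall>t\<in>S r. delta_differentiable_n T r y t \<longrightarrow> EL_lhs T r L y c t = 0"
proof -
  obtain d where d: "\<And>t. t \<in> S r \<Longrightarrow> delta_differentiable_n T r y t \<Longrightarrow>
    EL_principal y t = (\<Sum>j<r. d j * (sigma_integral K ^^ j) (\<lambda>x. 1) t)"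
    using EL_principal_spanned[OF y] by blast
  have p0: "piecewise_rd_continuous K (\<lambda>s. partial_deriv L 0 s (jet T r y s))"
    using y by (intro L_partial_rd) (auto simp: weak_local_minimizer_def)
  define c where "c j = (- 1) ^ (r + j) * d (r - j)" for j
  have "(\<Sum>j=1..r. (- 1) ^ (r + j) * c j * (sigma_integral K ^^ (r - j)) (\<lambda>x. 1) t)
      = (\<Sum>j<r. d j * (sigma_integral K ^^ j) (\<lambda>x. 1) t)" for t
  proof -
    have "(- 1) ^ (r + j) * c j = d (r - j)" for j
      by (simp add: c_def flip: mult.assoc power_add)
    then show ?thesis
      by (intro sum.reindex_bij_witness[of _ "\<lambda>j. r - j" "\<lambda>j. r - j"]) auto
  qed
  then show ?thesis
    using d by (intro exI[of _ c]) (simp add: EL_lhs_eq[OF p0] del: One_nat_def)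
qed

end

theorem theorem1:
  fixes T :: "real set" and r :: nat and a b :: real
    and L :: "real \<Rightarrow> (nat \<Rightarrow> real) \<Rightarrow> real"
    and ya yb :: "nat \<Rightarrow> real"
    and y :: "real \<Rightarrow> real"
  assumes "r \<ge> 1"
    and "time_scale T" and "bounded T" and "infinite T \<or> card T \<ge> 2 * r + 1"
    and "a = Inf T" and "b = Sup T"
    and "\<And>i t u. i \<le> r \<Longrightarrow> t \<in> T \<inter> {a..(rho T ^^ r) b} \<Longrightarrow> u \<in> {..r} \<rightarrow>\<^sub>E (UNIV :: real set) \<Longrightarrow>
           (\<lambda>x. L t (u(i := x))) differentiable at (u i)"
    and "\<And>i. i \<le> r \<Longrightarrow>
           continuous_on ((T \<inter> {a..(rho T ^^ r) b}) \<times> ({..r} \<rightarrow>\<^sub>E (UNIV :: real set)))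
             (\<lambda>(t, u). partial_deriv L i t u)"
    and "\<And>z. admissible T r ya yb z \<Longrightarrow>
           piecewise_rd_continuous ((kappa ^^ (r - 1)) T) (\<lambda>t. L t (jet T r z t))"
    and "\<And>z i. admissible T r ya yb z \<Longrightarrow> i \<le> r \<Longrightarrow>
           piecewise_rd_continuous ((kappa ^^ (r - 1)) T) (\<lambda>t. partial_deriv L i t (jet T r z t))"
    and "weak_local_minimizer T r L ya yb y"
  shows "\<exists>c :: nat \<Rightarrow> real. \<forall>t \<in> T \<inter> {a..(rho T ^^ r) b}.
           delta_differentiable_n T r y t \<longrightarrow> EL_lhs T r L y c t = 0"
proof -
  have S: "T \<inter> {a..(rho T ^^ r) b} = (kappa ^^ r) T"
    using kappa_iterate(1)[OF assms(2,3)] assms(5,6) by simp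
  interpret variational_problem T r L ya yb
  proof
    show "time_scale T" "bounded T" "r \<ge> 1" "infinite T \<or> card T \<ge> 2 * r + 1" by fact+
  qed (use assms(7-10) in \<open>simp_all only: S\<close>)
  show ?thesis unfolding S by (rule Euler_Lagrange) fact
qed

end
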